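(* In $\mathbb{Z}[t][[u]]$, \[ \sum_{n=2}^\infty P_{W_n}(t) u^{n}=\frac{2 (u-1)}{\sqrt{(u-1)^2-4 t u^2}-u+1}-\frac{2 \left(u^2+u-1\right)}{(u+1) \left(\sqrt{(u-1)^2-4 t u^2}+u+1\right)}+\frac{2 u}{(u+1) \sqrt{(u-1)^2-4 t u^2}}, \] where the square root is the power series in $u$ with constant term $1$.
   Context: For a matroid $M$ let $L(M)$ be its lattice of flats, $\mathrm{rk}\, M$ its rank, $\chi_M(t)$ its characteristic polynomial; for a flat $F$, $M_F$ is the localization (restriction to $F$) and $M^F$ the contraction at $F$. The Kazhdan–Lusztig polynomial is the unique assignment of $P_M(t)\in\mathbb{Z}[t]$ to each loopless matroid $M$ with: $P_M=1$ if $\mathrm{rk}\, M=0$; $\deg P_M<\frac12\mathrm{rk}\, M$ if $\mathrm{rk}\, M>0$; $t^{\mathrm{rk}\, M}P_M(t^{-1})=\sum_{F\in L(M)}\chi_{M_F}(t)P_{M^F}(t)$. For a graph $G$, $P_G=P_{M(G)}$. For $n\ge3$ the wheel $W_n$ has vertices $0,\dots,n$, the edges of the cycle $1,2,\dots,n,1$ and edges $\{0,i\}$ ($1\le i\le n$); $W_2$ denotes the simple cycle (triangle) on three vertices $0,1,2$. *)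

theory Defs
  imports
    "HOL-Library.FuncSet"
    "HOL-Computational_Algebra.Computational_Algebra"
begin

section \<open>Matroids\<close>

record 'a set_system =
  ground :: "'a set"
  indep :: "'a set set"

definition matroid :: "'a set_system \<Rightarrow> bool" where
  "matroid M \<longleftrightarrow>
     finite (ground M) \<and> indep M \<subseteq> Pow (ground M) \<and> {} \<in> indep M \<and>
     (\<forall>J\<in>indep M. \<forall>I\<subseteq>J. I \<in> indep M) \<and>
     (\<forall>I\<in>indep M. \<forall>J\<in>indep M. card I < card J \<longrightarrow> (\<exists>x\<in>J - I. insert x I \<in> indep M))"

definition loopless :: "'a set_system \<Rightarrow> bool" where
  "loopless M \<longleftrightarrow> (\<forall>x\<in>ground M. {x} \<in> indep M)"

definition rank_in :: "'a set_system \<Rightarrow> 'a set \<Rightarrow> nat" where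
  "rank_in M X = Max (card ` {I \<in> indep M. I \<subseteq> X})"

definition rk :: "'a set_system \<Rightarrow> nat" where
  "rk M = rank_in M (ground M)"

definition flats :: "'a set_system \<Rightarrow> 'a set set" where
  "flats M = {F. F \<subseteq> ground M \<and> (\<forall>x\<in>ground M - F. rank_in M F < rank_in M (insert x F))}"

definition localization :: "'a set_system \<Rightarrow> 'a set \<Rightarrow> 'a set_system" where
  "localization M F = \<lparr>ground = F, indep = {I \<in> indep M. I \<subseteq> F}\<rparr>"

definition contraction :: "'a set_system \<Rightarrow> 'a set \<Rightarrow> 'a set_system" where
  "contraction M F =
     \<lparr>ground = ground M - F,
      indep = {I. I \<subseteq> ground M - F \<and> rank_in M (I \<union> F) = card I + rank_in M F}\<rparr>"


section \<open>The characteristic polynomial\<close>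

text \<open>The Moebius function of a family \<open>L\<close> of finite sets ordered by inclusion. For \<open>Y\<close> infinite
  the value is a dummy.\<close>

function mobius :: "'a set set \<Rightarrow> 'a set \<Rightarrow> 'a set \<Rightarrow> int" where
  "mobius L X Y =
     (if X = Y then 1
      else if infinite Y then 0
      else - (\<Sum>Z \<in> {Z \<in> L. X \<subseteq> Z \<and> Z \<subset> Y}. mobius L X Z))"
  by pat_completeness auto
termination
  by (relation "measure (\<lambda>(L, X, Y). card Y)") (auto intro: psubset_card_mono)

declare mobius.simps [simp del]

text \<open>The least flat \<open>\<Inter>(flats M)\<close> is empty exactly for loopless matroids.\<close>

definition char_poly :: "'a set_system \<Rightarrow> int poly" where
  "char_poly M =
     (\<Sum>F\<in>flats M. monom (mobius (flats M) (\<Inter>(flats M)) F) (rk M - rank_in M F))"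


section \<open>Kazhdan--Lusztig polynomials\<close>

text \<open>\<open>t_rev n p\<close> is $t^n p(t^{-1})$, which is a polynomial as soon as \<open>degree p \<le> n\<close>; recall that
  \<open>reflect_poly p\<close> is $t^{\deg p} p(t^{-1})$.\<close>

definition t_rev :: "nat \<Rightarrow> int poly \<Rightarrow> int poly" where
  "t_rev n p = monom 1 (n - degree p) * reflect_poly p"

definition kl_assignment :: "('a set_system \<Rightarrow> int poly) \<Rightarrow> bool" where
  "kl_assignment P \<longleftrightarrow>
     (\<forall>M. matroid M \<and> loopless M \<longrightarrow>
        (rk M = 0 \<longrightarrow> P M = 1) \<and>
        (rk M > 0 \<longrightarrow> 2 * degree (P M) < rk M) \<and>
        t_rev (rk M) (P M) =
          (\<Sum>F\<in>flats M. char_poly (localization M F) * P (contraction M F)))"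

text \<open>The assignment is pinned down on loopless matroids only; \<open>extensional\<close> fixes the irrelevant
  remaining values.\<close>

definition KL_poly :: "'a set_system \<Rightarrow> int poly" where
  "KL_poly = (THE P. P \<in> extensional {M. matroid M \<and> loopless M} \<and> kl_assignment P)"


section \<open>Graphs and wheels\<close>

text \<open>Simple graphs; edges are two-element sets of vertices.\<close>

record 'v sgraph =
  verts :: "'v set"
  edges :: "'v set set"

definition is_cycle :: "'v set set \<Rightarrow> 'v list \<Rightarrow> bool" where
  "is_cycle A vs \<longleftrightarrow>
     length vs \<ge> 3 \<and> distinct vs \<and>
     (\<forall>i<length vs. {vs ! i, vs ! (Suc i mod length vs)} \<in> A)"

definition graphic_matroid :: "'v sgraph \<Rightarrow> 'v set set_system" where
  "graphic_matroid G =
     \<lparr>ground = edges G, indep = {A. A \<subseteq> edges G \<and> (\<nexists>vs. is_cycle A vs)}\<rparr>"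

definition KL_graph :: "'v sgraph \<Rightarrow> int poly" where
  "KL_graph G = KL_poly (graphic_matroid G)"

text \<open>Meant for \<open>n \<ge> 2\<close>. For \<open>n = 2\<close> the rim degenerates to the single edge \<open>{1, 2}\<close>, and the graph
  is the triangle.\<close>

definition wheel :: "nat \<Rightarrow> nat sgraph" where
  "wheel n =
     \<lparr>verts = {0..n},
      edges = {{i, i + 1} | i. 1 \<le> i \<and> i < n} \<union> {{n, 1}} \<union> {{0, i} | i. 1 \<le> i \<and> i \<le> n}\<rparr>"

lemma wheel_2: "wheel 2 = \<lparr>verts = {0, 1, 2}, edges = {{0, 1}, {1, 2}, {0, 2}}\<rparr>"
proof -
  have "{{i, i + 1} | i::nat. 1 \<le> i \<and> i < 2} = {{1, 2}}"
  proof -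
    have "1 \<le> i \<and> i < 2 \<longleftrightarrow> i = 1" for i :: nat by auto
    then show ?thesis by (simp add: numeral_2_eq_2)
  qed
  moreover have "{{0, i} | i::nat. 1 \<le> i \<and> i \<le> 2} = {{0, 1}, {0, 2}}"
  proof -
    have "1 \<le> i \<and> i \<le> 2 \<longleftrightarrow> i = 1 \<or> i = 2" for i :: nat by auto
    then show ?thesis by auto
  qed
  moreover have "{0..2::nat} = {0, 1, 2}" by auto
  ultimately show ?thesis
    unfolding wheel_def by (auto simp: insert_commute)
qed


section \<open>Power series over the integer polynomials\<close>

definition fps_sqrt1 :: "'a::idom fps \<Rightarrow> 'a fps" where
  "fps_sqrt1 a = (THE s. s ^ 2 = a \<and> fps_nth s 0 = 1)"

text \<open>The denominators in the closed form have constant terms $2$ and $1$, so they are nonzero but not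
  all units of $\mathbf{Z}[t][[u]]$; the identity is therefore written in the fraction field of
  $\mathbf{Z}[t][[u]]$, in which $\mathbf{Z}[t][[u]]$ embeds via \<open>to_fract\<close>.\<close>

definition wheel_KL_series :: "int poly fps" where
  "wheel_KL_series = Abs_fps (\<lambda>n. if n \<ge> 2 then KL_graph (wheel n) else 0)"

end

theory Submission
  imports Defs
begin

text \<open>
  The Kazhdan--Lusztig polynomials are characterized, without characteristic polynomials, by their
  degree bound and the palindromicity of $Z_M(t) = \sum_F t^{\mathrm{rk} F} P_{M^F}(t)$ for all loopless
  $M$. Hence a family of polynomials indexed by the flats of a single matroid consists of its
  $P_{M^F}$ as soon as it satisfies the degree bound and the palindromicity above every flat. For the
  wheel, flats are encoded by cyclic words. Contracting a flat yields, up to simplification, a smaller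
  wheel or a direct sum of fans, so that the candidates are Motzkin polynomials for the fans and the
  coefficients of the closed form for the wheels. The transfer matrix method computes the generating
  functions of the sums $Z$, in which the insertion of rim edges amounts to the substitution
  $u \mapsto u / (1 - t u)$. Both come out as rational functions of the series $R$ with
  $R = u (1 + R) (1 + t R)$ whose palindromicity can be read off.
\<close>

section \<open>Matroids: rank, minors and flats\<close>

text \<open>The obstacle is that contractions of a wheel have parallel edges and fall apart into
  direct sums, so an induction over graphs would need invariance of P under simplification and
  isomorphism, and its multiplicativity. Comparing candidates flat by flat inside one matroid, from
  the top of its lattice downwards, avoids all of this. The corank of a flat is the number of its
  \<open>Start\<close> letters, with one exception: the full rim has no \<open>Start\<close> but
  corank 1. This word and the excluded words (a single \<open>Start\<close>, no \<open>Hub\<close>)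
  disturb the letter-by-letter summation. Both are absorbed by the closed form, whose coefficients
  at u^0 and u^1 vanish: such words stay in the sums with weight 0, and the true contribution
  t^(k-1) of the full rim above a flat with k letters \<open>Start\<close> and no \<open>Hub\<close>
  is added separately. Cyclic words are cut open, and the last run is merged with the first.
  Counting the ways in which the cut divides a merged run produces a derivative, and implicit
  differentiation of the Motzkin equation is the source of the denominator 1 - t R^2.\<close>

lemma matroidD:
  assumes "matroid M"
  shows matroid_finite: "finite (ground M)"
    and indep_subset: "I \<in> indep M \<Longrightarrow> I \<subseteq> ground M"
    and indep_empty: "{} \<in> indep M"
    and indep_mono: "J \<in> indep M \<Longrightarrow> I \<subseteq> J \<Longrightarrow> I \<in> indep M"
    and indep_augment: "I \<in> indep M \<Longrightarrow> J \<in> indep M \<Longrightarrow> card I < card J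
      \<Longrightarrow> \<exists>x\<in>J - I. insert x I \<in> indep M"
  using assms unfolding matroid_def by blast+

lemma indep_finite: "matroid M \<Longrightarrow> I \<in> indep M \<Longrightarrow> finite I"
  using matroid_finite indep_subset finite_subset by metis

lemma finite_indep_cards: "matroid M \<Longrightarrow> finite (card ` {I \<in> indep M. I \<subseteq> X})"
proof -
  assume "matroid M"
  then have "indep M \<subseteq> Pow (ground M)" "finite (Pow (ground M))"
    using indep_subset matroid_finite by auto
  then have "finite (indep M)" by (rule finite_subset)
  then show ?thesis by simp
qed

lemma card_le_rank_in:
  assumes "matroid M" "I \<in> indep M" "I \<subseteq> X"
  shows "card I \<le> rank_in M X"
  unfolding rank_in_def using assms by (intro Max_ge finite_indep_cards) auto

lemma rank_in_basis:
  assumes "matroid M"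
  obtains I where "I \<in> indep M" "I \<subseteq> X" "card I = rank_in M X"
proof -
  have "rank_in M X \<in> card ` {I \<in> indep M. I \<subseteq> X}"
    unfolding rank_in_def using assms indep_empty by (intro Max_in finite_indep_cards) auto
  then show ?thesis using that by auto
qed

lemma rank_in_mono:
  assumes "matroid M" "X \<subseteq> Y"
  shows "rank_in M X \<le> rank_in M Y"
proof -
  obtain I where "I \<in> indep M" "I \<subseteq> X" "card I = rank_in M X" using rank_in_basis[OF assms(1)] .
  then show ?thesis using card_le_rank_in[OF assms(1), of I Y] assms(2) by auto
qed

lemma rank_in_insert_ge: "matroid M \<Longrightarrow> rank_in M X \<le> rank_in M (insert x X)"
  by (rule rank_in_mono) auto

lemma indep_extend:
  assumes M: "matroid M" and I: "I \<in> indep M" "I \<subseteq> X"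
  obtains J where "J \<in> indep M" "I \<subseteq> J" "J \<subseteq> X" "card J = rank_in M X"
proof -
  have "\<exists>J\<in>indep M. I \<subseteq> J \<and> J \<subseteq> X \<and> card J = rank_in M X"
    using I
  proof (induction "rank_in M X - card I" arbitrary: I rule: less_induct)
    case less
    show ?case
    proof (cases "card I < rank_in M X")
      case True
      obtain B where B: "B \<in> indep M" "B \<subseteq> X" "card B = rank_in M X"
        using rank_in_basis[OF M] .
      then obtain x where x: "x \<in> B - I" "insert x I \<in> indep M"
        using indep_augment[OF M less.prems(1) B(1)] True by auto
      have c: "card (insert x I) = Suc (card I)"
        using x indep_finite[OF M less.prems(1)] by auto
      have "rank_in M X - card (insert x I) < rank_in M X - card I" using c True by auto
      then obtain J where "J\<in>indep M" "insert x I \<subseteq> J" "J \<subseteq> X" "card J = rank_in M X"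
        using less.hyps[of "insert x I"] x B less.prems by blast
      then show ?thesis by auto
    next
      case False
      then show ?thesis using less.prems card_le_rank_in[OF M less.prems] by (intro bexI[of _ I]) auto
    qed
  qed
  then show ?thesis using that by auto
qed

lemma rank_in_indep:
  assumes "matroid M" "I \<in> indep M"
  shows "rank_in M I = card I"
proof -
  obtain J where J: "J \<in> indep M" "I \<subseteq> J" "J \<subseteq> I" "card J = rank_in M I"
    using indep_extend[OF assms, of I] by auto
  have "J = I" using J(2,3) by auto
  then show ?thesis using J(4) by simp
qed

lemma rank_in_empty: "matroid M \<Longrightarrow> rank_in M {} = 0"
  using rank_in_indep[of M "{}"] indep_empty by auto

lemma indep_iff_rank_in:
  assumes "matroid M" "I \<subseteq> ground M"
  shows "I \<in> indep M \<longleftrightarrow> rank_in M I = card I"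
proof
  assume *: "rank_in M I = card I"
  obtain J where J: "J \<in> indep M" "J \<subseteq> I" "card J = rank_in M I" using rank_in_basis[OF assms(1)] .
  have "finite I" using assms matroid_finite finite_subset by metis
  then have "J = I" using J * card_subset_eq by metis
  then show "I \<in> indep M" using J by simp
qed (simp add: rank_in_indep assms)

lemma rank_in_union_le:
  assumes M: "matroid M" and "finite I"
  shows "rank_in M (I \<union> F) \<le> card I + rank_in M F"
proof -
  obtain J where J: "J \<in> indep M" "J \<subseteq> I \<union> F" "card J = rank_in M (I \<union> F)"
    using rank_in_basis[OF M] .
  have "J \<inter> F \<in> indep M" using indep_mono[OF M J(1)] by auto
  then have 1: "card (J \<inter> F) \<le> rank_in M F" using card_le_rank_in[OF M] by auto
  have 2: "card (J - F) \<le> card I" using J(2) assms(2) by (intro card_mono) auto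
  have "card J \<le> card (J - F) + card (J \<inter> F)"
    by (metis Diff_Diff_Int Int_Diff_Un add.commute card_Un_le)
  then show ?thesis using 1 2 J(3) by simp
qed

lemma rank_in_insert_le:
  "matroid M \<Longrightarrow> rank_in M (insert x F) \<le> Suc (rank_in M F)"
  using rank_in_union_le[of M "{x}" F] by auto

text \<open>If \<open>x\<close> raised the rank of \<open>Y\<close>, a basis of
  \<open>insert x Y\<close> grown from a basis \<open>I\<close> of \<open>X\<close> would contain
  \<open>x\<close>, and \<open>insert x I\<close> would be too large for the rank of
  \<open>insert x X\<close>.\<close>

lemma closure_mono:
  assumes M: "matroid M" and "X \<subseteq> Y" and eq: "rank_in M (insert x X) = rank_in M X"
  shows "rank_in M (insert x Y) = rank_in M Y"
proof (rule ccontr)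
  assume "rank_in M (insert x Y) \<noteq> rank_in M Y"
  then have gt: "rank_in M Y < rank_in M (insert x Y)"
    using rank_in_insert_ge[OF M, of Y x] by simp
  obtain I where I: "I \<in> indep M" "I \<subseteq> X" "card I = rank_in M X"
    using rank_in_basis[OF M] .
  obtain J where J: "J \<in> indep M" "I \<subseteq> J" "J \<subseteq> Y" "card J = rank_in M Y"
    using indep_extend[OF M I(1), of Y] I(2) assms(2) by auto
  obtain K where K: "K \<in> indep M" "J \<subseteq> K" "K \<subseteq> insert x Y" "card K = rank_in M (insert x Y)"
    using indep_extend[OF M J(1), of "insert x Y"] J(3) by auto
  have "K \<inter> Y \<in> indep M" using K(1) indep_mono[OF M] by blast
  then have "card (K \<inter> Y) \<le> rank_in M Y" using card_le_rank_in[OF M] by blast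
  then have "K \<inter> Y \<noteq> K" using K gt by auto
  then have "x \<in> K" "x \<notin> Y" using K(3) by auto
  then have "insert x I \<in> indep M" "x \<notin> I"
    using indep_mono[OF M K(1), of "insert x I"] J K I assms(2) by auto
  then have "Suc (card I) \<le> rank_in M (insert x X)"
    using card_le_rank_in[OF M, of "insert x I" "insert x X"] I indep_finite[OF M I(1)] by auto
  then show False using eq I by auto
qed

section \<open>Flats and their ranks\<close>

lemma flat_subset: "F \<in> flats M \<Longrightarrow> F \<subseteq> ground M"
  by (simp add: flats_def)

lemma finite_flats: "matroid M \<Longrightarrow> finite (flats M)"
  by (rule finite_subset[of _ "Pow (ground M)"]) (auto simp: flats_def matroid_finite)

lemma flat_iff:
  assumes "matroid M" "F \<subseteq> ground M"
  shows "F \<in> flats M \<longleftrightarrow> (\<forall>x\<in>ground M - F. rank_in M (insert x F) \<noteq> rank_in M F)"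
proof -
  have "rank_in M F < rank_in M (insert x F) \<longleftrightarrow> rank_in M (insert x F) \<noteq> rank_in M F" for x
    using rank_in_insert_ge[OF assms(1), of F x] by linarith
  then show ?thesis using assms(2) unfolding flats_def by auto
qed

lemma rank_in_le_rk: "matroid M \<Longrightarrow> X \<subseteq> ground M \<Longrightarrow> rank_in M X \<le> rk M"
  unfolding rk_def by (rule rank_in_mono)

lemma flat_rank_less:
  assumes "matroid M" "F \<in> flats M" "F \<noteq> ground M"
  shows "rank_in M F < rk M"
proof -
  obtain x where "x \<in> ground M - F" using assms flat_subset by blast
  then have "rank_in M F < rank_in M (insert x F)" "insert x F \<subseteq> ground M"
    using assms flat_subset[OF assms(2)] by (auto simp: flats_def)
  then show ?thesis using rank_in_le_rk[OF assms(1), of "insert x F"] by auto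
qed

lemma empty_flat:
  assumes "matroid M" "loopless M"
  shows "{} \<in> flats M"
proof -
  have "rank_in M {x} = 1" if "x \<in> ground M" for x
    using rank_in_indep[of M "{x}"] assms that by (auto simp: loopless_def)
  then show ?thesis using assms by (auto simp: flats_def rank_in_empty)
qed

lemma rk_eq_0_iff:
  assumes "matroid M" "loopless M"
  shows "rk M = 0 \<longleftrightarrow> ground M = {}"
proof
  assume "rk M = 0"
  moreover have "rank_in M {} < rk M" if "ground M \<noteq> {}"
    using flat_rank_less[OF assms(1) empty_flat[OF assms]] that by metis
  ultimately show "ground M = {}" by auto
qed (simp add: rk_def rank_in_empty assms)

subsection \<open>Contraction\<close>

lemma contraction_simps [simp]:
  "ground (contraction M F) = ground M - F"
  by (simp add: contraction_def)

lemma indep_contraction: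
  assumes M: "matroid M" and F: "F \<subseteq> ground M"
    and B: "B \<in> indep M" "B \<subseteq> F" "card B = rank_in M F"
  shows "I \<in> indep (contraction M F) \<longleftrightarrow> I \<subseteq> ground M - F \<and> I \<union> B \<in> indep M"
proof (cases "I \<subseteq> ground M - F")
  case True
  have finI: "finite I" using True matroid_finite[OF M] finite_subset by blast
  have finB: "finite B" using B indep_finite[OF M] by blast
  have cIB: "card (I \<union> B) = card I + card B"
    using True B finI finB by (intro card_Un_disjoint) auto
  have "rank_in M (I \<union> F) = card I + rank_in M F \<longleftrightarrow> I \<union> B \<in> indep M"
  proof
    assume *: "rank_in M (I \<union> F) = card I + rank_in M F"
    obtain J where J: "J \<in> indep M" "B \<subseteq> J" "J \<subseteq> I \<union> F" "card J = rank_in M (I \<union> F)"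
      using indep_extend[OF M B(1), of "I \<union> F"] B by auto
    have "J \<inter> F \<in> indep M" using J indep_mono[OF M] by blast
    then have "card (J \<inter> F) \<le> card B" using card_le_rank_in[OF M] B by auto
    then have "J \<inter> F = B" using J B indep_finite[OF M J(1)]
      by (intro card_seteq[symmetric]) auto
    then have "J \<subseteq> I \<union> B" using J by auto
    moreover have "card J = card (I \<union> B)" using J * cIB B by simp
    ultimately have "J = I \<union> B" using finI finB card_subset_eq by (metis finite_UnI)
    then show "I \<union> B \<in> indep M" using J by simp
  next
    assume "I \<union> B \<in> indep M"
    then have "card I + card B \<le> rank_in M (I \<union> F)"
      using card_le_rank_in[OF M, of "I \<union> B" "I \<union> F"] B cIB by auto
    then show "rank_in M (I \<union> F) = card I + rank_in M F"
      using rank_in_union_le[OF M finI, of F] B by auto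
  qed
  then show ?thesis using True by (simp add: contraction_def)
qed (simp add: contraction_def)

lemma matroid_contraction:
  assumes M: "matroid M" and F: "F \<subseteq> ground M"
  shows "matroid (contraction M F)"
proof -
  obtain B where B: "B \<in> indep M" "B \<subseteq> F" "card B = rank_in M F"
    using rank_in_basis[OF M] .
  note iff = indep_contraction[OF M F B]
  have aug: "\<exists>x\<in>J - I. insert x I \<in> indep (contraction M F)"
    if I: "I \<in> indep (contraction M F)" and J: "J \<in> indep (contraction M F)" and c: "card I < card J" for I J
  proof -
    have fin: "finite (I \<union> B)" "finite (J \<union> B)" using I J iff indep_finite[OF M] by blast+
    moreover have "I \<inter> B = {}" "J \<inter> B = {}" using I J iff B(2) by blast+
    ultimately have "card (I \<union> B) = card I + card B" "card (J \<union> B) = card J + card B"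
      by (simp_all add: card_Un_disjoint)
    then obtain x where "x \<in> (J \<union> B) - (I \<union> B)" "insert x (I \<union> B) \<in> indep M"
      using indep_augment[OF M, of "I \<union> B" "J \<union> B"] I J iff c by auto
    then show ?thesis using I J iff by (intro bexI[of _ x]) auto
  qed
  have down: "I \<in> indep (contraction M F)" if "J \<in> indep (contraction M F)" "I \<subseteq> J" for I J
    using that indep_mono[OF M, of "J \<union> B" "I \<union> B"] unfolding iff by blast
  have "{} \<in> indep (contraction M F)" using B by (simp add: iff)
  moreover have "indep (contraction M F) \<subseteq> Pow (ground M - F)" using iff by auto
  ultimately show ?thesis unfolding matroid_def
    using aug down matroid_finite[OF M] by (intro conjI ballI allI impI) (simp, simp, assumption, blast, blast)
qed

lemma rank_in_contraction:
  assumes M: "matroid M" and F: "F \<subseteq> ground M" and X: "X \<subseteq> ground M - F"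
  shows "rank_in (contraction M F) X = rank_in M (X \<union> F) - rank_in M F"
proof -
  obtain B where B: "B \<in> indep M" "B \<subseteq> F" "card B = rank_in M F"
    using rank_in_basis[OF M] .
  note iff = indep_contraction[OF M F B]
  note M' = matroid_contraction[OF M F]
  obtain I where I: "I \<in> indep (contraction M F)" "I \<subseteq> X" "card I = rank_in (contraction M F) X"
    using rank_in_basis[OF M'] .
  have "rank_in M (I \<union> F) = card I + rank_in M F" using I by (simp add: contraction_def)
  then have le: "rank_in (contraction M F) X + rank_in M F \<le> rank_in M (X \<union> F)"
    using I rank_in_mono[OF M, of "I \<union> F" "X \<union> F"] by auto
  obtain J where J: "J \<in> indep M" "B \<subseteq> J" "J \<subseteq> X \<union> F" "card J = rank_in M (X \<union> F)"
    using indep_extend[OF M B(1), of "X \<union> F"] B by auto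
  have "J \<inter> F \<in> indep M" using J indep_mono[OF M] by blast
  then have "card (J \<inter> F) \<le> card B" using card_le_rank_in[OF M] B by auto
  then have JF: "J \<inter> F = B" using J B indep_finite[OF M J(1)]
    by (intro card_seteq[symmetric]) auto
  have "J - B \<in> indep (contraction M F)" "J - B \<subseteq> X"
    using J JF X indep_subset[OF M J(1)] B by (auto simp: iff Un_absorb1)
  then have "card (J - B) \<le> rank_in (contraction M F) X" by (rule card_le_rank_in[OF M'])
  moreover have "card (J - B) = card J - card B"
    using J indep_finite[OF M B(1)] by (intro card_Diff_subset)
  ultimately show ?thesis using le J B by auto
qed

lemma rk_contraction:
  assumes M: "matroid M" and F: "F \<subseteq> ground M"
  shows "rk (contraction M F) = rk M - rank_in M F"
  using rank_in_contraction[OF assms, of "ground M - F"] F unfolding rk_def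
  by (simp add: Un_absorb2)

text \<open>The lattice of the contraction is the interval above \<open>F\<close>; injectivity
  allows sums over it to be reindexed by flats of \<open>M\<close>.\<close>

lemma flats_contraction:
  assumes M: "matroid M" and F: "F \<subseteq> ground M"
  shows "flats (contraction M F) = (\<lambda>G. G - F) ` {G \<in> flats M. F \<subseteq> G}"
    and "inj_on (\<lambda>G. G - F) {G \<in> flats M. F \<subseteq> G}"
proof -
  have iff: "G \<in> flats (contraction M F) \<longleftrightarrow> G \<subseteq> ground M - F \<and> G \<union> F \<in> flats M" for G
  proof (cases "G \<subseteq> ground M - F")
    case True
    have "rank_in (contraction M F) G < rank_in (contraction M F) (insert x G)
        \<longleftrightarrow> rank_in M (G \<union> F) < rank_in M (insert x (G \<union> F))" if "x \<in> ground M - F" for x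
      using rank_in_contraction[OF M F, of G] rank_in_contraction[OF M F, of "insert x G"]
        rank_in_mono[OF M, of F "G \<union> F"] True that by (auto simp: less_diff_iff)
    moreover have "ground M - F - G = ground M - (G \<union> F)" by auto
    ultimately show ?thesis using True F unfolding flats_def by auto
  qed (auto simp: flats_def)
  have "G \<in> (\<lambda>G. G - F) ` {G \<in> flats M. F \<subseteq> G}" if "G \<subseteq> ground M - F" "G \<union> F \<in> flats M" for G
    using that by (intro image_eqI[of _ _ "G \<union> F"]) auto
  then show "flats (contraction M F) = (\<lambda>G. G - F) ` {G \<in> flats M. F \<subseteq> G}"
  proof (intro set_eqI iffI)
    fix G assume "G \<in> (\<lambda>G. G - F) ` {G \<in> flats M. F \<subseteq> G}"
    then obtain K where K: "K \<in> flats M" "F \<subseteq> K" "G = K - F" by auto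
    then have "G \<union> F = K" by auto
    then show "G \<in> flats (contraction M F)" using K flat_subset[OF K(1)] unfolding iff by auto
  qed (simp add: iff)
  show "inj_on (\<lambda>G. G - F) {G \<in> flats M. F \<subseteq> G}"
    by (auto simp: inj_on_def)
qed

lemma loopless_contraction:
  assumes M: "matroid M" and F: "F \<in> flats M"
  shows "loopless (contraction M F)"
proof -
  have "{x} \<in> indep (contraction M F)" if x: "x \<in> ground M - F" for x
  proof -
    have "rank_in M F < rank_in M (insert x F)" using x F by (auto simp: flats_def)
    then have "rank_in M (insert x F) = Suc (rank_in M F)"
      using rank_in_insert_le[OF M, of x F] by linarith
    then show ?thesis using x by (simp add: contraction_def)
  qed
  then show ?thesis unfolding loopless_def by simp
qed

lemma contraction_contraction:
  assumes M: "matroid M" and F: "F \<subseteq> ground M" and G: "G \<subseteq> ground M" "F \<subseteq> G"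
  shows "contraction (contraction M F) (G - F) = contraction M G"
proof -
  have "rank_in (contraction M F) (I \<union> (G - F)) = card I + rank_in (contraction M F) (G - F)
    \<longleftrightarrow> rank_in M (I \<union> G) = card I + rank_in M G" if "I \<subseteq> ground M - G" for I
  proof -
    have e: "I \<union> (G - F) \<union> F = I \<union> G" "(G - F) \<union> F = G" using G by auto
    have "rank_in M F \<le> rank_in M G" "rank_in M G \<le> rank_in M (I \<union> G)"
      using rank_in_mono[OF M] G by auto
    then show ?thesis
      using rank_in_contraction[OF M F, of "I \<union> (G - F)"] rank_in_contraction[OF M F, of "G - F"]
        Diff_mono[of I "ground M" F G] that G unfolding e by fastforce
  qed
  moreover have "ground M - F - (G - F) = ground M - G" using G by auto
  ultimately show ?thesis unfolding contraction_def[of _ "G - F"] contraction_def[of M G]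
    by auto
qed

lemma contraction_empty:
  fixes M :: "'a set_system"
  assumes M: "matroid M"
  shows "contraction M {} = M"
proof -
  have "indep (contraction M {}) = indep M"
    using indep_iff_rank_in[OF M] indep_subset[OF M] by (auto simp: contraction_def rank_in_empty[OF M])
  then show ?thesis by (simp add: contraction_def)
qed

subsection \<open>Localization and the characteristic polynomial\<close>

lemma rank_in_localization: "X \<subseteq> F \<Longrightarrow> rank_in (localization M F) X = rank_in M X"
  unfolding rank_in_def localization_def
  by (rule arg_cong[where f = "\<lambda>A. Max (card ` A)"]) auto

lemma rk_localization: "rk (localization M F) = rank_in M F"
  unfolding rk_def using rank_in_localization[of F F M] by (simp add: localization_def)

text \<open>An element outside the flat \<open>F\<close> raises the rank of \<open>F\<close>, hence
  by \<open>closure_mono\<close> that of every subset of \<open>F\<close>. So only elements of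
  \<open>F\<close> have to be tested.\<close>

lemma flats_localization:
  assumes M: "matroid M" and F: "F \<in> flats M"
  shows "flats (localization M F) = {G \<in> flats M. G \<subseteq> F}"
proof -
  have "G \<in> flats (localization M F) \<longleftrightarrow> G \<in> flats M" if G: "G \<subseteq> F" for G
  proof -
    have inc: "rank_in M G < rank_in M (insert x G)" if x: "x \<in> ground M - F" for x
    proof -
      have "rank_in M (insert x F) \<noteq> rank_in M F"
        using x F flat_iff[OF M, of F] flat_subset[OF F] by blast
      then have "rank_in M (insert x G) \<noteq> rank_in M G" using closure_mono[OF M G] by blast
      then show ?thesis using rank_in_insert_ge[OF M, of G x] by linarith
    qed
    have "G \<in> flats (localization M F) \<longleftrightarrow> (\<forall>x\<in>F - G. rank_in M G < rank_in M (insert x G))"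
      using G rank_in_localization[of _ F M] unfolding flats_def by (simp add: localization_def)
    also have "\<dots> \<longleftrightarrow> G \<in> flats M"
      using inc G flat_subset[OF F] unfolding flats_def by blast
    finally show ?thesis .
  qed
  moreover have "G \<subseteq> F" if "G \<in> flats (localization M F)" for G
    using flat_subset[OF that] by (simp add: localization_def)
  ultimately show ?thesis by (intro set_eqI) (metis (no_types, lifting) mem_Collect_eq)
qed

text \<open>The recursion for \<open>Y\<close> only visits sets below \<open>Y\<close>.\<close>

lemma mobius_restrict:
  assumes "finite Y" "Y \<subseteq> F"
  shows "mobius {Z \<in> L. Z \<subseteq> F} X Y = mobius L X Y"
  using assms
proof (induction Y rule: finite_psubset_induct)
  case (psubset Y)
  have "{Z \<in> {Z \<in> L. Z \<subseteq> F}. X \<subseteq> Z \<and> Z \<subset> Y} = {Z \<in> L. X \<subseteq> Z \<and> Z \<subset> Y}"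
    using psubset.prems by auto
  then have "(\<Sum>Z \<in> {Z \<in> {Z \<in> L. Z \<subseteq> F}. X \<subseteq> Z \<and> Z \<subset> Y}. mobius {Z \<in> L. Z \<subseteq> F} X Z)
    = (\<Sum>Z \<in> {Z \<in> L. X \<subseteq> Z \<and> Z \<subset> Y}. mobius L X Z)"
  proof (rule sum.cong)
    fix Z assume "Z \<in> {Z \<in> L. X \<subseteq> Z \<and> Z \<subset> Y}"
    then have "Z \<subset> Y" "Z \<subseteq> F" using psubset.prems by auto
    then show "mobius {Z \<in> L. Z \<subseteq> F} X Z = mobius L X Z" by (rule psubset.IH)
  qed
  then show ?case by (subst (1 2) mobius.simps) simp
qed

lemma sum_mobius:
  assumes "finite Y" "Y \<in> L" "{} \<in> L"
  shows "(\<Sum>Z | Z \<in> L \<and> Z \<subseteq> Y. mobius L {} Z) = (if Y = {} then 1 else 0)"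
proof -
  have fin: "finite {Z. Z \<in> L \<and> Z \<subset> Y}"
    by (rule finite_subset[of _ "Pow Y"]) (use assms in auto)
  have "{Z. Z \<in> L \<and> Z \<subseteq> Y} = insert Y {Z. Z \<in> L \<and> Z \<subset> Y}" using assms by auto
  then have "(\<Sum>Z | Z \<in> L \<and> Z \<subseteq> Y. mobius L {} Z)
     = mobius L {} Y + (\<Sum>Z | Z \<in> L \<and> Z \<subset> Y. mobius L {} Z)" using fin by simp
  also have "\<dots> = (if Y = {} then 1 else 0)"
    using assms(1) by (subst mobius.simps) auto
  finally show ?thesis .
qed

text \<open>All localizations share the Moebius function of the whole lattice, which makes Moebius
  inversion over \<open>flats M\<close> possible.\<close>

lemma char_poly_localization:
  assumes M: "matroid M" "loopless M" and F: "F \<in> flats M"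
  shows "char_poly (localization M F) =
    (\<Sum>G | G \<in> flats M \<and> G \<subseteq> F. monom (mobius (flats M) {} G) (rank_in M F - rank_in M G))"
proof -
  have fl: "flats (localization M F) = {G \<in> flats M. G \<subseteq> F}" by (rule flats_localization[OF M(1) F])
  have "\<Inter>(flats (localization M F)) = {}" using empty_flat[OF M] fl by auto
  moreover have "finite G" if "G \<subseteq> F" for G
    using that flat_subset[OF F] matroid_finite[OF M(1)] by (meson finite_subset)
  ultimately show ?thesis
    unfolding char_poly_def fl by (intro sum.cong) (auto simp: mobius_restrict rk_localization rank_in_localization)
qed

section \<open>Palindromic polynomials\<close>

text \<open>The degree bound is included because \<open>t_rev d\<close> is the reversal only up to
  degree \<open>d\<close>; beyond that the subtraction in it truncates.\<close>

definition palindromic :: "nat \<Rightarrow> int poly \<Rightarrow> bool" where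
  "palindromic d p \<longleftrightarrow> degree p \<le> d \<and> t_rev d p = p"

lemma coeff_t_rev:
  assumes "degree p \<le> d"
  shows "coeff (t_rev d p) i = (if i \<le> d then coeff p (d - i) else 0)"
proof -
  have "coeff (t_rev d p) i = (if i < d - degree p then 0 else coeff (reflect_poly p) (i - (d - degree p)))"
    by (simp add: t_rev_def coeff_monom_mult)
  also have "\<dots> = (if i \<le> d then coeff p (d - i) else 0)"
  proof (cases "d - degree p \<le> i \<and> i \<le> d")
    case True
    then have "degree p - (i - (d - degree p)) = d - i" "\<not> degree p < i - (d - degree p)"
      using assms by linarith+
    then have "coeff (reflect_poly p) (i - (d - degree p)) = coeff p (d - i)"
      by (simp only: coeff_reflect_poly if_False)
    then show ?thesis using True by auto
  next
    case False
    then consider "i < d - degree p" | "i > d" by linarith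
    then show ?thesis
    proof cases
      case 1
      then have "degree p < d - i" by linarith
      then show ?thesis using 1 by (simp add: coeff_eq_0)
    next
      case 2
      then have "degree p < i - (d - degree p)" using assms by linarith
      then show ?thesis using 2 by (simp add: coeff_reflect_poly)
    qed
  qed
  finally show ?thesis .
qed

lemma t_rev_add:
  assumes "degree p \<le> d" "degree q \<le> d"
  shows "t_rev d (p + q) = t_rev d p + t_rev d q"
  using degree_add_le[OF assms] assms by (intro poly_eqI) (simp add: coeff_t_rev)

lemma t_rev_sum:
  assumes "\<And>x. x \<in> A \<Longrightarrow> degree (f x) \<le> d"
  shows "t_rev d (\<Sum>x\<in>A. f x) = (\<Sum>x\<in>A. t_rev d (f x))"
proof (cases "finite A")
  case True
  then show ?thesis using assms
  proof (induction A)
    case (insert a A)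
    then have "degree (\<Sum>x\<in>A. f x) \<le> d" by (intro degree_sum_le) auto
    then show ?case using insert by (simp add: t_rev_add)
  qed (simp add: t_rev_def)
qed (simp add: t_rev_def)

lemma t_rev_mult:
  assumes "degree p \<le> a" "degree q \<le> b"
  shows "t_rev (a + b) (p * q) = t_rev a p * t_rev b q"
proof (cases "p = 0 \<or> q = 0")
  case False
  then have "a + b - degree (p * q) = (a - degree p) + (b - degree q)"
    using assms by (simp add: degree_mult_eq)
  then have "monom (1::int) (a + b - degree (p * q)) = monom 1 (a - degree p) * monom 1 (b - degree q)"
    by (simp only: mult_monom mult_1)
  then show ?thesis
    by (simp only: t_rev_def reflect_poly_mult mult_ac)
qed (auto simp: t_rev_def)

lemma t_rev_monom_mult:
  assumes "degree p \<le> b"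
  shows "t_rev (a + b) (monom 1 a * p) = t_rev b p"
proof -
  have "t_rev a (monom 1 a) = (1 :: int poly)"
    by (rule poly_eqI) (auto simp: coeff_t_rev degree_monom_eq coeff_monom coeff_1)
  then show ?thesis using t_rev_mult[of "monom 1 a" a p b] assms by (simp add: degree_monom_eq)
qed

lemma palindromic_0 [simp]: "palindromic d 0"
  by (simp add: palindromic_def t_rev_def)

lemma palindromic_iff_coeff:
  "palindromic d p \<longleftrightarrow> (\<forall>i. coeff p i = (if i \<le> d then coeff p (d - i) else 0))"
proof (cases "degree p \<le> d")
  case True
  then have "palindromic d p \<longleftrightarrow> p = t_rev d p" by (auto simp: palindromic_def)
  then show ?thesis using True by (simp add: poly_eq_iff coeff_t_rev)
next
  case False
  then have "p \<noteq> 0" by auto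
  then have "coeff p (degree p) \<noteq> (if degree p \<le> d then coeff p (d - degree p) else 0)"
    using False by simp
  then show ?thesis using False unfolding palindromic_def by blast
qed

lemma palindromic_1: "palindromic 0 1"
  by (auto simp: palindromic_iff_coeff coeff_1)

lemma palindromic_add: "palindromic d p \<Longrightarrow> palindromic d q \<Longrightarrow> palindromic d (p + q)"
  by (simp add: palindromic_def t_rev_add degree_add_le)

lemma palindromic_diff: "palindromic d p \<Longrightarrow> palindromic d q \<Longrightarrow> palindromic d (p - q)"
  unfolding palindromic_iff_coeff
proof
  fix i
  assume "\<forall>i. coeff p i = (if i \<le> d then coeff p (d - i) else 0)"
    and "\<forall>i. coeff q i = (if i \<le> d then coeff q (d - i) else 0)"
  from spec[OF this(1), of i] spec[OF this(2), of i]
  show "coeff (p - q) i = (if i \<le> d then coeff (p - q) (d - i) else 0)"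
    by (cases "i \<le> d") (simp_all only: coeff_diff if_True if_False diff_self)
qed

lemma palindromic_sum: "(\<And>x. x \<in> A \<Longrightarrow> palindromic d (f x)) \<Longrightarrow> palindromic d (\<Sum>x\<in>A. f x)"
  by (induction A rule: infinite_finite_induct) (simp_all add: palindromic_add)

lemma palindromic_mult:
  assumes "palindromic a p" "palindromic b q"
  shows "palindromic (a + b) (p * q)"
proof -
  have "degree (p * q) \<le> a + b"
    using degree_mult_le[of p q] assms by (simp add: palindromic_def)
  then show ?thesis using assms by (simp add: palindromic_def t_rev_mult)
qed

text \<open>The mirror image of the leading coefficient sits at \<open>d - degree p\<close>, beyond
  the degree.\<close>

lemma palindromic_low_degree:
  assumes "palindromic d p" "2 * degree p < d"
  shows "p = 0"
proof -
  have "coeff p (degree p) = (if degree p \<le> d then coeff p (d - degree p) else 0)"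
    using assms(1) unfolding palindromic_iff_coeff by blast
  also have "\<dots> = 0" using assms(2) by (simp add: coeff_eq_0)
  finally show ?thesis by simp
qed

text \<open>The unique \<open>p\<close> with \<open>2 * degree p < d\<close> for which \<open>p + q\<close> is palindromic.\<close>

definition pal_completion :: "nat \<Rightarrow> int poly \<Rightarrow> int poly" where
  "pal_completion d q = (\<Sum>i | 2 * i < d. monom (coeff q (d - i) - coeff q i) i)"

lemma coeff_pal_completion:
  "coeff (pal_completion d q) i = (if 2 * i < d then coeff q (d - i) - coeff q i else 0)"
proof -
  have "finite {i. 2 * i < d}" by (rule finite_subset[of _ "{..d}"]) auto
  then show ?thesis by (simp add: pal_completion_def coeff_sum coeff_monom if_distrib sum.delta)
qed

lemma degree_pal_completion: "d > 0 \<Longrightarrow> 2 * degree (pal_completion d q) < d"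
proof -
  assume "d > 0"
  have "degree (pal_completion d q) \<le> (d - 1) div 2"
    by (rule degree_le) (auto simp: coeff_pal_completion)
  then show ?thesis using \<open>d > 0\<close> by linarith
qed

lemma palindromic_pal_completion:
  assumes "degree q \<le> d"
  shows "palindromic d (pal_completion d q + q)"
  unfolding palindromic_iff_coeff
proof
  fix i
  consider "i > d" | "2 * i < d" | "2 * i = d" | "i \<le> d" "d < 2 * i" by linarith
  then show "coeff (pal_completion d q + q) i
      = (if i \<le> d then coeff (pal_completion d q + q) (d - i) else 0)"
    using assms by cases (auto simp: coeff_pal_completion coeff_eq_0 mult_2)
qed

section \<open>Existence and uniqueness of Kazhdan--Lusztig polynomials\<close>

text \<open>Degree bound and palindromicity leave one choice for the term of the empty flat: it
  completes the terms of the nonempty flats, whose contractions have smaller ground sets.\<close>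

function KL_rec :: "'a set_system \<Rightarrow> int poly" where
  "KL_rec M =
    (if \<not> (matroid M \<and> loopless M) then undefined
     else if ground M = {} then 1
     else pal_completion (rk M)
       (\<Sum>F\<in>flats M - {{}}. monom 1 (rank_in M F) * KL_rec (contraction M F)))"
  by auto
termination
proof (relation "measure (\<lambda>M. card (ground M))")
  fix M :: "'a set_system" and F
  assume M: "\<not> \<not> (matroid M \<and> loopless M)" and F: "F \<in> flats M - {{}}"
  then have "ground M - F \<subset> ground M" using flat_subset by fastforce
  then show "(contraction M F, M) \<in> measure (\<lambda>M. card (ground M))"
    using M by (simp add: matroid_finite psubset_card_mono)
qed simp

declare KL_rec.simps [simp del]

lemma KL_rec_empty: "matroid M \<Longrightarrow> loopless M \<Longrightarrow> rk M = 0 \<Longrightarrow> KL_rec M = 1"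
  by (subst KL_rec.simps) (simp add: rk_eq_0_iff)

lemma degree_KL_rec:
  assumes "matroid M" "loopless M" "rk M > 0"
  shows "2 * degree (KL_rec M) < rk M"
  using assms by (subst KL_rec.simps) (auto simp: rk_eq_0_iff[symmetric] intro: degree_pal_completion)

lemma degree_KL_rec_le: "matroid M \<Longrightarrow> loopless M \<Longrightarrow> degree (KL_rec M) \<le> rk M"
  using degree_KL_rec[of M] KL_rec_empty[of M] by (cases "rk M = 0") auto

lemma degree_KL_rec_contraction:
  assumes "matroid M" "F \<in> flats M"
  shows "degree (KL_rec (contraction M F)) \<le> rk M - rank_in M F"
  using degree_KL_rec_le[of "contraction M F"] matroid_contraction[OF assms(1)] assms
    flat_subset loopless_contraction rk_contraction by metis

text \<open>The palindromicity of the polynomials $\sum_F t^{\mathrm{rk} F} P_{M^F}(t)$ is equivalent to the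
  defining relation of $P$, without reference to characteristic polynomials.\<close>

lemma palindromic_KL_rec:
  assumes M: "matroid M" "loopless M"
  shows "palindromic (rk M) (\<Sum>F\<in>flats M. monom 1 (rank_in M F) * KL_rec (contraction M F))"
proof (cases "rk M = 0")
  case True
  then have "ground M = {}" using rk_eq_0_iff[OF M] by simp
  then have "flats M = {{}}" using empty_flat[OF M] flat_subset by force
  then show ?thesis
    using True KL_rec_empty[OF M] by (simp add: rank_in_empty M contraction_empty palindromic_1 monom_0 flip: one_pCons)
next
  case False
  let ?f = "\<lambda>F. monom 1 (rank_in M F) * KL_rec (contraction M F)"
  have "degree (?f F) \<le> rk M" if F: "F \<in> flats M" for F
  proof -
    have "degree (?f F) \<le> degree (monom (1::int) (rank_in M F)) + degree (KL_rec (contraction M F))"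
      by (rule degree_mult_le)
    also have "\<dots> \<le> rank_in M F + (rk M - rank_in M F)"
      using degree_KL_rec_contraction[OF M(1) F] by (simp add: degree_monom_eq)
    also have "\<dots> = rk M" using rank_in_le_rk[OF M(1) flat_subset[OF F]] by simp
    finally show ?thesis .
  qed
  then have deg: "degree (\<Sum>F\<in>flats M - {{}}. ?f F) \<le> rk M" by (intro degree_sum_le) (auto simp: finite_flats M)
  have "(\<Sum>F\<in>flats M. ?f F) = ?f {} + (\<Sum>F\<in>flats M - {{}}. ?f F)"
    using empty_flat[OF M] finite_flats[OF M(1)] by (rule sum.remove[rotated])
  also have "?f {} = KL_rec M" by (simp add: rank_in_empty M contraction_empty)
  also have "KL_rec M = pal_completion (rk M) (\<Sum>F\<in>flats M - {{}}. ?f F)"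
    using M False rk_eq_0_iff[OF M] by (subst KL_rec.simps) simp
  finally show ?thesis using palindromic_pal_completion[OF deg] by simp
qed

lemma palindromic_KL_rec_above:
  assumes M: "matroid M" and G: "G \<in> flats M"
  shows "palindromic (rk M - rank_in M G)
    (\<Sum>F | F \<in> flats M \<and> G \<subseteq> F. monom 1 (rank_in M F - rank_in M G) * KL_rec (contraction M F))"
proof -
  note Gs = flat_subset[OF G]
  have "palindromic (rk (contraction M G))
     (\<Sum>F\<in>flats (contraction M G). monom 1 (rank_in (contraction M G) F) * KL_rec (contraction (contraction M G) F))"
    by (intro palindromic_KL_rec matroid_contraction loopless_contraction M G Gs)
  also have "(\<Sum>F\<in>flats (contraction M G). monom 1 (rank_in (contraction M G) F) * KL_rec (contraction (contraction M G) F))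
    = (\<Sum>F | F \<in> flats M \<and> G \<subseteq> F. monom 1 (rank_in (contraction M G) (F - G)) * KL_rec (contraction (contraction M G) (F - G)))"
    unfolding flats_contraction(1)[OF M Gs] by (subst sum.reindex[OF flats_contraction(2)[OF M Gs]]) (simp add: o_def)
  also have "\<dots> = (\<Sum>F | F \<in> flats M \<and> G \<subseteq> F. monom 1 (rank_in M F - rank_in M G) * KL_rec (contraction M F))"
  proof (rule sum.cong)
    fix F assume "F \<in> {F. F \<in> flats M \<and> G \<subseteq> F}"
    then have F: "F \<subseteq> ground M" "G \<subseteq> F" using flat_subset by auto
    then have "F - G \<union> G = F" "F - G \<subseteq> ground M - G" by auto
    then show "monom 1 (rank_in (contraction M G) (F - G)) * KL_rec (contraction (contraction M G) (F - G))
      = monom 1 (rank_in M F - rank_in M G) * KL_rec (contraction M F)"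
      using rank_in_contraction[OF M Gs, of "F - G"] contraction_contraction[OF M Gs F] by simp
  qed simp
  finally show ?thesis by (simp add: rk_contraction[OF M Gs])
qed

text \<open>Moebius inversion: the palindromicity relations above all flats \<open>G\<close>,
  weighted with the Moebius function from \<open>{}\<close> to \<open>G\<close>, add up to the
  defining relation.\<close>

lemma KL_rec_equation:
  assumes M: "matroid M" "loopless M"
  shows "t_rev (rk M) (KL_rec M) =
    (\<Sum>F\<in>flats M. char_poly (localization M F) * KL_rec (contraction M F))"
proof -
  let ?L = "flats M" and ?r = "rank_in M" and ?mu = "\<lambda>G. mobius (flats M) {} G"
    and ?P = "\<lambda>F. KL_rec (contraction M F)"
  have fin: "finite ?L" by (rule finite_flats[OF M(1)])
  have deg: "degree (?P F) \<le> rk M - ?r F" if "F \<in> ?L" for F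
    by (rule degree_KL_rec_contraction[OF M(1) that])
  \<comment> \<open>Reversal strips the monomial, and the reversed summand of \<open>F\<close> no
    longer depends on \<open>G\<close>. This is what lets the sum over \<open>G\<close> collapse to
    \<open>F = {}\<close>.\<close>
  have pal: "(\<Sum>F | F \<in> ?L \<and> G \<subseteq> F. monom 1 (?r F - ?r G) * ?P F)
    = (\<Sum>F | F \<in> ?L \<and> G \<subseteq> F. t_rev (rk M - ?r F) (?P F))" if G: "G \<in> ?L" for G
  proof -
    have *: "degree (monom 1 (?r F - ?r G) * ?P F) \<le> rk M - ?r G
       \<and> t_rev (rk M - ?r G) (monom 1 (?r F - ?r G) * ?P F) = t_rev (rk M - ?r F) (?P F)"
      if F: "F \<in> ?L" "G \<subseteq> F" for F
    proof -
      have le: "?r G \<le> ?r F" "?r F \<le> rk M"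
        using rank_in_mono[OF M(1)] rank_in_le_rk[OF M(1) flat_subset] F by auto
      then have e: "rk M - ?r G = (?r F - ?r G) + (rk M - ?r F)" by simp
      have "degree (monom 1 (?r F - ?r G) * ?P F) \<le> degree (monom (1::int) (?r F - ?r G)) + degree (?P F)"
        by (rule degree_mult_le)
      also have "\<dots> \<le> rk M - ?r G" using deg[OF F(1)] le by (simp add: degree_monom_eq)
      finally show ?thesis unfolding e using t_rev_monom_mult[OF deg[OF F(1)]] by simp
    qed
    have "(\<Sum>F | F \<in> ?L \<and> G \<subseteq> F. monom 1 (?r F - ?r G) * ?P F)
       = t_rev (rk M - ?r G) (\<Sum>F | F \<in> ?L \<and> G \<subseteq> F. monom 1 (?r F - ?r G) * ?P F)"
      using palindromic_KL_rec_above[OF M(1) G] by (simp add: palindromic_def)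
    also have "\<dots> = (\<Sum>F | F \<in> ?L \<and> G \<subseteq> F. t_rev (rk M - ?r F) (?P F))"
      using * by (subst t_rev_sum) auto
    finally show ?thesis .
  qed
  have swap: "(\<Sum>F\<in>?L. \<Sum>G | G \<in> ?L \<and> G \<subseteq> F. h F G) = (\<Sum>G\<in>?L. \<Sum>F | F \<in> ?L \<and> G \<subseteq> F. h F G)"
    for h :: "'a set \<Rightarrow> 'a set \<Rightarrow> int poly"
    by (rule sum.swap_restrict[OF fin fin])
  have "(\<Sum>F\<in>?L. char_poly (localization M F) * ?P F)
    = (\<Sum>F\<in>?L. \<Sum>G | G \<in> ?L \<and> G \<subseteq> F. [:?mu G:] * (monom 1 (?r F - ?r G) * ?P F))"
    by (intro sum.cong refl)
      (simp add: char_poly_localization[OF M] sum_distrib_right smult_monom flip: mult_smult_left)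
  also have "\<dots> = (\<Sum>G\<in>?L. [:?mu G:] * (\<Sum>F | F \<in> ?L \<and> G \<subseteq> F. monom 1 (?r F - ?r G) * ?P F))"
    unfolding swap sum_distrib_left ..
  also have "\<dots> = (\<Sum>G\<in>?L. \<Sum>F | F \<in> ?L \<and> G \<subseteq> F. [:?mu G:] * t_rev (rk M - ?r F) (?P F))"
    unfolding sum_distrib_left[symmetric] using pal by simp
  also have "\<dots> = (\<Sum>F\<in>?L. [:\<Sum>G | G \<in> ?L \<and> G \<subseteq> F. ?mu G:] * t_rev (rk M - ?r F) (?P F))"
    unfolding swap[symmetric] by (simp only: sum_distrib_right flip: sum_to_poly)
  also have "\<dots> = (\<Sum>F\<in>?L. if F = {} then t_rev (rk M - ?r F) (?P F) else 0)"
  proof (rule sum.cong)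
    fix F assume F: "F \<in> ?L"
    then have "finite F" using flat_subset matroid_finite[OF M(1)] finite_subset by metis
    then have "(\<Sum>G | G \<in> ?L \<and> G \<subseteq> F. ?mu G) = (if F = {} then 1 else 0)"
      by (intro sum_mobius F empty_flat M)
    then show "[:\<Sum>G | G \<in> ?L \<and> G \<subseteq> F. ?mu G:] * t_rev (rk M - ?r F) (?P F)
      = (if F = {} then t_rev (rk M - ?r F) (?P F) else 0)" by simp
  qed simp
  also have "\<dots> = t_rev (rk M) (KL_rec M)"
    using fin empty_flat[OF M] by (simp add: rank_in_empty M contraction_empty)
  finally show ?thesis ..
qed

text \<open>In the defining relation the term of the empty flat is \<open>P M\<close> itself, and by
  induction all other terms agree for \<open>P\<close> and \<open>Q\<close>. So the difference
  equals its own reversal, and the degree bound kills it.\<close>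

lemma kl_assignment_unique:
  assumes P: "kl_assignment P" and Q: "kl_assignment Q"
  shows "matroid M \<Longrightarrow> loopless M \<Longrightarrow> P M = Q M"
proof (induction "card (ground M)" arbitrary: M rule: less_induct)
  case less
  note M = less.prems
  show ?case
  proof (cases "rk M = 0")
    case True
    then show ?thesis using P Q M by (simp add: kl_assignment_def)
  next
    case False
    have eq: "P (contraction M F) = Q (contraction M F)" if F: "F \<in> flats M - {{}}" for F
    proof -
      have "ground M - F \<subset> ground M" using F flat_subset by fastforce
      then have "card (ground (contraction M F)) < card (ground M)"
        using M by (simp add: matroid_finite psubset_card_mono)
      then show ?thesis using less.hyps[of "contraction M F"]
          matroid_contraction[OF M(1)] loopless_contraction[OF M(1)] F flat_subset by blast
    qed
    have fe: "finite (flats M)" "{} \<in> flats M" using finite_flats empty_flat M by auto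
    have loc: "char_poly (localization M {}) = 1"
    proof -
      have "{G. G \<in> flats M \<and> G \<subseteq> {}} = {{}}" using fe by auto
      then show ?thesis
        using char_poly_localization[OF M fe(2)] by (simp add: mobius.simps)
    qed
    have step: "t_rev (rk M) (S M) = S M + (\<Sum>F\<in>flats M - {{}}. char_poly (localization M F) * S (contraction M F))"
      if "kl_assignment S" for S
    proof -
      have "t_rev (rk M) (S M) = (\<Sum>F\<in>flats M. char_poly (localization M F) * S (contraction M F))"
        using that M by (simp add: kl_assignment_def)
      then show ?thesis using fe loc by (simp add: sum.remove[OF fe] contraction_empty M)
    qed
    let ?D = "P M - Q M"
    have d: "2 * degree (P M) < rk M" "2 * degree (Q M) < rk M"
      using P Q M False by (auto simp: kl_assignment_def)
    then have dD: "2 * degree ?D < rk M"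
      using degree_diff_le_max[of "P M" "Q M"] by (auto simp: max_def split: if_splits)
    have "t_rev (rk M) (P M) = t_rev (rk M) (?D + Q M)" by simp
    also have "\<dots> = t_rev (rk M) ?D + t_rev (rk M) (Q M)"
      using d dD by (intro t_rev_add) auto
    finally have "t_rev (rk M) ?D = ?D"
      using step[OF P] step[OF Q] eq by simp
    then have "palindromic (rk M) ?D" using dD by (simp add: palindromic_def)
    then have "?D = 0" using dD by (rule palindromic_low_degree)
    then show ?thesis by simp
  qed
qed

lemma kl_assignment_KL_rec: "kl_assignment KL_rec"
  unfolding kl_assignment_def using KL_rec_empty degree_KL_rec KL_rec_equation by blast

lemma kl_assignment_cong:
  assumes eq: "\<And>M. matroid M \<Longrightarrow> loopless M \<Longrightarrow> P M = Q M" and Q: "kl_assignment Q"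
  shows "kl_assignment P"
  unfolding kl_assignment_def
proof (intro allI impI)
  fix M :: "'a set_system" assume M: "matroid M \<and> loopless M"
  have "(\<Sum>F\<in>flats M. char_poly (localization M F) * P (contraction M F))
    = (\<Sum>F\<in>flats M. char_poly (localization M F) * Q (contraction M F))"
  proof (rule sum.cong)
    fix F assume "F \<in> flats M"
    then have "P (contraction M F) = Q (contraction M F)"
      using M by (intro eq matroid_contraction loopless_contraction flat_subset) auto
    then show "char_poly (localization M F) * P (contraction M F)
      = char_poly (localization M F) * Q (contraction M F)" by simp
  qed simp
  then show "(rk M = 0 \<longrightarrow> P M = 1) \<and> (rk M > 0 \<longrightarrow> 2 * degree (P M) < rk M) \<and>
      t_rev (rk M) (P M) = (\<Sum>F\<in>flats M. char_poly (localization M F) * P (contraction M F))"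
    using M Q eq[of M] by (simp add: kl_assignment_def)
qed

lemma KL_poly_eq_KL_rec:
  fixes M :: "'a set_system"
  assumes "matroid M" "loopless M"
  shows "KL_poly M = KL_rec M"
proof -
  let ?D = "{M :: 'a set_system. matroid M \<and> loopless M}"
  have "KL_poly = restrict KL_rec ?D"
    unfolding KL_poly_def
  proof (rule the_equality)
    show "restrict KL_rec ?D \<in> extensional ?D \<and> kl_assignment (restrict KL_rec ?D)"
      using kl_assignment_cong[OF _ kl_assignment_KL_rec, of "restrict KL_rec ?D"] by simp
    show "P = restrict KL_rec ?D" if "P \<in> extensional ?D \<and> kl_assignment P" for P
      using that kl_assignment_unique[OF _ kl_assignment_KL_rec, of P]
      by (intro extensionalityI[of _ ?D]) auto
  qed
  then have "KL_poly M = restrict KL_rec ?D M" by (rule fun_cong)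
  then show ?thesis using assms by simp
qed

text \<open>Downward induction over flats: strictly above \<open>F\<close> the family already agrees
  with the polynomials of the contractions, so the difference at \<open>F\<close> is a difference of
  two palindromic sums, of too low degree to be nonzero.\<close>

lemma KL_poly_eqI:
  assumes M: "matroid M" "loopless M"
    and top: "Q (ground M) = 1"
    and deg: "\<And>F. F \<in> flats M \<Longrightarrow> F \<noteq> ground M \<Longrightarrow> 2 * degree (Q F) < rk M - rank_in M F"
    and pal: "\<And>F. F \<in> flats M \<Longrightarrow>
      palindromic (rk M - rank_in M F) (\<Sum>G | G \<in> flats M \<and> F \<subseteq> G. monom 1 (rank_in M G - rank_in M F) * Q G)"
  shows "KL_poly M = Q {}"
proof -
  let ?P = "\<lambda>F. KL_rec (contraction M F)"
  have "F \<in> flats M \<Longrightarrow> ?P F = Q F" for F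
  proof (induction "card (ground M - F)" arbitrary: F rule: less_induct)
    case less
    note F = less.prems
    show ?case
    proof (cases "F = ground M")
      case True
      have "rk (contraction M F) = 0"
        using rk_eq_0_iff[OF matroid_contraction[OF M(1)] loopless_contraction[OF M(1)], of F] F True by simp
      then show ?thesis
        using KL_rec_empty[OF matroid_contraction[OF M(1)] loopless_contraction[OF M(1)], of F] F top True by auto
    next
      case False
      let ?A = "{G. G \<in> flats M \<and> F \<subseteq> G}"
      have A: "finite ?A" "F \<in> ?A" using F finite_flats[OF M(1)] by auto
      have up: "?P G = Q G" if "G \<in> ?A - {F}" for G
      proof (rule less.hyps)
        have "ground M - G \<subset> ground M - F" using that flat_subset by blast
        then show "card (ground M - G) < card (ground M - F)"
          by (intro psubset_card_mono) (simp_all add: matroid_finite M)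
      qed (use that in auto)
      have sum: "(\<Sum>G\<in>?A. monom 1 (rank_in M G - rank_in M F) * S G)
        = S F + (\<Sum>G\<in>?A - {F}. monom 1 (rank_in M G - rank_in M F) * S G)" for S :: "'a set \<Rightarrow> int poly"
        by (subst sum.remove[OF A]) simp
      have "palindromic (rk M - rank_in M F) (?P F - Q F)"
        using palindromic_diff[OF palindromic_KL_rec_above[OF M(1) F] pal[OF F]] up
        unfolding sum by simp
      moreover have "rk (contraction M F) > 0"
        using flat_rank_less[OF M(1) F False] by (simp add: rk_contraction M F flat_subset)
      then have "2 * degree (?P F) < rk M - rank_in M F"
        using degree_KL_rec[OF matroid_contraction[OF M(1)] loopless_contraction[OF M(1)], of F]
          F flat_subset[OF F] by (simp add: rk_contraction M)
      then have "2 * degree (?P F - Q F) < rk M - rank_in M F"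
        using deg[OF F False] degree_diff_le_max[of "?P F" "Q F"] by (auto simp: max_def split: if_splits)
      ultimately show ?thesis using palindromic_low_degree by fastforce
    qed
  qed
  from this[OF empty_flat[OF M]] show ?thesis
    using KL_poly_eq_KL_rec[OF M] by (simp add: contraction_empty M)
qed

section \<open>Graphic matroids\<close>

definition conn :: "'v set set \<Rightarrow> 'v \<Rightarrow> 'v \<Rightarrow> bool" where
  "conn A x y \<longleftrightarrow> (x, y) \<in> {(x, y). {x, y} \<in> A}\<^sup>*"

definition spanned :: "'v set set \<Rightarrow> 'v set \<Rightarrow> bool" where
  "spanned A e \<longleftrightarrow> (\<exists>x y. e = {x, y} \<and> conn A x y)"

text \<open>Independence expressed as "no edge lies in the closure of the others". This form feeds
  the exchange arguments directly; \<open>forest_iff\<close> links it to cycles.\<close>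

definition forest :: "'v set set \<Rightarrow> bool" where
  "forest A \<longleftrightarrow> (\<forall>e\<in>A. \<not> spanned (A - {e}) e)"

lemma conn_refl [simp]: "conn A x x"
  by (simp add: conn_def)

lemma conn_edge: "{x, y} \<in> A \<Longrightarrow> conn A x y"
  by (auto simp: conn_def)

lemma conn_trans: "conn A x y \<Longrightarrow> conn A y z \<Longrightarrow> conn A x z"
  unfolding conn_def by (rule rtrancl_trans)

lemma conn_induct [consumes 1, case_names refl step]:
  assumes "conn A x y" "P x" "\<And>y z. conn A x y \<Longrightarrow> {y, z} \<in> A \<Longrightarrow> P y \<Longrightarrow> P z"
  shows "P y"
  using assms unfolding conn_def by (induction rule: rtrancl_induct) auto

lemma conn_sym: "conn A x y \<Longrightarrow> conn A y x"
proof (induction rule: conn_induct)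
  case (step y z)
  then have "conn A z y" by (intro conn_edge) (simp add: insert_commute)
  then show ?case using step conn_trans by metis
qed simp

lemma conn_subst:
  assumes "conn A x y" "\<And>a b. {a, b} \<in> A \<Longrightarrow> conn B a b"
  shows "conn B x y"
  using assms(1)
proof (induction rule: conn_induct)
  case (step y z)
  then show ?case using assms(2) conn_trans by metis
qed simp

lemma conn_mono: "conn A x y \<Longrightarrow> A \<subseteq> B \<Longrightarrow> conn B x y"
  by (erule conn_subst) (auto intro: conn_edge)

lemma conn_cut:
  assumes "conn A x y" "\<And>a b. {a, b} \<in> A \<Longrightarrow> a \<in> X \<Longrightarrow> b \<in> X" "x \<in> X"
  shows "y \<in> X"
  using assms(1,3) by (induction rule: conn_induct) (auto intro: assms(2))

lemma conn_insert:
  "conn (insert {p, q} A) x y \<Longrightarrow>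
    conn A x y \<or> conn A x p \<and> conn A q y \<or> conn A x q \<and> conn A p y"
proof (induction rule: conn_induct)
  case (step y z)
  show ?case
  proof (cases "{y, z} \<in> A")
    case True
    then show ?thesis using step.IH conn_edge conn_trans by metis
  next
    case False
    then have "y = p \<and> z = q \<or> y = q \<and> z = p" using step.hyps(2) by (auto simp: doubleton_eq_iff)
    then show ?thesis using step.IH conn_refl by metis
  qed
qed simp

lemma spanned_doubleton: "spanned A {x, y} \<longleftrightarrow> conn A x y"
  unfolding spanned_def using conn_sym by (metis doubleton_eq_iff)

lemma spanned_mono: "spanned A e \<Longrightarrow> A \<subseteq> B \<Longrightarrow> spanned B e"
  unfolding spanned_def using conn_mono by metis

lemma spanned_trans:
  assumes "spanned A e" "\<And>a. a \<in> A \<Longrightarrow> spanned B a"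
  shows "spanned B e"
proof -
  obtain x y where e: "e = {x, y}" and "conn A x y" using assms(1) by (auto simp: spanned_def)
  moreover have "conn B a b" if "{a, b} \<in> A" for a b
    using assms(2)[OF that] by (simp add: spanned_doubleton)
  ultimately have "conn B x y" by (blast intro: conn_subst)
  then show ?thesis using e by (simp add: spanned_doubleton)
qed

text \<open>A path that spans \<open>e\<close> must run through \<open>f\<close>; closing its two
  remaining pieces by \<open>e\<close> joins the ends of \<open>f\<close>.\<close>

lemma spanned_exchange:
  assumes "spanned (insert f A) e" "\<not> spanned A e" "f = {p, q}"
  shows "spanned (insert e A) f"
proof -
  obtain x y where e: "e = {x, y}" and "conn (insert f A) x y" using assms(1) by (auto simp: spanned_def)
  moreover have "\<not> conn A x y" using assms(2) e by (simp add: spanned_doubleton)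
  ultimately have *: "conn A x p \<and> conn A q y \<or> conn A x q \<and> conn A p y"
    using conn_insert[of p q A x y] assms(3) by auto
  let ?B = "insert e A"
  have "conn ?B x y" by (rule conn_edge) (simp add: e)
  moreover have "conn A a b \<Longrightarrow> conn ?B a b" for a b by (erule conn_mono) auto
  ultimately have "conn ?B p q" using * conn_sym conn_trans by metis
  then show ?thesis by (simp add: assms(3) spanned_doubleton)
qed

lemma forest_mono: "forest B \<Longrightarrow> A \<subseteq> B \<Longrightarrow> forest A"
  unfolding forest_def by (meson Diff_mono spanned_mono subset_iff order_refl)

section \<open>Cycles and spanned edges\<close>

lemma simple_path:
  "conn A x y \<Longrightarrow> \<exists>vs. vs \<noteq> [] \<and> distinct vs \<and> hd vs = x \<and> last vs = y \<and>
    successively (\<lambda>a b. {a, b} \<in> A) vs"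
proof (induction rule: conn_induct)
  case refl
  show ?case by (rule exI[of _ "[x]"]) simp
next
  case (step y z)
  then obtain vs where vs: "vs \<noteq> []" "distinct vs" "hd vs = x" "last vs = y"
    "successively (\<lambda>a b. {a, b} \<in> A) vs" by auto
  show ?case
  proof (cases "z \<in> set vs")
    \<comment> \<open>The walk returns to \<open>z\<close>: it is cut off at the earlier
      visit.\<close>
    case True
    then obtain us ws where "vs = us @ z # ws" by (meson split_list)
    then have e: "vs = (us @ [z]) @ ws" by simp
    have "hd (us @ [z]) = x" using vs(3) e by (metis Nil_is_append_conv hd_append2 list.discI)
    moreover have "distinct (us @ [z])" using vs(2) unfolding e by (simp only: distinct_append)
    moreover have "successively (\<lambda>a b. {a, b} \<in> A) (us @ [z])"
      using vs(5) unfolding e successively_append_iff by blast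
    ultimately show ?thesis by (intro exI[of _ "us @ [z]"]) simp
  next
    case False
    then show ?thesis using vs step.hyps(2)
      by (intro exI[of _ "vs @ [z]"]) (simp add: successively_append_iff)
  qed
qed

text \<open>The edge that closes the cycle is spanned by the remaining ones.\<close>

lemma cycle_imp_not_forest:
  assumes "is_cycle A vs"
  shows "\<not> forest A"
proof -
  let ?n = "length vs" and ?e = "{vs ! 0, vs ! (length vs - 1)}"
  have n: "?n \<ge> 3" "distinct vs" and A: "\<And>i. i < ?n \<Longrightarrow> {vs ! i, vs ! (Suc i mod ?n)} \<in> A"
    using assms by (auto simp: is_cycle_def)
  have "{vs ! (?n - 1), vs ! (Suc (?n - 1) mod ?n)} \<in> A" using n(1) by (intro A) linarith
  moreover have "Suc (?n - 1) = ?n" using n(1) by linarith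
  ultimately have "{vs ! (?n - 1), vs ! 0} \<in> A" by (metis mod_self)
  then have "?e \<in> A" by (subst insert_commute)
  moreover have "conn (A - {?e}) (vs ! 0) (vs ! k)" if "k < ?n" for k
    using that
  proof (induction k)
    case (Suc k)
    \<comment> \<open>Here the length of at least 3 enters: with two vertices the closing edge would
      coincide with the only other one.\<close>
    have "{vs ! k, vs ! Suc k} \<noteq> ?e"
    proof
      assume "{vs ! k, vs ! Suc k} = ?e"
      then have "vs ! Suc k = vs ! 0 \<or> vs ! k = vs ! 0 \<and> vs ! Suc k = vs ! (?n - 1)"
        by (auto simp: doubleton_eq_iff)
      moreover have "vs ! i = vs ! 0 \<longleftrightarrow> i = 0" if "i < ?n" for i
        using nth_eq_iff_index_eq[OF n(2) that, of 0] that by linarith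
      moreover have "vs ! Suc k = vs ! (?n - 1) \<longleftrightarrow> Suc k = ?n - 1"
        using nth_eq_iff_index_eq[OF n(2) Suc.prems, of "?n - 1"] n(1) by linarith
      ultimately have "Suc k = 0 \<or> k = 0 \<and> Suc k = ?n - 1" using Suc.prems Suc_lessD[OF Suc.prems] by blast
      then show False using n(1) by linarith
    qed
    moreover have "{vs ! k, vs ! Suc k} \<in> A" using A[of k] Suc.prems by simp
    ultimately have "conn (A - {?e}) (vs ! k) (vs ! Suc k)" by (intro conn_edge) simp
    moreover have "conn (A - {?e}) (vs ! 0) (vs ! k)" using Suc.prems by (intro Suc.IH) simp
    ultimately show ?case by (rule conn_trans[rotated])
  qed simp
  then have "conn (A - {?e}) (vs ! 0) (vs ! (?n - 1))" using n(1) by simp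
  then have "spanned (A - {?e}) ?e" by (simp add: spanned_doubleton)
  ultimately show ?thesis unfolding forest_def by blast
qed

lemma cycle_if_spanned:
  assumes "{x, y} \<in> A" "x \<noteq> y" "conn (A - {{x, y}}) x y"
  shows "\<exists>vs. is_cycle A vs"
proof -
  obtain vs where vs: "vs \<noteq> []" "distinct vs" "hd vs = x" "last vs = y"
    "successively (\<lambda>a b. {a, b} \<in> A - {{x, y}}) vs"
    using simple_path[OF assms(3)] by auto
  let ?n = "length vs"
  have x: "vs ! 0 = x" and y: "vs ! (?n - 1) = y"
    using vs by (simp_all add: hd_conv_nth last_conv_nth)
  have s: "{vs ! i, vs ! Suc i} \<in> A - {{x, y}}" if "Suc i < ?n" for i
    using vs(5) that by (simp add: successively_conv_nth)
  have "?n \<noteq> 0" "?n \<noteq> 1" using vs(1) x y assms(2) by auto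
  \<comment> \<open>A path on two vertices would be the removed edge itself.\<close>
  moreover have "?n \<noteq> 2" using s[of 0] x y by auto
  ultimately have "?n \<ge> 3" by linarith
  moreover have "{vs ! i, vs ! (Suc i mod ?n)} \<in> A" if "i < ?n" for i
  proof (cases "Suc i < ?n")
    case True
    then show ?thesis using s[of i] by simp
  next
    case False
    then have "Suc i = ?n" using that by linarith
    then have "Suc i mod ?n = 0" by simp
    moreover have "vs ! i = y" using y \<open>Suc i = ?n\<close> by (metis diff_Suc_1)
    ultimately show ?thesis using x assms(1) by (simp only: insert_commute)
  qed
  ultimately show ?thesis unfolding is_cycle_def using vs(2) by blast
qed

section \<open>The graphic matroid of a finite simple graph\<close>

locale finite_simple_graph =
  fixes G :: "'v sgraph"
  assumes finite_edges: "finite (edges G)"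
    and edge_doubleton: "e \<in> edges G \<Longrightarrow> \<exists>x y. x \<noteq> y \<and> e = {x, y}"
begin

abbreviation "M \<equiv> graphic_matroid G"

lemma ground_M [simp]: "ground M = edges G"
  by (simp add: graphic_matroid_def)

lemma finite_sub: "A \<subseteq> edges G \<Longrightarrow> finite A"
  using finite_edges finite_subset by blast

lemma spanned_member: "e \<in> A \<Longrightarrow> e \<in> edges G \<Longrightarrow> spanned A e"
  using edge_doubleton conn_edge unfolding spanned_def by metis

lemma forest_iff:
  assumes "A \<subseteq> edges G"
  shows "forest A \<longleftrightarrow> (\<nexists>vs. is_cycle A vs)"
proof
  assume *: "\<nexists>vs. is_cycle A vs"
  show "forest A"
    unfolding forest_def
  proof
    fix e assume e: "e \<in> A"
    then obtain x y where "x \<noteq> y" "e = {x, y}" using assms edge_doubleton by blast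
    then show "\<not> spanned (A - {e}) e"
      using cycle_if_spanned[of x y A] * e by (auto simp: spanned_doubleton)
  qed
qed (use cycle_imp_not_forest in blast)

lemma indep_M: "A \<in> indep M \<longleftrightarrow> A \<subseteq> edges G \<and> forest A"
  using forest_iff by (auto simp: graphic_matroid_def)

lemma forest_insert:
  assumes "forest A" "\<not> spanned A e" "insert e A \<subseteq> edges G"
  shows "forest (insert e A)"
  unfolding forest_def
proof
  fix a assume a: "a \<in> insert e A"
  show "\<not> spanned (insert e A - {a}) a"
  proof (cases "a = e")
    case True
    have "insert e A - {e} \<subseteq> A" by auto
    then show ?thesis using True assms(2) spanned_mono by blast
  next
    case False
    then have aA: "a \<in> A" and eq: "insert e A - {a} = insert e (A - {a})" using a by auto
    obtain p q where "e = {p, q}" using assms(3) edge_doubleton[of e] by auto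
    moreover have "\<not> spanned (A - {a}) a" using assms(1) aA by (simp add: forest_def)
    moreover have "insert a (A - {a}) = A" using aA by auto
    ultimately show ?thesis using spanned_exchange[of e "A - {a}" a p q] assms(2) eq by auto
  qed
qed

text \<open>Steinitz exchange: an edge of \<open>I\<close> outside \<open>J\<close> is either
  dispensable for spanning \<open>J\<close>, or it can be traded for an edge of \<open>J\<close>.
  Both decrease \<open>card (I - J)\<close> without increasing \<open>card I\<close>.\<close>

lemma forest_card_le:
  assumes "forest J" "J \<subseteq> edges G" "I \<subseteq> edges G" "\<And>e. e \<in> J \<Longrightarrow> spanned I e"
  shows "card J \<le> card I"
  using assms(3,4)
proof (induction "card (I - J)" arbitrary: I rule: less_induct)
  case less
  note finI = finite_sub[OF less.prems(1)]
  show ?case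
  proof (cases "I \<subseteq> J")
    case True
    have "J \<subseteq> I"
    proof
      fix e assume e: "e \<in> J"
      show "e \<in> I"
      proof (rule ccontr)
        assume "e \<notin> I"
        then have "I \<subseteq> J - {e}" using True by auto
        then have "spanned (J - {e}) e" using less.prems(2)[OF e] spanned_mono by blast
        then show False using assms(1) e by (simp add: forest_def)
      qed
    qed
    then show ?thesis using card_mono[OF finI] by simp
  next
    case False
    then obtain f where f: "f \<in> I" "f \<notin> J" by auto
    let ?I = "I - {f}"
    have lt: "card (?I - J) < card (I - J)"
      using f finI by (intro psubset_card_mono) auto
    show ?thesis
    proof (cases "\<forall>e\<in>J. spanned ?I e")
      case True
      then have "card J \<le> card ?I" using less.hyps[OF lt] less.prems(1) by auto
      also have "\<dots> \<le> card I" by (rule card_Diff1_le)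
      finally show ?thesis .
    next
      case False
      then obtain e where e: "e \<in> J" "\<not> spanned ?I e" by auto
      let ?I' = "insert e ?I"
      have If: "insert f ?I = I" using f by auto
      obtain p q where "f = {p, q}" using f less.prems(1) edge_doubleton by blast
      then have sf: "spanned ?I' f"
        using spanned_exchange[of f ?I e p q] e less.prems(2)[OF e(1)] If by simp
      have sub: "?I' \<subseteq> edges G" using e less.prems(1) assms(2) by auto
      have "spanned ?I' a" if "a \<in> I" for a
        using that sf spanned_member[of a ?I'] less.prems(1) by (cases "a = f") auto
      then have "spanned ?I' a" if "a \<in> J" for a
        using spanned_trans[OF less.prems(2)[OF that]] by blast
      moreover have "?I' - J = ?I - J" using e(1) by auto
      ultimately have "card J \<le> card ?I'" using less.hyps[of ?I'] lt sub by auto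
      also have "\<dots> \<le> Suc (card ?I)" using finI by (simp add: card_insert_if)
      also have "\<dots> = card I" using card_Suc_Diff1[OF finI f(1)] by simp
      finally show ?thesis .
    qed
  qed
qed

lemma matroid_M: "matroid M"
proof -
  have "\<exists>x\<in>J - I. insert x I \<in> indep M"
    if IJ: "I \<in> indep M" "J \<in> indep M" "card I < card J" for I J
  proof -
    have "\<not> (\<forall>e\<in>J. spanned I e)" using forest_card_le[of J I] IJ unfolding indep_M by auto
    then obtain e where e: "e \<in> J" "\<not> spanned I e" by auto
    then have "e \<notin> I" using spanned_member[of e I] IJ by (auto simp: indep_M)
    moreover have "insert e I \<in> indep M" using forest_insert[of I e] e IJ unfolding indep_M by auto
    ultimately show ?thesis using e by auto
  qed
  moreover have "I \<in> indep M" if "J \<in> indep M" "I \<subseteq> J" for I J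
    using that forest_mono[of J I] unfolding indep_M by auto
  moreover have "{} \<in> indep M" by (simp add: indep_M forest_def)
  moreover have "indep M \<subseteq> Pow (edges G)" by (auto simp: indep_M)
  ultimately show ?thesis unfolding matroid_def using finite_edges by simp
qed

lemma forest_single: "x \<noteq> y \<Longrightarrow> forest {{x, y}}"
  using conn_cut[of "{}" x y "{x}"] by (auto simp: forest_def spanned_doubleton)

lemma loopless_M: "loopless M"
  unfolding loopless_def
proof
  fix e assume "e \<in> ground M"
  moreover from this obtain x y where "x \<noteq> y" "e = {x, y}" using edge_doubleton[of e] by auto
  ultimately show "{e} \<in> indep M" by (simp add: indep_M forest_single)
qed

lemma rank_in_eqI:
  assumes "F \<subseteq> edges G" "I \<subseteq> F" "forest I" "\<And>e. e \<in> F \<Longrightarrow> spanned I e"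
  shows "rank_in M F = card I"
proof (rule antisym)
  obtain J where J: "J \<in> indep M" "J \<subseteq> F" "card J = rank_in M F" using rank_in_basis[OF matroid_M] .
  moreover have "J \<subseteq> edges G" "I \<subseteq> edges G" using J(2) assms(1,2) by auto
  ultimately have "card J \<le> card I" using assms(4) by (intro forest_card_le) (auto simp: indep_M)
  then show "rank_in M F \<le> card I" using J by simp
  show "card I \<le> rank_in M F" using assms(1-3) by (intro card_le_rank_in matroid_M) (auto simp: indep_M)
qed

lemma spanning_forest:
  assumes "F \<subseteq> edges G"
  obtains I where "I \<subseteq> F" "forest I" "\<And>e. e \<in> F \<Longrightarrow> spanned I e" "card I = rank_in M F"
proof -
  obtain I where I: "I \<in> indep M" "I \<subseteq> F" "card I = rank_in M F" using rank_in_basis[OF matroid_M] .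
  have "spanned I e" if e: "e \<in> F" for e
  proof (rule ccontr)
    assume ns: "\<not> spanned I e"
    then have "e \<notin> I" using spanned_member[of e I] e assms by auto
    moreover have "insert e I \<in> indep M" using forest_insert[of I e] ns I e assms unfolding indep_M by auto
    then have "card (insert e I) \<le> rank_in M F" using card_le_rank_in[OF matroid_M] I e by blast
    ultimately show False using I finite_sub by (auto simp: indep_M)
  qed
  then show ?thesis using I by (intro that[of I]) (simp_all add: indep_M)
qed

lemma flat_iff_spanned: "F \<in> flats M \<longleftrightarrow> F \<subseteq> edges G \<and> (\<forall>e\<in>edges G. spanned F e \<longrightarrow> e \<in> F)"
proof (cases "F \<subseteq> edges G")
  case True
  obtain I where I: "I \<subseteq> F" "forest I" "\<And>e. e \<in> F \<Longrightarrow> spanned I e" "card I = rank_in M F"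
    using spanning_forest[OF True] by blast
  have rank: "rank_in M (insert e F) \<noteq> rank_in M F \<longleftrightarrow> \<not> spanned F e" if e: "e \<in> edges G" "e \<notin> F" for e
  proof (cases "spanned F e")
    case span: True
    then have "spanned I e" using I(3) spanned_trans by blast
    then have "rank_in M (insert e F) = card I" using I True e by (intro rank_in_eqI) auto
    then show ?thesis using I span by simp
  next
    case False
    then have "\<not> spanned I e" using I spanned_mono by blast
    then have "forest (insert e I)" using I True e by (intro forest_insert) auto
    moreover have "spanned (insert e I) a" if "a \<in> insert e F" for a
    proof (cases "a = e")
      case True
      then show ?thesis using spanned_member[of e "insert e I"] e by simp
    next
      case False
      then have "spanned I a" using that I(3) by simp
      then show ?thesis by (rule spanned_mono) auto
    qed
    ultimately have "rank_in M (insert e F) = card (insert e I)"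
      using I True e by (intro rank_in_eqI) auto
    moreover have "e \<notin> I" using e I by auto
    moreover have "finite I" using I(1) True by (intro finite_sub) auto
    ultimately show ?thesis using False I(4) by simp
  qed
  have "F \<in> flats M \<longleftrightarrow> (\<forall>e\<in>edges G - F. rank_in M (insert e F) \<noteq> rank_in M F)"
    using flat_iff[OF matroid_M, of F] True by simp
  also have "\<dots> \<longleftrightarrow> (\<forall>e\<in>edges G - F. \<not> spanned F e)" using rank by (intro ball_cong) blast+
  also have "\<dots> \<longleftrightarrow> F \<subseteq> edges G \<and> (\<forall>e\<in>edges G. spanned F e \<longrightarrow> e \<in> F)" using True by blast
  finally show ?thesis .
qed (use flat_subset[of F M] in auto)

text \<open>Deleting an edge spanned by the others would leave a spanning set with fewer edges than
  the rank. Acyclicity is thereby reduced to counting.\<close>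

lemma spanning_set_forest:
  assumes B: "B \<subseteq> edges G" "\<And>e. e \<in> edges G \<Longrightarrow> spanned B e" and card: "card B \<le> rk M"
  shows "forest B"
  unfolding forest_def
proof
  fix e assume e: "e \<in> B"
  show "\<not> spanned (B - {e}) e"
  proof
    assume s: "spanned (B - {e}) e"
    have "spanned (B - {e}) a" if "a \<in> B" for a
    proof (cases "a = e")
      case False
      then show ?thesis using that B(1) by (intro spanned_member) auto
    qed (simp add: s)
    then have span: "spanned (B - {e}) a" if "a \<in> edges G" for a
      using B(2)[OF that] by (rule spanned_trans[rotated])
    obtain I where I: "I \<subseteq> edges G" "forest I"
      "\<And>a. a \<in> edges G \<Longrightarrow> spanned I a" "card I = rank_in M (edges G)"
      using spanning_forest[OF order_refl] by metis
    have "B - {e} \<subseteq> edges G" using B(1) by auto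
    with span have "card I \<le> card (B - {e})" using I(1) by (intro forest_card_le[OF I(2,1)]) auto
    then have "rk M \<le> card (B - {e})" using I(4) by (simp add: rk_def)
    also have "\<dots> < card B" using e finite_sub[OF B(1)] by (intro psubset_card_mono) auto
    finally show False using card by simp
  qed
qed

end

section \<open>Flats of the wheel as cyclic words\<close>

text \<open>The letter at position \<open>i < n\<close> describes the rim vertex \<open>Suc i\<close> relative to a flat: it lies in the
  component of the hub (\<open>Hub\<close>), or it is joined to the preceding rim vertex (\<open>Cont\<close>), or it is the
  first vertex of its component (\<open>Start\<close>). The exceptional words excluded in \<open>good\<close> would describe
  the rim minus an edge, which is not closed.\<close>

datatype letter = Hub | Start | Cont

definition prv :: "nat \<Rightarrow> nat \<Rightarrow> nat" where
  "prv n i = (if i = 0 then n - 1 else i - 1)"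

definition spoke :: "nat \<Rightarrow> nat set" where
  "spoke i = {0, Suc i}"

definition rim :: "nat \<Rightarrow> nat \<Rightarrow> nat set" where
  "rim n i = {Suc i, Suc (prv n i)}"

definition good :: "nat \<Rightarrow> letter list \<Rightarrow> bool" where
  "good n w \<longleftrightarrow> length w = n \<and> (\<forall>i<n. w ! i = Cont \<longrightarrow> w ! prv n i \<noteq> Hub) \<and>
    \<not> (Hub \<notin> set w \<and> count_list w Start = 1)"

definition flat_of :: "nat \<Rightarrow> letter list \<Rightarrow> nat set set" where
  "flat_of n w = spoke ` {i. i < n \<and> w ! i = Hub} \<union>
    rim n ` {i. i < n \<and> (w ! i = Cont \<or> w ! i = Hub \<and> w ! prv n i = Hub)}"

text \<open>\<open>Hub\<close> takes precedence over \<open>Cont\<close>: a rim edge between two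
  vertices of the hub component is forced by closure and is not recorded.\<close>

definition word_of :: "nat \<Rightarrow> nat set set \<Rightarrow> letter list" where
  "word_of n F = map (\<lambda>i. if spoke i \<in> F then Hub else if rim n i \<in> F then Cont else Start) [0..<n]"

lemma length_word_of [simp]: "length (word_of n F) = n"
  by (simp add: word_of_def)

lemma nth_word_of:
  "i < n \<Longrightarrow> word_of n F ! i = (if spoke i \<in> F then Hub else if rim n i \<in> F then Cont else Start)"
  by (simp add: word_of_def)

lemma count_list_eq_card: "count_list w x = card {i. i < length w \<and> w ! i = x}"
  by (simp add: count_list_eq_length_filter length_filter_conv_card eq_commute)

lemma spoke_eq_iff [simp]: "spoke i = spoke j \<longleftrightarrow> i = j"
  by (auto simp: spoke_def doubleton_eq_iff)

lemma spoke_neq_rim [simp]: "spoke i \<noteq> rim n j"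
  by (auto simp: spoke_def rim_def doubleton_eq_iff)

lemmas rim_neq_spoke [simp] = spoke_neq_rim[symmetric]

lemma spoke_in_flat_of: "spoke i \<in> flat_of n w \<longleftrightarrow> i < n \<and> w ! i = Hub"
  by (auto simp: flat_of_def)

text \<open>For \<open>n = 2\<close> both rim positions name the same edge. Only
  \<open>[Cont, Cont]\<close> among the good words contains \<open>Cont\<close>, so decoding stays
  unambiguous.\<close>

lemma good_2: "good 2 w \<Longrightarrow> w \<in> {[Hub, Hub], [Hub, Start], [Start, Hub], [Start, Start], [Cont, Cont]}"
proof -
  assume w: "good 2 w"
  then obtain a b where "w = [a, b]" by (auto simp: good_def length_Suc_conv numeral_2_eq_2)
  then show ?thesis using w
    by (cases a; cases b) (auto simp: good_def prv_def numeral_2_eq_2 All_less_Suc)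
qed

section \<open>The wheel: its edges, and the correspondence of flats and good words\<close>

locale wheel_graph =
  fixes n :: nat
  assumes n: "n \<ge> 2"
begin

lemma prv_less: "i < n \<Longrightarrow> prv n i < n"
  by (auto simp: prv_def)

lemma prv_neq: "i < n \<Longrightarrow> prv n i \<noteq> i"
  using n by (auto simp: prv_def)

lemma edges_wheel: "edges (wheel n) = spoke ` {..<n} \<union> rim n ` {..<n}"
proof -
  have "{{0, i} | i. 1 \<le> i \<and> i \<le> n} = spoke ` {..<n}"
  proof (intro set_eqI iffI)
    fix e assume "e \<in> {{0, i} | i. 1 \<le> i \<and> i \<le> n}"
    then obtain i where "e = {0, i}" "1 \<le> i" "i \<le> n" by blast
    then show "e \<in> spoke ` {..<n}" by (intro image_eqI[of _ _ "i - 1"]) (auto simp: spoke_def)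
  qed (force simp: spoke_def)
  moreover have "{{i, i + 1} | i. 1 \<le> i \<and> i < n} \<union> {{n, 1}} = rim n ` {..<n}"
  proof (intro set_eqI iffI)
    fix e assume "e \<in> {{i, i + 1} | i. 1 \<le> i \<and> i < n} \<union> {{n, 1}}"
    then consider i where "e = {i, i + 1}" "1 \<le> i" "i < n" | "e = {n, 1}" by blast
    then show "e \<in> rim n ` {..<n}"
    proof cases
      case 1
      then show ?thesis by (intro image_eqI[of _ _ i]) (auto simp: rim_def prv_def)
    next
      case 2
      then show ?thesis using n by (intro image_eqI[of _ _ 0]) (auto simp: rim_def prv_def)
    qed
  next
    fix e assume "e \<in> rim n ` {..<n}"
    then obtain i where i: "e = rim n i" "i < n" by auto
    show "e \<in> {{i, i + 1} | i. 1 \<le> i \<and> i < n} \<union> {{n, 1}}"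
    proof (cases "i = 0")
      case True
      then show ?thesis using i n by (auto simp: rim_def prv_def)
    next
      case False
      then have "e = {i, i + 1}" using i by (auto simp: rim_def prv_def)
      then show ?thesis using False i by fastforce
    qed
  qed
  ultimately show ?thesis unfolding wheel_def by auto
qed

sublocale finite_simple_graph "wheel n"
proof
  show "finite (edges (wheel n))" by (simp add: edges_wheel)
  fix e assume "e \<in> edges (wheel n)"
  then consider i where "e = spoke i" | i where "e = rim n i" "i < n" unfolding edges_wheel by auto
  then show "\<exists>x y. x \<noteq> y \<and> e = {x, y}"
  proof cases
    case (1 i)
    then show ?thesis by (intro exI[of _ 0] exI[of _ "Suc i"]) (simp add: spoke_def)
  next
    case (2 i)
    then show ?thesis using prv_neq[of i] by (intro exI[of _ "Suc i"] exI[of _ "Suc (prv n i)"]) (simp add: rim_def)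
  qed
qed

lemma spanned_if_conn_hub:
  assumes B: "\<And>j. j < n \<Longrightarrow> conn B 0 (Suc j)" and e: "e \<in> edges (wheel n)"
  shows "spanned B e"
proof -
  from e consider i where "e = spoke i" "i < n" | i where "e = rim n i" "i < n"
    unfolding edges_wheel by auto
  then show ?thesis
  proof cases
    case (1 i)
    then show ?thesis using B[of i] by (simp add: spoke_def spanned_doubleton)
  next
    case (2 i)
    have "conn B (Suc i) (Suc (prv n i))"
      using conn_trans[OF conn_sym[OF B] B] 2 prv_less by blast
    then show ?thesis using 2 by (simp add: rim_def spanned_doubleton)
  qed
qed

lemma flat_of_subset: "flat_of n w \<subseteq> edges (wheel n)"
  unfolding edges_wheel flat_of_def by auto

lemma rim_eq_imp:
  assumes "i < n" "j < n" "i \<noteq> j" "rim n i = rim n j"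
  shows "n = 2 \<and> prv n i = j \<and> prv n j = i"
proof -
  have "prv n i = j \<and> prv n j = i"
    using assms by (auto simp: rim_def doubleton_eq_iff)
  then show ?thesis using assms(1-3) n unfolding prv_def by (auto split: if_splits)
qed

lemma rim_in_flat_of:
  assumes w: "good n w" and i: "i < n"
  shows "rim n i \<in> flat_of n w \<longleftrightarrow> w ! i = Cont \<or> w ! i = Hub \<and> w ! prv n i = Hub"
proof
  assume "rim n i \<in> flat_of n w"
  then obtain j where j: "j < n" "w ! j = Cont \<or> w ! j = Hub \<and> w ! prv n j = Hub" "rim n i = rim n j"
    using spoke_neq_rim by (auto simp: flat_of_def)
  show "w ! i = Cont \<or> w ! i = Hub \<and> w ! prv n i = Hub"
  proof (cases "i = j")
    case False
    then have p: "n = 2" "prv n i = j" "prv n j = i" using rim_eq_imp[OF i j(1)] j(3) by auto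
    have "w \<in> {[Hub, Hub], [Hub, Start], [Start, Hub], [Start, Start], [Cont, Cont]}"
      using w p(1) good_2 by simp
    moreover have "i = 0 \<and> j = 1 \<or> i = 1 \<and> j = 0" using i j(1) p(1) False by auto
    ultimately have "w ! j = Cont \<longrightarrow> w ! i = Cont" by auto
    then show ?thesis using j(2) p by auto
  qed (use j in simp)
qed (use i in \<open>auto simp: flat_of_def\<close>)

text \<open>No edge of the flat leaves the set of vertices without letter \<open>Hub\<close>: they
  have no spokes, and a \<open>Cont\<close> never follows a \<open>Hub\<close>.\<close>

lemma conn_nonhub:
  assumes w: "good n w" and x: "conn (flat_of n w) (Suc i) y" "i < n" "w ! i \<noteq> Hub"
  shows "\<exists>j<n. y = Suc j \<and> w ! j \<noteq> Hub"
proof -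
  let ?X = "{Suc j | j. j < n \<and> w ! j \<noteq> Hub}"
  have "y \<in> ?X"
  proof (rule conn_cut[OF x(1)])
    fix a b assume ab: "{a, b} \<in> flat_of n w" "a \<in> ?X"
    then consider j where "{a, b} = spoke j" "w ! j = Hub"
      | j where "{a, b} = rim n j" "j < n" "w ! j = Cont"
      | j where "{a, b} = rim n j" "w ! j = Hub" "w ! prv n j = Hub"
      unfolding flat_of_def by blast
    then show "b \<in> ?X"
    proof cases
      case 1
      then show ?thesis using ab(2) by (auto simp: spoke_def doubleton_eq_iff)
    next
      case 2
      moreover have "w ! prv n j \<noteq> Hub" using w 2 by (simp add: good_def)
      ultimately show ?thesis using prv_less[of j] by (auto simp: rim_def doubleton_eq_iff)
    next
      case 3
      then show ?thesis using ab(2) by (auto simp: rim_def doubleton_eq_iff)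
    qed
  qed (use x in auto)
  then show ?thesis by blast
qed

text \<open>Two adjacent rim vertices in different components are separated by the arc that ends at the
  first of them.\<close>

lemma rim_not_spanned:
  assumes w: "good n w" and i: "i < n" "w ! i = Start" "w ! prv n i \<noteq> Hub"
  shows "\<not> conn (flat_of n w) (Suc (prv n i)) (Suc i)"
proof
  assume conn: "conn (flat_of n w) (Suc (prv n i)) (Suc i)"
  \<comment> \<open>\<open>d j\<close> counts the steps backwards around the rim from
    \<open>i\<close> to \<open>j\<close>, with value \<open>n\<close> instead of 0 at
    \<open>i\<close> itself, so that \<open>i\<close> is reached last.\<close>
  define d where "d j = (if j < i then i - j else i + n - j)" for j
  have d_prv: "d (prv n j) = Suc (d j)" if "j < n" "j \<noteq> i" for j
    using that i(1) by (auto simp: d_def prv_def)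
  have d_first: "d (prv n i) = 1" using i(1) n by (auto simp: d_def prv_def)
  have d_inj: "j = k" if "j < n" "k < n" "d j = d k" for j k
    using that i(1) by (auto simp: d_def split: if_splits)
  have d_le: "d j < n" if "j < n" "j \<noteq> i" for j using that i(1) by (auto simp: d_def)
  have d_pos: "d j \<ge> 1" if "j < n" for j using that by (auto simp: d_def)
  \<comment> \<open>A second letter other than \<open>Cont\<close>, which stops the arc before it
    comes round to \<open>i\<close>. If no \<open>Hub\<close> occurs, it exists because words with a
    lone \<open>Start\<close> are excluded.\<close>
  obtain k where k: "k < n" "k \<noteq> i" "w ! k \<noteq> Cont"
  proof (cases "Hub \<in> set w")
    case True
    then obtain k where "k < n" "w ! k = Hub" using w unfolding good_def in_set_conv_nth by blast
    then show ?thesis using i(2) by (intro that[of k]) auto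
  next
    case False
    then have "card {k. k < n \<and> w ! k = Start} \<noteq> 1"
      using w unfolding good_def count_list_eq_card by blast
    then have "{k. k < n \<and> w ! k = Start} \<noteq> {i}" by force
    then obtain k where "k < n" "w ! k = Start" "k \<noteq> i" using i by blast
    then show ?thesis using that[of k] by auto
  qed
  \<comment> \<open>The arc: vertices met when walking back from the predecessor of \<open>i\<close>
    through letters \<open>Cont\<close>, including the \<open>Start\<close> at which the walk
    stops.\<close>
  let ?X = "{Suc j | j. j < n \<and> w ! j \<noteq> Hub \<and> d j \<le> d k \<and> (\<forall>l<n. d l < d j \<longrightarrow> w ! l = Cont)}"
  have "Suc i \<in> ?X"
  proof (rule conn_cut[OF conn])
    show "Suc (prv n i) \<in> ?X"
    proof -
      have "w ! l = Cont" if "l < n" "d l < d (prv n i)" for l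
        using d_pos[OF that(1)] that(2) d_first by linarith
      moreover have "d (prv n i) \<le> d k" using d_pos[OF k(1)] d_first by simp
      ultimately show ?thesis using i(3) prv_less[OF i(1)] by blast
    qed
  next
    fix a b assume ab: "{a, b} \<in> flat_of n w" "a \<in> ?X"
    then consider j where "{a, b} = spoke j" "w ! j = Hub"
      | j where "{a, b} = rim n j" "j < n" "w ! j = Cont"
      | j where "{a, b} = rim n j" "w ! j = Hub" "w ! prv n j = Hub"
      unfolding flat_of_def by blast
    then show "b \<in> ?X"
    proof cases
      case 1
      then show ?thesis using ab(2) by (auto simp: spoke_def doubleton_eq_iff)
    next
      case 3
      then show ?thesis using ab(2) by (auto simp: rim_def doubleton_eq_iff)
    next
      case (2 j)
      then have ji: "j \<noteq> i" using i(2) by auto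
      have dj: "d (prv n j) = Suc (d j)" using d_prv 2 ji by blast
      consider "a = Suc j" "b = Suc (prv n j)" | "b = Suc j" "a = Suc (prv n j)"
        using 2(1) by (auto simp: rim_def doubleton_eq_iff)
      then show ?thesis
      proof cases
        case 1
        then have "d j \<le> d k" and all: "\<forall>l<n. d l < d j \<longrightarrow> w ! l = Cont" using ab(2) by blast+
        moreover have "d j \<noteq> d k" using d_inj[of j k] 2(2,3) k(1,3) by metis
        ultimately have "d (prv n j) \<le> d k" using dj by linarith
        moreover have "w ! l = Cont" if "l < n" "d l < d (prv n j)" for l
        proof (cases "d l = d j")
          case True
          then have "l = j" using d_inj that(1) 2(2) by blast
          then show ?thesis using 2(3) by simp
        next
          case False
          then have "d l < d j" using that(2) dj by linarith
          then show ?thesis using all that(1) by blast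
        qed
        moreover have "w ! prv n j \<noteq> Hub" using w 2 by (simp add: good_def)
        ultimately show ?thesis using 1 prv_less 2 by blast
      next
        case second: 2
        then have *: "d (prv n j) \<le> d k" "\<forall>l<n. d l < d (prv n j) \<longrightarrow> w ! l = Cont" using ab(2) by blast+
        have "d j \<le> d k" using *(1) dj by linarith
        moreover have "w ! l = Cont" if "l < n" "d l < d j" for l
          using *(2) that dj by (metis less_SucI)
        moreover have "w ! j \<noteq> Hub" using 2(3) by simp
        ultimately show ?thesis using second(1) 2(2) by blast
      qed
    qed
  qed
  then have "d i \<le> d k" by blast
  moreover have "d i = n" by (simp add: d_def)
  ultimately show False using d_le[OF k(1,2)] by simp
qed

lemma flat_of_flat:
  assumes w: "good n w"
  shows "flat_of n w \<in> flats M"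
proof -
  have "e \<in> flat_of n w" if e: "e \<in> edges (wheel n)" "spanned (flat_of n w) e" for e
  proof -
    from e(1) consider i where "e = spoke i" "i < n" | i where "e = rim n i" "i < n"
      unfolding edges_wheel by auto
    then show ?thesis
    proof cases
      case (1 i)
      have "conn (flat_of n w) (Suc i) 0"
        using e(2) 1 by (intro conn_sym[of _ 0]) (simp add: spoke_def spanned_doubleton)
      then have "w ! i = Hub" using conn_nonhub[OF w, of i 0] 1(2) by blast
      then show ?thesis using 1 by (simp add: spoke_in_flat_of)
    next
      case (2 i)
      have c: "conn (flat_of n w) (Suc i) (Suc (prv n i))"
        using e(2) 2 unfolding rim_def by (simp add: spanned_doubleton)
      have hub: "w ! i = Hub \<longleftrightarrow> w ! prv n i = Hub"
        using conn_nonhub[OF w c 2(2)] conn_nonhub[OF w conn_sym[OF c] prv_less[OF 2(2)]]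
        by (metis nat.inject)
      have "w ! i \<noteq> Start" using rim_not_spanned[OF w 2(2)] conn_sym[OF c] hub by force
      then show ?thesis using 2 hub rim_in_flat_of[OF w 2(2)] by (cases "w ! i") auto
    qed
  qed
  then show ?thesis using flat_of_subset unfolding flat_iff_spanned by blast
qed

lemma conn_arc:
  assumes "a \<le> b" "b < n" "\<And>j. a < j \<Longrightarrow> j \<le> b \<Longrightarrow> rim n j \<in> F"
  shows "conn F (Suc b) (Suc a)"
  using assms
proof (induction b rule: dec_induct)
  case (step b)
  have "rim n (Suc b) \<in> F" using step.hyps step.prems(2)[of "Suc b"] by simp
  then have "conn F (Suc (Suc b)) (Suc b)" by (intro conn_edge) (simp add: rim_def prv_def)
  moreover have "conn F (Suc b) (Suc a)" using step.prems by (intro step.IH) auto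
  ultimately show ?case by (rule conn_trans)
qed simp

text \<open>A circle minus one edge is a path. This rules out words with a lone \<open>Start\<close>
  and no \<open>Hub\<close>, and it gives the rank of the full rim.\<close>

lemma conn_broken_rim:
  assumes "i < n" "\<And>j. j < n \<Longrightarrow> j \<noteq> i \<Longrightarrow> rim n j \<in> F"
  shows "conn F (Suc i) (Suc (prv n i))"
proof (cases "i = 0")
  case True
  have "conn F (Suc (n - 1)) (Suc 0)"
  proof (rule conn_arc)
    fix j assume "0 < j" "j \<le> n - 1"
    then show "rim n j \<in> F" using n True by (intro assms(2)) linarith+
  qed (use n in linarith)+
  then show ?thesis using True by (simp add: prv_def conn_sym)
next
  case False
  have "rim n 0 \<in> F" using assms(2)[of 0] False n by auto
  then have 1: "conn F (Suc 0) (Suc (n - 1))" by (intro conn_edge) (simp add: rim_def prv_def)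
  have 2: "conn F (Suc (n - 1)) (Suc i)"
  proof (rule conn_arc)
    fix j assume "i < j" "j \<le> n - 1"
    then show "rim n j \<in> F" using n by (intro assms(2)) linarith+
  qed (use assms(1) in linarith)+
  have "conn F (Suc (i - 1)) (Suc 0)"
  proof (rule conn_arc)
    fix j assume "0 < j" "j \<le> i - 1"
    then show "rim n j \<in> F" using assms(1) by (intro assms(2)) linarith+
  qed (use assms(1) in linarith)+
  then have "conn F (Suc (i - 1)) (Suc i)" using conn_trans[OF 1 2] by (rule conn_trans)
  then show ?thesis using False by (simp add: prv_def conn_sym)
qed

lemma word_of_flat:
  assumes F: "F \<in> flats M"
  shows "good n (word_of n F)" and "flat_of n (word_of n F) = F"
proof -
  let ?w = "word_of n F"
  have Fs: "F \<subseteq> edges (wheel n)" and closed: "\<And>x y. {x, y} \<in> edges (wheel n) \<Longrightarrow> conn F x y \<Longrightarrow> {x, y} \<in> F"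
    using F unfolding flat_iff_spanned by (blast, metis spanned_doubleton)
  have sp: "spoke i \<in> F" if "conn F 0 (Suc i)" "i < n" for i
  proof -
    have "{0, Suc i} \<in> edges (wheel n)" using that(2) by (auto simp: edges_wheel spoke_def)
    then show ?thesis using closed that(1) by (simp add: spoke_def)
  qed
  have rm: "rim n i \<in> F" if "conn F (Suc i) (Suc (prv n i))" "i < n" for i
  proof -
    have "{Suc i, Suc (prv n i)} \<in> edges (wheel n)" using that(2) by (auto simp: edges_wheel rim_def)
    then show ?thesis using closed that(1) by (simp add: rim_def)
  qed
  have csp: "conn F 0 (Suc i)" if "spoke i \<in> F" for i using that by (intro conn_edge) (simp add: spoke_def)
  have crm: "conn F (Suc i) (Suc (prv n i))" if "rim n i \<in> F" for i
    using that by (intro conn_edge) (simp add: rim_def)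
  have tri: "spoke i \<in> F \<longleftrightarrow> spoke (prv n i) \<in> F" if "rim n i \<in> F" "i < n" for i
  proof
    have c: "conn F (Suc i) (Suc (prv n i))" by (rule crm[OF that(1)])
    show "spoke (prv n i) \<in> F" if "spoke i \<in> F"
      using conn_trans[OF csp[OF that] c] prv_less[OF \<open>i < n\<close>] by (rule sp)
    show "spoke i \<in> F" if "spoke (prv n i) \<in> F"
      using conn_trans[OF csp[OF that] conn_sym[OF c]] \<open>i < n\<close> by (rule sp)
  qed
  have tri2: "rim n i \<in> F" if "spoke i \<in> F" "spoke (prv n i) \<in> F" "i < n" for i
    using conn_trans[OF conn_sym[OF csp[OF that(1)]] csp[OF that(2)]] that(3) by (rule rm)
  have "\<not> (Hub \<notin> set ?w \<and> count_list ?w Start = 1)"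
  proof
    assume *: "Hub \<notin> set ?w \<and> count_list ?w Start = 1"
    then have "card {i. i < length ?w \<and> ?w ! i = Start} = 1" by (simp only: count_list_eq_card)
    then obtain i where "{i. i < length ?w \<and> ?w ! i = Start} = {i}" using card_1_singletonE by blast
    then have iff: "j < n \<and> ?w ! j = Start \<longleftrightarrow> j = i" for j by (auto simp: set_eq_iff)
    have i: "i < n" "?w ! i = Start" using iff[of i] by auto
    have "rim n j \<in> F" if "j < n" "j \<noteq> i" for j
    proof -
      have "?w ! j \<noteq> Hub" using * that(1) nth_mem[of j ?w] by fastforce
      moreover have "?w ! j \<noteq> Start" using iff[of j] that by simp
      ultimately show ?thesis using that(1) by (auto simp: nth_word_of split: if_splits)
    qed
    then have "rim n i \<in> F" using rm conn_broken_rim[OF i(1)] i(1) by blast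
    then show False using i by (auto simp: nth_word_of split: if_splits)
  qed
  moreover have "?w ! prv n i \<noteq> Hub" if "i < n" "?w ! i = Cont" for i
    using that tri[of i] prv_less[of i] by (auto simp: nth_word_of split: if_splits)
  ultimately show g: "good n ?w" by (simp add: good_def)
  show "flat_of n ?w = F"
  proof (intro set_eqI iffI)
    fix e assume "e \<in> F"
    then consider i where "e = spoke i" "i < n" | i where "e = rim n i" "i < n"
      using Fs unfolding edges_wheel by auto
    then show "e \<in> flat_of n ?w"
    proof cases
      case (1 i)
      then show ?thesis using \<open>e \<in> F\<close> by (simp add: spoke_in_flat_of nth_word_of)
    next
      case (2 i)
      then show ?thesis using \<open>e \<in> F\<close> tri[of i] prv_less[of i] by (simp add: rim_in_flat_of[OF g] nth_word_of)
    qed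
  next
    fix e assume "e \<in> flat_of n ?w"
    then consider i where "e = spoke i" "i < n" "?w ! i = Hub"
      | i where "e = rim n i" "i < n" "?w ! i = Cont"
      | i where "e = rim n i" "i < n" "?w ! i = Hub" "?w ! prv n i = Hub"
      unfolding flat_of_def by blast
    then show "e \<in> F"
    proof cases
      case (3 i)
      then have "spoke i \<in> F" "spoke (prv n i) \<in> F"
        using prv_less[of i] by (auto simp: nth_word_of split: if_splits)
      then show ?thesis using tri2 3 by simp
    qed (auto simp: nth_word_of split: if_splits)
  qed
qed

lemma word_of_flat_of:
  assumes w: "good n w"
  shows "word_of n (flat_of n w) = w"
proof (rule nth_equalityI)
  show "length (word_of n (flat_of n w)) = length w" using w by (simp add: good_def)
  fix i assume "i < length (word_of n (flat_of n w))"
  then have i: "i < n" by simp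
  show "word_of n (flat_of n w) ! i = w ! i"
    using rim_in_flat_of[OF w i] i by (cases "w ! i") (auto simp: nth_word_of spoke_in_flat_of)
qed

text \<open>Inclusion of flats is a condition on pairs of consecutive letters. This locality is what
  permits summation letter by letter.\<close>

lemma flat_of_mono_iff:
  assumes w: "good n w" and v: "good n v"
  shows "flat_of n w \<subseteq> flat_of n v \<longleftrightarrow>
    (\<forall>i<n. (w ! i = Hub \<longrightarrow> v ! i = Hub) \<and>
      (w ! i = Cont \<longrightarrow> v ! i = (if v ! prv n i = Hub then Hub else Cont)))"
proof
  assume sub: "flat_of n w \<subseteq> flat_of n v"
  show "\<forall>i<n. (w ! i = Hub \<longrightarrow> v ! i = Hub) \<and>
      (w ! i = Cont \<longrightarrow> v ! i = (if v ! prv n i = Hub then Hub else Cont))"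
  proof (intro allI impI conjI)
    fix i assume i: "i < n"
    show "v ! i = Hub" if "w ! i = Hub"
      using subsetD[OF sub, of "spoke i"] that i by (simp add: spoke_in_flat_of)
    assume "w ! i = Cont"
    then have "rim n i \<in> flat_of n v"
      using subsetD[OF sub, of "rim n i"] i by (simp add: rim_in_flat_of[OF w])
    then have "v ! i = Cont \<or> v ! i = Hub \<and> v ! prv n i = Hub" by (simp add: rim_in_flat_of[OF v i])
    moreover have "v ! i = Cont \<Longrightarrow> v ! prv n i \<noteq> Hub" using v i by (simp add: good_def)
    ultimately show "v ! i = (if v ! prv n i = Hub then Hub else Cont)" by auto
  qed
next
  assume *: "\<forall>i<n. (w ! i = Hub \<longrightarrow> v ! i = Hub) \<and>
      (w ! i = Cont \<longrightarrow> v ! i = (if v ! prv n i = Hub then Hub else Cont))"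
  show "flat_of n w \<subseteq> flat_of n v"
  proof
    fix e assume "e \<in> flat_of n w"
    then consider i where "e = spoke i" "i < n" "w ! i = Hub"
      | i where "e = rim n i" "i < n" "w ! i = Cont"
      | i where "e = rim n i" "i < n" "w ! i = Hub" "w ! prv n i = Hub"
      unfolding flat_of_def by blast
    then show "e \<in> flat_of n v"
    proof cases
      case (1 i)
      then show ?thesis using * by (simp add: spoke_in_flat_of)
    next
      case (2 i)
      then have "v ! i = (if v ! prv n i = Hub then Hub else Cont)" using * by blast
      then show ?thesis using 2 by (simp add: rim_in_flat_of[OF v])
    next
      case (3 i)
      then have "v ! i = Hub" "v ! prv n i = Hub" using * prv_less[of i] by blast+
      then show ?thesis using 3 by (simp add: rim_in_flat_of[OF v])
    qed
  qed
qed

subsection \<open>Ranks\<close>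

lemma rk_wheel: "rk M = n"
proof -
  let ?I = "spoke ` {..<n}"
  have "\<not> spanned (?I - {e}) e" if "e \<in> ?I" for e
  proof -
    obtain i where e: "e = spoke i" using \<open>e \<in> ?I\<close> by auto
    have "\<not> conn (?I - {e}) (Suc i) 0"
    proof
      assume "conn (?I - {e}) (Suc i) 0"
      then have "0 \<in> {Suc i}"
        by (rule conn_cut) (auto simp: e spoke_def doubleton_eq_iff)
      then show False by simp
    qed
    then show ?thesis using conn_sym[of "?I - {e}" 0 "Suc i"]
      unfolding e spoke_def[of i] spanned_doubleton by blast
  qed
  then have "forest ?I" by (simp add: forest_def)
  moreover have c: "conn ?I 0 (Suc i)" if "i < n" for i
    using that by (intro conn_edge) (auto simp: spoke_def)
  then have "spanned ?I e" if "e \<in> edges (wheel n)" for e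
    using spanned_if_conn_hub that by blast
  ultimately have "rank_in M (edges (wheel n)) = card ?I"
    by (intro rank_in_eqI) (auto simp: edges_wheel)
  also have "\<dots> = n" by (subst card_image) (auto simp: inj_on_def)
  finally show ?thesis by (simp add: rk_def)
qed

text \<open>One edge is chosen for each rim vertex. Starting at \<open>i0\<close>, which has its
  spoke, and going once around the rim, every vertex is tied to the hub.\<close>

lemma word_forest:
  assumes "length w = n" and i0: "i0 < n" "w ! i0 \<noteq> Cont"
  defines "e \<equiv> \<lambda>i. if w ! i = Cont then rim n i else spoke i"
  shows "forest (e ` {..<n})" and "inj_on e {..<n}"
proof -
  let ?B = "e ` {..<n}"
  have next_conn: "conn ?B 0 (Suc i)" if "i < n" "w ! i = Cont \<Longrightarrow> conn ?B 0 (Suc (prv n i))" for i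
  proof (cases "w ! i = Cont")
    case True
    then have "rim n i \<in> ?B" using that(1) by (auto simp: e_def)
    then have "conn ?B (Suc i) (Suc (prv n i))" by (intro conn_edge) (simp add: rim_def)
    then show ?thesis using conn_trans[OF that(2)[OF True] conn_sym] by blast
  next
    case False
    then have "spoke i \<in> ?B" using that(1) by (auto simp: e_def)
    then show ?thesis by (intro conn_edge) (simp add: spoke_def)
  qed
  have from_i0: "conn ?B 0 (Suc j)" if "i0 \<le> j" "j < n" for j
    using that
  proof (induction j rule: dec_induct)
    case base
    show ?case using i0 by (intro next_conn[of i0]) simp_all
  next
    case (step j)
    then show ?case using next_conn[of "Suc j"] by (simp add: prv_def)
  qed
  have all: "conn ?B 0 (Suc j)" if "j < n" for j
    using that
  proof (induction j)
    case 0
    then show ?case using from_i0[of "n - 1"] i0 next_conn[of 0] by (simp add: prv_def)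
  next
    case (Suc j)
    then show ?case using next_conn[of "Suc j"] by (simp add: prv_def)
  qed
  have sub: "?B \<subseteq> edges (wheel n)" by (auto simp: e_def edges_wheel)
  have span: "spanned ?B a" if "a \<in> edges (wheel n)" for a
    using spanned_if_conn_hub all that by blast
  \<comment> \<open>At most \<open>n\<close> edges span a matroid of rank \<open>n\<close>, so there
    are exactly \<open>n\<close> and they form a tree. Distinctness of the chosen edges falls out of
    the count.\<close>
  have le: "card ?B \<le> n" using card_image_le[of "{..<n}" e] by simp
  show f: "forest ?B" using sub span le rk_wheel by (intro spanning_set_forest) auto
  have "rk M = card ?B" unfolding rk_def ground_M by (rule rank_in_eqI[OF order_refl sub f span])
  then show "inj_on e {..<n}" using rk_wheel by (intro eq_card_imp_inj_on) auto
qed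

lemma card_not_Start:
  assumes "length w = n"
  shows "card {i. i < n \<and> w ! i \<noteq> Start} = n - count_list w Start"
proof -
  have "{i. i < n \<and> w ! i \<noteq> Start} = {..<n} - {i. i < n \<and> w ! i = Start}" by auto
  then show ?thesis using assms by (simp add: count_list_eq_card card_Diff_subset subset_iff)
qed

text \<open>From the tree of \<open>word_forest\<close> the spokes chosen at letters
  \<open>Start\<close> are dropped; the rest spans the flat.\<close>

lemma rank_flat_of:
  assumes w: "good n w" and nc: "\<not> set w \<subseteq> {Cont}"
  shows "rank_in M (flat_of n w) = n - count_list w Start"
proof -
  have len: "length w = n" using w by (simp add: good_def)
  obtain x where "x \<in> set w" "x \<noteq> Cont" using nc by auto
  then obtain i0 where i0: "i0 < n" "w ! i0 \<noteq> Cont" using len by (auto simp: in_set_conv_nth)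
  define e where "e = (\<lambda>i. if w ! i = Cont then rim n i else spoke i)"
  let ?J = "{i. i < n \<and> w ! i \<noteq> Start}"
  have f: "forest (e ` {..<n})" "inj_on e {..<n}"
    unfolding e_def by (rule word_forest[OF len i0])+
  have forest: "forest (e ` ?J)" by (rule forest_mono[OF f(1)]) auto
  have sub: "e ` ?J \<subseteq> flat_of n w"
  proof
    fix a assume "a \<in> e ` ?J"
    then obtain i where i: "a = e i" "i < n" "w ! i \<noteq> Start" by blast
    then show "a \<in> flat_of n w" by (cases "w ! i") (simp_all add: e_def flat_of_def)
  qed
  have member: "spanned (e ` ?J) (e i)" if "i < n" "w ! i \<noteq> Start" for i
  proof -
    have "e i \<in> e ` ?J" using that by blast
    moreover from this have "e i \<in> edges (wheel n)" using sub flat_of_subset by (meson subsetD)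
    ultimately show ?thesis by (rule spanned_member)
  qed
  have span: "spanned (e ` ?J) a" if "a \<in> flat_of n w" for a
  proof -
    from that consider i where "a = spoke i" "i < n" "w ! i = Hub"
      | i where "a = rim n i" "i < n" "w ! i = Cont"
      | i where "a = rim n i" "i < n" "w ! i = Hub" "w ! prv n i = Hub"
      unfolding flat_of_def by blast
    then show ?thesis
    proof cases
      case (1 i)
      then show ?thesis using member[of i] by (simp add: e_def)
    next
      case (2 i)
      then show ?thesis using member[of i] by (simp add: e_def)
    next
      case (3 i)
      have "conn (e ` ?J) 0 (Suc j)" if "j < n" "w ! j = Hub" for j
        using member[of j] that by (simp add: e_def spoke_def spanned_doubleton)
      from this[of i] this[of "prv n i"]
      have "conn (e ` ?J) 0 (Suc i)" "conn (e ` ?J) 0 (Suc (prv n i))" using 3 prv_less by simp_all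
      then have "conn (e ` ?J) (Suc i) (Suc (prv n i))" by (rule conn_trans[OF conn_sym])
      then show ?thesis using 3 by (simp add: rim_def spanned_doubleton)
    qed
  qed
  have "rank_in M (flat_of n w) = card (e ` ?J)"
    by (rule rank_in_eqI[OF flat_of_subset sub forest span])
  also have "\<dots> = card ?J" by (rule card_image) (rule inj_on_subset[OF f(2)], auto)
  finally show ?thesis using card_not_Start[OF len] by simp
qed

lemma rank_flat_of_Cont: "rank_in M (flat_of n (replicate n Cont)) = n - 1"
proof -
  \<comment> \<open>The tree of this word contains all rim edges but \<open>rim n 0\<close>.\<close>
  define v where "v = Start # replicate (n - 1) Cont"
  define e where "e = (\<lambda>i. if v ! i = Cont then rim n i else spoke i)"
  have v: "length v = n" "v ! 0 \<noteq> Cont" using n by (auto simp: v_def)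
  have f: "forest (e ` {..<n})" "inj_on e {..<n}"
    unfolding e_def by (rule word_forest[OF v(1) _ v(2)]; use n in linarith)+
  have e: "e i = rim n i" if "1 \<le> i" "i < n" for i
    using that by (auto simp: e_def v_def nth_Cons')
  let ?I = "rim n ` {1..<n}"
  have I: "?I = e ` {1..<n}" using e by (intro image_cong) auto
  have flat: "flat_of n (replicate n Cont) = rim n ` {..<n}"
    using prv_less by (auto simp: flat_of_def)
  have forest: "forest ?I" unfolding I by (rule forest_mono[OF f(1)]) auto
  have span: "spanned ?I a" if "a \<in> rim n ` {..<n}" for a
  proof -
    obtain i where i: "a = rim n i" "i < n" using \<open>a \<in> rim n ` {..<n}\<close> by blast
    have "conn ?I (Suc i) (Suc (prv n i))"
    proof (cases "i = 0")
      case True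
      have "conn ?I (Suc 0) (Suc (prv n 0))" by (rule conn_broken_rim) (use n in auto)
      then show ?thesis using True by simp
    next
      case False
      then have "rim n i \<in> ?I" using i(2) by simp
      then show ?thesis by (intro conn_edge) (simp add: rim_def)
    qed
    then show ?thesis using i by (simp add: rim_def spanned_doubleton)
  qed
  have "rank_in M (rim n ` {..<n}) = card ?I"
    by (rule rank_in_eqI[OF _ _ forest span]) (auto simp: edges_wheel)
  also have "\<dots> = card {1..<n}" unfolding I by (rule card_image) (rule inj_on_subset[OF f(2)], auto)
  finally show ?thesis by (simp add: flat)
qed

end

section \<open>The generating functions\<close>

definition tt :: "int poly" where "tt = [:0, 1:]"

abbreviation TT :: "int poly fps" where "TT \<equiv> fps_const tt"

abbreviation uu :: "int poly fps" where "uu \<equiv> fps_X"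

lemma degree_tt: "degree tt = 1"
  by (simp add: tt_def)

lemma palindromic_tt: "palindromic 2 tt"
  by (simp add: palindromic_def t_rev_def tt_def reflect_poly_pCons' monom_altdef)

lemma palindromic_1_tt: "palindromic 1 (1 + tt)"
  by (simp add: palindromic_def t_rev_def tt_def reflect_poly_def one_pCons)

text \<open>The coefficients of the solution of M = 1 + u M + t u^2 M^2; \<open>t\<close> marks the
  up steps of Motzkin paths.\<close>

fun motzkin :: "nat \<Rightarrow> int poly" where
  "motzkin 0 = 1"
| "motzkin (Suc 0) = 1"
| "motzkin (Suc (Suc m)) = motzkin (Suc m) + tt * (\<Sum>i\<le>m. motzkin i * motzkin (m - i))"

text \<open>The candidate for the fan whose path has \<open>k\<close> vertices; \<open>k = 0\<close>
  is the empty run, for instance between two adjacent letters \<open>Hub\<close>.\<close>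

definition fan :: "nat \<Rightarrow> int poly" where
  "fan k = (if k = 0 then 1 else motzkin (k - 1))"

lemma fan_0 [simp]: "fan 0 = 1" and fan_Suc: "fan (Suc k) = motzkin k"
  by (simp_all add: fan_def)

definition motzkin_fps :: "int poly fps" where
  "motzkin_fps = Abs_fps motzkin"

lemma motzkin_fps_eq: "motzkin_fps = 1 + uu * motzkin_fps + TT * uu\<^sup>2 * motzkin_fps\<^sup>2"
proof (rule fps_ext)
  fix k
  have e: "TT * uu\<^sup>2 * motzkin_fps\<^sup>2 = uu * (uu * (TT * (motzkin_fps * motzkin_fps)))"
    by (simp add: power2_eq_square algebra_simps)
  have sq: "fps_nth (motzkin_fps * motzkin_fps) m = (\<Sum>i\<le>m. motzkin i * motzkin (m - i))" for m
    by (simp add: motzkin_fps_def fps_mult_nth atLeast0AtMost)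
  have "fps_nth motzkin_fps k = motzkin k" for k by (simp add: motzkin_fps_def)
  then show "fps_nth motzkin_fps k = fps_nth (1 + uu * motzkin_fps + TT * uu\<^sup>2 * motzkin_fps\<^sup>2) k"
    unfolding e by (cases k rule: motzkin.cases) (simp_all add: sq)
qed

lemma degree_motzkin: "2 * degree (motzkin k) \<le> k"
proof (induction k rule: motzkin.induct)
  case (3 m)
  have "degree (\<Sum>i\<le>m. motzkin i * motzkin (m - i)) \<le> m div 2"
  proof (rule degree_sum_le)
    fix i assume "i \<in> {..m}"
    then show "degree (motzkin i * motzkin (m - i)) \<le> m div 2"
      using degree_mult_le[of "motzkin i" "motzkin (m - i)"] 3(2)[of i] 3(3)[of i] by auto
  qed simp
  then have "degree (tt * (\<Sum>i\<le>m. motzkin i * motzkin (m - i))) \<le> Suc (m div 2)"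
    using degree_mult_le[of tt "\<Sum>i\<le>m. motzkin i * motzkin (m - i)"] by (simp add: degree_tt)
  moreover have "degree (motzkin (Suc m)) \<le> Suc (m div 2)" using 3(1) by auto
  ultimately have "degree (motzkin (Suc (Suc m))) \<le> Suc (m div 2)"
    by (simp only: motzkin.simps degree_add_le)
  then show ?case by linarith
qed simp_all

lemma degree_fan: "k > 0 \<Longrightarrow> 2 * degree (fan k) < k"
  using degree_motzkin[of "k - 1"] by (simp add: fan_def)

subsection \<open>Series with slowly growing degrees\<close>

definition slow :: "int poly fps \<Rightarrow> bool" where
  "slow a \<longleftrightarrow> (\<forall>k. 2 * degree (fps_nth a k) \<le> k)"

lemma slow_add: "slow a \<Longrightarrow> slow b \<Longrightarrow> slow (a + b)"
  unfolding slow_def fps_add_nth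
  by (metis (no_types, opaque_lifting) degree_add_le_max max_def mult_le_mono2 order_trans)

lemma slow_minus: "slow a \<Longrightarrow> slow (- a)"
  by (simp add: slow_def)

lemma slow_diff: "slow a \<Longrightarrow> slow b \<Longrightarrow> slow (a - b)"
  using slow_add[of a "- b"] slow_minus by simp

lemma slow_convolution:
  assumes "\<And>i. i \<in> I \<Longrightarrow> i \<le> k \<and> 2 * degree (f i) \<le> i \<and> 2 * degree (g (k - i)) \<le> k - i" "finite I"
  shows "2 * degree (\<Sum>i\<in>I. f i * g (k - i)) \<le> k"
proof -
  have "degree (\<Sum>i\<in>I. f i * g (k - i)) \<le> k div 2"
  proof (rule degree_sum_le[OF assms(2)])
    fix i assume "i \<in> I"
    then show "degree (f i * g (k - i)) \<le> k div 2"
      using degree_mult_le[of "f i" "g (k - i)"] assms(1)[of i] by linarith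
  qed
  then show ?thesis by simp
qed

lemma slow_mult:
  assumes "slow a" "slow b"
  shows "slow (a * b)"
  unfolding slow_def fps_mult_nth
  using assms by (intro allI slow_convolution) (auto simp: slow_def)

lemma slow_1: "slow 1"
  by (simp add: slow_def)

lemma slow_X: "slow fps_X"
  by (simp add: slow_def)

lemma slow_numeral: "slow (numeral k)"
  by (simp add: slow_def fps_numeral_nth)

lemma slow_TX2: "slow (TT * uu\<^sup>2)"
  by (simp add: slow_def fps_X_power_nth degree_tt)

lemma slow_motzkin: "slow motzkin_fps"
  by (simp add: slow_def motzkin_fps_def degree_motzkin)

text \<open>Since 1 - a has no constant term, b = 1 + (1 - a) b determines the coefficients of b
  recursively.\<close>

lemma slow_inverse:
  assumes a: "slow a" "fps_nth a 0 = 1" and ab: "a * b = 1"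
  shows "slow b"
proof -
  have eq: "b = 1 + (1 - a) * b" using ab by (simp add: algebra_simps)
  have "2 * degree (fps_nth b k) \<le> k" for k
  proof (induction k rule: less_induct)
    case (less k)
    have s: "slow (1 - a)" using a slow_1 slow_diff by blast
    have "fps_nth ((1 - a) * b) k = (\<Sum>i=0..k. fps_nth (1 - a) i * fps_nth b (k - i))"
      by (rule fps_mult_nth)
    also have "\<dots> = (\<Sum>i\<in>{1..k}. fps_nth (1 - a) i * fps_nth b (k - i))"
      using a(2) by (intro sum.mono_neutral_right) (auto simp: not_less_eq_eq)
    also have "2 * degree \<dots> \<le> k"
    proof (rule slow_convolution)
      fix i assume i: "i \<in> {1..k}"
      then have "k - i < k" by auto
      then show "i \<le> k \<and> 2 * degree (fps_nth (1 - a) i) \<le> i \<and> 2 * degree (fps_nth b (k - i)) \<le> k - i"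
        using s[unfolded slow_def] less.IH i by (meson atLeastAtMost_iff)
    qed simp
    finally have "2 * degree (fps_nth ((1 - a) * b) k) \<le> k" .
    moreover have "fps_nth b k = fps_nth 1 k + fps_nth ((1 - a) * b) k"
      by (subst eq) (simp only: fps_add_nth)
    moreover have "degree (fps_nth (1 :: int poly fps) k) = 0" by simp
    ultimately show ?case
      using degree_add_le_max[of "fps_nth (1 :: int poly fps) k" "fps_nth ((1 - a) * b) k"] by simp
  qed
  then show ?thesis by (simp add: slow_def)
qed

subsection \<open>Series with palindromic coefficients\<close>

text \<open>Palindromicity degrees add under multiplication just like exponents of
  \<open>uu\<close>, so the property is closed under products of series.\<close>

definition pal_fps :: "int poly fps \<Rightarrow> bool" where
  "pal_fps a \<longleftrightarrow> (\<forall>k. palindromic k (fps_nth a k))"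

lemma palindromic_convolution:
  assumes "\<And>i. i \<in> I \<Longrightarrow> i \<le> k \<and> palindromic i (f i) \<and> palindromic (k - i) (g (k - i))"
  shows "palindromic k (\<Sum>i\<in>I. f i * g (k - i))"
proof (rule palindromic_sum)
  fix i assume "i \<in> I"
  then show "palindromic k (f i * g (k - i))"
    using palindromic_mult[of i "f i" "k - i" "g (k - i)"] assms[of i] by simp
qed

lemma pal_fps_add: "pal_fps a \<Longrightarrow> pal_fps b \<Longrightarrow> pal_fps (a + b)"
  by (simp add: pal_fps_def palindromic_add)

lemma pal_fps_mult:
  assumes "pal_fps a" "pal_fps b"
  shows "pal_fps (a * b)"
  unfolding pal_fps_def fps_mult_nth
  using assms by (intro allI palindromic_convolution) (auto simp: pal_fps_def)

lemma pal_fps_1: "pal_fps 1"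
  using palindromic_1 by (simp add: pal_fps_def)

lemma pal_fps_X: "pal_fps ((1 + TT) * uu)"
  unfolding pal_fps_def
proof
  fix k
  show "palindromic k (fps_nth ((1 + TT) * uu) k)"
    using palindromic_1_tt by (cases "k = 0"; cases "k = 1") auto
qed

lemma pal_fps_TX2: "pal_fps (TT * uu\<^sup>2)"
  using palindromic_tt by (auto simp: pal_fps_def fps_X_power_nth)

text \<open>\<open>q\<close> may depend on \<open>z\<close> itself: only the coefficients of
  \<open>z\<close> below \<open>k\<close> are available when those of \<open>q\<close> up to
  \<open>k\<close> are checked. This covers the quadratic equation of \<open>fan_Z\<close>.\<close>

lemma pal_fps_recursive:
  assumes eq: "z = p + q * z" and p: "pal_fps p" and q0: "fps_nth q 0 = 0"
    and q: "\<And>k i. (\<And>j. j < k \<Longrightarrow> palindromic j (fps_nth z j)) \<Longrightarrow> i \<le> k \<Longrightarrow> palindromic i (fps_nth q i)"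
  shows "pal_fps z"
proof -
  have "palindromic k (fps_nth z k)" for k
  proof (induction k rule: less_induct)
    case (less k)
    have "fps_nth (q * z) k = (\<Sum>i=0..k. fps_nth q i * fps_nth z (k - i))" by (rule fps_mult_nth)
    also have "\<dots> = (\<Sum>i\<in>{1..k}. fps_nth q i * fps_nth z (k - i))"
      using q0 by (intro sum.mono_neutral_right) (auto simp: not_less_eq_eq)
    also have "palindromic k \<dots>"
      using q[OF less] less by (intro palindromic_convolution) auto
    finally have "palindromic k (fps_nth p k + fps_nth (q * z) k)"
      using p by (simp add: pal_fps_def palindromic_add)
    then show ?case by (subst eq) simp
  qed
  then show ?thesis by (simp add: pal_fps_def)
qed

subsection \<open>Sums over words without hubs\<close>

text \<open>Above a flat described by \<open>k\<close> letters \<open>Start\<close>, these are the sums over the words without \<open>Hub\<close>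
  (\<open>cut_sum\<close>), over the words with a hub on both sides (\<open>fan_sum\<close>), and over the words with at least
  one \<open>Hub\<close> whose first run wraps around (\<open>wrap_sum\<close>). The indices \<open>j\<close>, \<open>i\<close> count the components
  already met in the current and in the first run, and \<open>c\<close>, \<open>e\<close> are the weights of the last run.\<close>

fun cut_sum :: "(nat \<Rightarrow> int poly) \<Rightarrow> nat \<Rightarrow> nat \<Rightarrow> int poly" where
  "cut_sum c j 0 = c j"
| "cut_sum c j (Suc k) = cut_sum c (Suc j) k + tt * cut_sum c j k"

fun fan_sum :: "(nat \<Rightarrow> int poly) \<Rightarrow> nat \<Rightarrow> nat \<Rightarrow> int poly" where
  "fan_sum e j 0 = e j"
| "fan_sum e j (Suc k) = tt * fan j * fan_sum e 0 k + fan_sum e (Suc j) k + (if j = 0 then 0 else tt * fan_sum e j k)"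

fun wrap_sum :: "(nat \<Rightarrow> nat \<Rightarrow> int poly) \<Rightarrow> nat \<Rightarrow> nat \<Rightarrow> int poly" where
  "wrap_sum e i 0 = 0"
| "wrap_sum e i (Suc k) = tt * fan_sum (e i) 0 k + wrap_sum e (Suc i) k + tt * wrap_sum e i k"

text \<open>\<open>vv\<close> is $u / (1 - t u)$.\<close>

definition VV :: "int poly fps" where "VV = Abs_fps (\<lambda>k. tt ^ k)"

definition vv :: "int poly fps" where "vv = uu * VV"

lemma VV_eq: "VV = 1 + TT * uu * VV"
proof (rule fps_ext)
  fix k
  show "fps_nth VV k = fps_nth (1 + TT * uu * VV) k"
    by (cases k) (simp_all add: VV_def mult.assoc)
qed

lemma vv_mult: "vv * x = uu * (VV * x)"
  by (simp add: vv_def mult.assoc)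

lemma vv_0 [simp]: "fps_nth vv 0 = 0"
  by (simp add: vv_def)

lemmas vv_compose_mult = fps_compose_mult_distrib[OF vv_0]

definition shift :: "(nat \<Rightarrow> int poly) \<Rightarrow> nat \<Rightarrow> int poly fps" where
  "shift c j = Abs_fps (\<lambda>i. c (i + j))"

lemma shift_Suc: "shift c j = fps_const (c j) + uu * shift c (Suc j)"
proof (rule fps_ext)
  fix k
  show "fps_nth (shift c j) k = fps_nth (fps_const (c j) + uu * shift c (Suc j)) k"
    by (cases k) (simp_all add: shift_def)
qed

lemma shift_compose_Suc:
  "shift c j oo vv = fps_const (c j) + vv * (shift c (Suc j) oo vv)"
  by (subst shift_Suc) (simp add: fps_compose_add_distrib vv_compose_mult)

text \<open>A binomial transform: \<open>cut_sum c j k\<close> is the sum of binomial(k, i) t^(k-i)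
  c(i + j). The proof avoids binomials and checks that the right-hand side satisfies the recursion
  of \<open>cut_sum\<close>.\<close>

lemma cut_sum_fps: "Abs_fps (cut_sum c j) = VV * (shift c j oo vv)"
proof (rule fps_ext)
  let ?G = "\<lambda>j. VV * (shift c j oo vv)"
  have rec: "?G j = fps_const (c j) + uu * (?G (Suc j) + TT * ?G j)" for j
  proof -
    have "?G j = (shift c j oo vv) + TT * uu * ?G j"
      by (subst (1) VV_eq) (simp add: algebra_simps)
    moreover have "fps_const (c j) + uu * (?G (Suc j) + TT * ?G j) = (shift c j oo vv) + TT * uu * ?G j"
      using shift_compose_Suc[of c j] by (simp only: vv_mult ring_distribs ac_simps)
    ultimately show ?thesis by simp
  qed
  fix k
  have "fps_nth (?G j) k = cut_sum c j k"
  proof (induction k arbitrary: j)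
    case 0
    show ?case by (subst rec) simp
  next
    case (Suc k)
    have "fps_nth (?G j) (Suc k) = fps_nth (?G (Suc j)) k + tt * fps_nth (?G j) k"
      by (subst rec) simp
    then show ?case using Suc by simp
  qed
  then show "fps_nth (Abs_fps (cut_sum c j)) k = fps_nth (?G j) k" by simp
qed

lemma cut_sum_cong: "(\<And>i. i \<ge> j \<Longrightarrow> c i = c' (i + d)) \<Longrightarrow> cut_sum c j k = cut_sum c' (j + d) k"
proof (induction k arbitrary: j)
  case (Suc k)
  have "cut_sum c (Suc j) k = cut_sum c' (Suc j + d) k" by (rule Suc.IH) (simp add: Suc.prems)
  moreover have "cut_sum c j k = cut_sum c' (j + d) k" by (rule Suc.IH) (simp add: Suc.prems)
  ultimately show ?case by simp
qed simp

section \<open>The series R and the sums for fans\<close>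

definition mm :: "int poly fps" where "mm = motzkin_fps oo vv"

text \<open>The series of Narayana polynomials, by the equation \<open>RR_eq\<close>.\<close>

definition RR :: "int poly fps" where "RR = vv * mm"

lemma shift_fan_1: "shift fan (Suc 0) = motzkin_fps"
  by (simp add: shift_def motzkin_fps_def fan_Suc)

lemma mm_eq: "mm = 1 + RR + TT * RR\<^sup>2"
proof -
  have "mm = (1 + uu * motzkin_fps + TT * uu\<^sup>2 * motzkin_fps\<^sup>2) oo vv"
    unfolding mm_def by (subst motzkin_fps_eq) simp
  also have "\<dots> = 1 + vv * mm + TT * vv\<^sup>2 * mm\<^sup>2"
    by (simp add: fps_compose_add_distrib vv_compose_mult power2_eq_square mm_def)
  finally show ?thesis by (simp add: RR_def power2_eq_square algebra_simps)
qed

lemma RR_eq: "RR = uu * (1 + RR) * (1 + TT * RR)"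
proof -
  have v: "vv = uu + TT * uu * vv"
    unfolding vv_def by (subst VV_eq) (simp add: algebra_simps)
  have "RR = vv * mm" by (rule RR_def)
  also have "\<dots> = uu * mm + TT * uu * (vv * mm)" by (subst v) (simp add: algebra_simps)
  also have "\<dots> = uu * mm + TT * uu * RR" by (simp add: RR_def)
  also have "\<dots> = uu * (1 + RR) * (1 + TT * RR)"
    by (subst mm_eq) (simp add: power2_eq_square algebra_simps)
  finally show ?thesis .
qed

text \<open>Splitting by the first \<open>Hub\<close> gives a linear equation with the factor 1 - t
  u (1 + R), which by \<open>RR_eq\<close> is inverse to 1 + t R.\<close>

lemma fan_sum_fps:
  "Abs_fps (fan_sum e 0) = (1 + TT * RR) * (fps_const (e 0) + uu * Abs_fps (cut_sum e (Suc 0)))"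
proof -
  let ?A = "Abs_fps (fan_sum e 0)"
  \<comment> \<open>For a run that already has \<open>j\<close> components: the first summand
    collects the words in which a later \<open>Hub\<close> closes it, the second those in which it
    lasts to the end. For \<open>j > 0\<close>, where \<open>Cont\<close> is allowed, this solves
    the recursion of \<open>fan_sum\<close>.\<close>
  let ?X = "\<lambda>j. TT * uu * ?A * Abs_fps (cut_sum fan j) + Abs_fps (cut_sum e j)"
  have K: "Abs_fps (cut_sum c j) = fps_const (c j) + uu * (Abs_fps (cut_sum c (Suc j)) + TT * Abs_fps (cut_sum c j))" for c j
  proof (rule fps_ext)
    fix k
    show "fps_nth (Abs_fps (cut_sum c j)) k = fps_nth (fps_const (c j) + uu * (Abs_fps (cut_sum c (Suc j)) + TT * Abs_fps (cut_sum c j))) k"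
      by (cases k) simp_all
  qed
  have rec: "?X j = fps_const (e j) + uu * (TT * fps_const (fan j) * ?A + ?X (Suc j) + TT * ?X j)" for j
    by (subst (1 2) K) (simp add: algebra_simps)
  have "fps_nth (?X (Suc j)) k = fan_sum e (Suc j) k" for j k
  proof (induction k arbitrary: j)
    case 0
    show ?case by (subst rec) simp
  next
    case (Suc k)
    have "fps_nth (?X (Suc j)) (Suc k)
      = tt * fan (Suc j) * fan_sum e 0 k + fps_nth (?X (Suc (Suc j))) k + tt * fps_nth (?X (Suc j)) k"
      by (subst rec) (simp add: mult.assoc)
    then show ?case by (simp only: Suc.IH fan_sum.simps) simp
  qed
  then have X: "Abs_fps (fan_sum e (Suc 0)) = ?X (Suc 0)" by (intro fps_ext) simp
  have "?A = fps_const (e 0) + uu * (TT * ?A + Abs_fps (fan_sum e (Suc 0)))"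
  proof (rule fps_ext)
    fix k
    show "fps_nth ?A k = fps_nth (fps_const (e 0) + uu * (TT * ?A + Abs_fps (fan_sum e (Suc 0)))) k"
      by (cases k) simp_all
  qed
  also have "\<dots> = fps_const (e 0) + uu * Abs_fps (cut_sum e (Suc 0))
     + TT * uu * ?A * (1 + uu * Abs_fps (cut_sum fan (Suc 0)))"
    unfolding X by (simp add: algebra_simps)
  also have "uu * Abs_fps (cut_sum fan (Suc 0)) = RR"
    by (simp add: cut_sum_fps shift_fan_1 RR_def vv_def mm_def mult.assoc)
  finally have A: "?A = (fps_const (e 0) + uu * Abs_fps (cut_sum e (Suc 0))) + TT * uu * ?A * (1 + RR)"
    (is "_ = ?E + _") .
  have "?A * (1 + TT * RR) = ?E * (1 + TT * RR) + TT * ?A * (uu * (1 + RR) * (1 + TT * RR))"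
    by (subst A) (simp add: algebra_simps)
  also have "uu * (1 + RR) * (1 + TT * RR) = RR" by (rule RR_eq[symmetric])
  finally show ?thesis by (simp add: algebra_simps)
qed

definition fan_Z :: "int poly fps" where "fan_Z = Abs_fps (fan_sum fan 0)"

lemma fan_Z_eq: "fan_Z = (1 + RR) * (1 + TT * RR)"
  unfolding fan_Z_def fan_sum_fps
  by (simp add: cut_sum_fps shift_fan_1 RR_def vv_def mm_def mult_ac)

lemma RR_fan_Z: "RR = uu * fan_Z"
  unfolding fan_Z_eq using RR_eq by (simp add: mult.assoc)

text \<open>With R = u A the product formula reads A = 1 + ((1 + t) u + t u^2 A) A, and its
  ingredients (1 + t) u and t u^2 are palindromic.\<close>

lemma pal_fps_fan_Z: "pal_fps fan_Z"
proof (rule pal_fps_recursive)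
  let ?q = "(1 + TT) * uu + uu * (uu * (TT * fan_Z))"
  have "fan_Z = (1 + uu * fan_Z) * (1 + TT * (uu * fan_Z))" using fan_Z_eq RR_fan_Z by simp
  then show "fan_Z = 1 + ?q * fan_Z" by (simp add: algebra_simps)
  show "pal_fps 1" by (rule pal_fps_1)
  show "fps_nth ?q 0 = 0" by simp
  fix k i assume IH: "\<And>j. j < k \<Longrightarrow> palindromic j (fps_nth fan_Z j)" and i: "i \<le> k"
  have "palindromic i (fps_nth (uu * (uu * (TT * fan_Z))) i)"
  proof (cases "i < 2")
    case True
    then have "i = 0 \<or> i = Suc 0" by auto
    then show ?thesis by auto
  next
    case False
    then have "i = Suc (Suc (i - 2))" by simp
    then obtain l where l: "i = Suc (Suc l)" by blast
    then have "fps_nth (uu * (uu * (TT * fan_Z))) i = tt * fps_nth fan_Z l" by simp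
    then show ?thesis using palindromic_mult[OF palindromic_tt IH[of l]] i l by simp
  qed
  then show "palindromic i (fps_nth ?q i)"
    using pal_fps_X unfolding pal_fps_def fps_add_nth by (blast intro: palindromic_add)
qed

lemma palindromic_fan_sum: "palindromic k (fan_sum fan 0 k)"
  using pal_fps_fan_Z by (simp add: pal_fps_def fan_Z_def)

subsection \<open>Sums over cyclic words\<close>

text \<open>The last run of a cyclic word, with \<open>j\<close> components, is completed by the first run, with \<open>i\<close>
  components. If the word begins with \<open>Cont\<close>, it must not end with \<open>Hub\<close>, that is, \<open>j = 0\<close> is
  impossible.\<close>

definition end_start :: "nat \<Rightarrow> nat \<Rightarrow> int poly" where
  "end_start i j = fan (i + j)"

definition end_cont :: "nat \<Rightarrow> nat \<Rightarrow> int poly" where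
  "end_cont i j = (if j = 0 then 0 else fan (i + j))"

text \<open>The coefficient at u^k is (k + 1) fan(i + k): the cut can distribute the
  \<open>k\<close> further components of a merged run in k + 1 ways over the beginning and the end
  of the word.\<close>

definition deriv_shift :: "nat \<Rightarrow> int poly fps" where
  "deriv_shift i = fps_deriv (uu * shift fan i)"

lemma deriv_shift_Suc: "deriv_shift i = shift fan i + uu * deriv_shift (Suc i)"
proof -
  have "uu * shift fan i = uu * fps_const (fan i) + uu * (uu * shift fan (Suc i))"
    by (subst shift_Suc) (simp add: distrib_left)
  then have "deriv_shift i = fps_deriv (uu * fps_const (fan i) + uu * (uu * shift fan (Suc i)))"
    by (simp add: deriv_shift_def)
  also have "\<dots> = fps_const (fan i) + (uu * shift fan (Suc i) + uu * deriv_shift (Suc i))"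
    by (simp add: deriv_shift_def)
  also have "\<dots> = shift fan i + uu * deriv_shift (Suc i)"
    by (subst (2) shift_Suc) (simp add: add.assoc)
  finally show ?thesis .
qed

lemma deriv_shift_compose: "deriv_shift i oo vv = (shift fan i oo vv) + vv * (deriv_shift (Suc i) oo vv)"
  by (subst deriv_shift_Suc) (simp add: fps_compose_add_distrib vv_compose_mult)

text \<open>Any solution of the recursion of \<open>wrap_sum\<close> on the level of generating functions is the generating
  function of \<open>wrap_sum\<close>.\<close>

lemma wrap_sum_fps_eqI:
  assumes "\<And>i. X i = uu * (TT * Abs_fps (fan_sum (e i) 0) + X (Suc i) + TT * X i)"
  shows "Abs_fps (wrap_sum e i) = X i"
proof (rule fps_ext)
  fix k
  have "fps_nth (X i) k = wrap_sum e i k"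
  proof (induction k arbitrary: i)
    case 0
    show ?case by (subst assms) simp
  next
    case (Suc k)
    show ?case by (subst assms) (simp add: Suc.IH)
  qed
  then show "fps_nth (Abs_fps (wrap_sum e i)) k = fps_nth (X i) k" by simp
qed

lemma wrap_sum_solution:
  assumes A: "\<And>i. Abs_fps (fan_sum (e i) 0) = (1 + TT * RR) * Y i"
    and rec: "\<And>i. Z i = Y i + vv * Z (Suc i)"
  shows "Abs_fps (wrap_sum e i) = TT * uu * (1 + TT * RR) * VV * Z i"
proof (rule wrap_sum_fps_eqI)
  fix i
  let ?c = "TT * uu * (1 + TT * RR)"
  have "?c * VV * Z i = ?c * Z i + TT * uu * (?c * VV * Z i)"
    by (subst (1) VV_eq) (simp add: algebra_simps)
  also have "?c * Z i = ?c * Y i + uu * (?c * VV * Z (Suc i))"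
    by (subst rec) (simp add: vv_mult algebra_simps)
  finally have "?c * VV * Z i = ?c * Y i + uu * (?c * VV * Z (Suc i)) + TT * uu * (?c * VV * Z i)" .
  also have "\<dots> = uu * (TT * Abs_fps (fan_sum (e i) 0) + ?c * VV * Z (Suc i) + TT * (?c * VV * Z i))"
    unfolding A by (simp only: ring_distribs ac_simps)
  finally show "?c * VV * Z i = uu * (TT * Abs_fps (fan_sum (e i) 0) + ?c * VV * Z (Suc i) + TT * (?c * VV * Z i))" .
qed

lemma fan_sum_end_start: "Abs_fps (fan_sum (end_start i) 0) = (1 + TT * RR) * (shift fan i oo vv)"
proof -
  have "cut_sum (end_start i) (Suc 0) k = cut_sum fan (Suc 0 + i) k" for k
    by (rule cut_sum_cong) (simp add: end_start_def add.commute)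
  then have "Abs_fps (cut_sum (end_start i) (Suc 0)) = Abs_fps (cut_sum fan (Suc i))" by (intro fps_ext) simp
  then have "uu * Abs_fps (cut_sum (end_start i) (Suc 0)) = vv * (shift fan (Suc i) oo vv)"
    by (simp add: vv_mult cut_sum_fps)
  then show ?thesis unfolding fan_sum_fps by (simp add: end_start_def shift_compose_Suc[of fan i])
qed

lemma fan_sum_end_cont: "Abs_fps (fan_sum (end_cont i) 0) = (1 + TT * RR) * (vv * (shift fan (Suc i) oo vv))"
proof -
  have "cut_sum (end_cont i) (Suc 0) k = cut_sum fan (Suc 0 + i) k" for k
    by (rule cut_sum_cong) (simp add: end_cont_def add.commute)
  then have "Abs_fps (cut_sum (end_cont i) (Suc 0)) = Abs_fps (cut_sum fan (Suc i))" by (intro fps_ext) simp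
  then have "uu * Abs_fps (cut_sum (end_cont i) (Suc 0)) = vv * (shift fan (Suc i) oo vv)"
    by (simp add: vv_mult cut_sum_fps)
  then show ?thesis unfolding fan_sum_fps by (simp add: end_cont_def)
qed

lemma wrap_sum_end_start: "Abs_fps (wrap_sum end_start i) = TT * uu * (1 + TT * RR) * VV * (deriv_shift i oo vv)"
  by (rule wrap_sum_solution[where Z = "\<lambda>i. deriv_shift i oo vv", OF fan_sum_end_start deriv_shift_compose])

lemma wrap_sum_end_cont: "Abs_fps (wrap_sum end_cont i) = TT * uu * (1 + TT * RR) * VV * (vv * (deriv_shift (Suc i) oo vv))"
proof (rule wrap_sum_solution[where Z = "\<lambda>i. vv * (deriv_shift (Suc i) oo vv)", OF fan_sum_end_cont])
  show "vv * (deriv_shift (Suc i) oo vv) = vv * (shift fan (Suc i) oo vv) + vv * (vv * (deriv_shift (Suc (Suc i)) oo vv))" for i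
    by (subst deriv_shift_compose) (simp add: distrib_left)
qed

text \<open>The word is cut at a \<open>Start\<close> of the lower flat; the summands belong to its
  becoming \<open>Hub\<close>, \<open>Start\<close> or \<open>Cont\<close>.\<close>

definition hub_Z :: "int poly fps" where
  "hub_Z = uu * (TT * fan_Z + Abs_fps (wrap_sum end_start 1) + TT * Abs_fps (wrap_sum end_cont 0))"

lemma vv_mm: "vv * mm = RR"
  by (simp add: RR_def)

text \<open>Differentiating phi = u (1 + phi + t phi^2) implicitly and substituting
  \<open>vv\<close> yields v^2 d (1 - t R^2) = R^2. The denominator is kept multiplied out.\<close>

lemma hub_Z_eq: "hub_Z * (1 - TT * RR\<^sup>2) = TT * RR * (1 + RR)"
proof -
  define d where "d = deriv_shift 1 oo vv"
  define phi where "phi = uu * motzkin_fps"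
  have phi: "phi = uu * (1 + phi + TT * phi\<^sup>2)"
    using motzkin_fps_eq unfolding phi_def by (simp add: power2_eq_square algebra_simps)
  have D: "deriv_shift 1 = fps_deriv phi" by (simp add: deriv_shift_def phi_def shift_fan_1)
  have "deriv_shift 1 = 1 + phi + TT * phi\<^sup>2 + uu * (deriv_shift 1 + 2 * TT * phi * deriv_shift 1)"
    unfolding D by (subst phi) (simp add: power2_eq_square algebra_simps)
  then have "d = (1 + phi + TT * phi\<^sup>2 + uu * (deriv_shift 1 + 2 * TT * phi * deriv_shift 1)) oo vv"
    unfolding d_def by simp
  also have "phi oo vv = RR" by (simp add: phi_def vv_compose_mult RR_def mm_def)
  then have "(1 + phi + TT * phi\<^sup>2 + uu * (deriv_shift 1 + 2 * TT * phi * deriv_shift 1)) oo vv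
    = 1 + RR + TT * RR\<^sup>2 + vv * (d + 2 * TT * RR * d)"
    by (simp add: fps_compose_add_distrib vv_compose_mult power2_eq_square d_def)
  finally have d: "d = mm + vv * (d + 2 * TT * RR * d)" by (simp add: mm_eq)
  have vd: "vv\<^sup>2 * d * (1 - TT * RR\<^sup>2) = RR\<^sup>2"
  proof -
    have "mm * d = mm * mm + RR * (d + 2 * TT * RR * d)"
    proof -
      have "mm * d = mm * mm + mm * (vv * (d + 2 * TT * RR * d))"
        by (subst (1) d) (simp only: distrib_left)
      also have "mm * (vv * (d + 2 * TT * RR * d)) = RR * (d + 2 * TT * RR * d)"
        unfolding RR_def by (simp only: mult_ac)
      finally show ?thesis .
    qed
    then have "mm * mm = (mm - RR - 2 * TT * RR\<^sup>2) * d" by (simp add: power2_eq_square algebra_simps)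
    also have "mm - RR - 2 * TT * RR\<^sup>2 = 1 - TT * RR\<^sup>2" by (simp add: mm_eq)
    finally have "mm * mm = (1 - TT * RR\<^sup>2) * d" .
    moreover have "(vv * mm) * (vv * mm) = vv\<^sup>2 * (mm * mm)"
      by (simp only: power2_eq_square mult_ac)
    ultimately have "(vv * mm) * (vv * mm) = vv\<^sup>2 * ((1 - TT * RR\<^sup>2) * d)" by simp
    then show ?thesis unfolding vv_mm by (simp add: power2_eq_square mult_ac)
  qed
  \<comment> \<open>The \<open>Start\<close> and \<open>Cont\<close> contributions differ by the
    factor \<open>TT * vv\<close>, so together they supply a second factor
    \<open>VV\<close>.\<close>
  have V: "VV = 1 + TT * vv" using VV_eq by (simp add: vv_def mult.assoc)
  have "hub_Z = TT * RR + TT * (1 + TT * RR) * d * (uu * VV) * (uu * (1 + TT * vv))"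
    unfolding hub_Z_def wrap_sum_end_start wrap_sum_end_cont RR_fan_Z d_def by (simp add: algebra_simps)
  also have "\<dots> = TT * RR + TT * (1 + TT * RR) * (vv\<^sup>2 * d)"
    unfolding V[symmetric] vv_def[symmetric] by (simp add: power2_eq_square mult_ac)
  finally have hub_Z: "hub_Z = TT * RR + TT * (1 + TT * RR) * (vv\<^sup>2 * d)" .
  have "hub_Z * (1 - TT * RR\<^sup>2) = TT * RR * (1 - TT * RR\<^sup>2) + TT * (1 + TT * RR) * (vv\<^sup>2 * d * (1 - TT * RR\<^sup>2))"
    unfolding hub_Z by (simp only: distrib_right mult.assoc mult_1_left)
  also have "\<dots> = TT * RR * (1 + RR)" unfolding vd by (simp add: power2_eq_square algebra_simps)
  finally show ?thesis .
qed

subsection \<open>The wheel polynomials\<close>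

definition recip :: "int poly fps \<Rightarrow> int poly fps" where
  "recip a = fps_right_inverse a 1"

lemma recip: "fps_nth a 0 = 1 \<Longrightarrow> a * recip a = 1"
  unfolding recip_def by (rule fps_right_inverse) simp

text \<open>The closed form written in terms of the Motzkin series: the factor \<open>uu\<close> in front of a series
  whose coefficients grow slowly in degree makes the degree bound visible.\<close>

definition wheel_fps :: "int poly fps" where
  "wheel_fps = uu * (motzkin_fps * recip (1 + uu) *
     (2 * recip (1 - TT * uu\<^sup>2 * motzkin_fps\<^sup>2)
      - (1 + motzkin_fps * (1 - uu\<^sup>2)) * recip (1 + uu * motzkin_fps)))"

lemma motzkin_fps_0: "fps_nth motzkin_fps 0 = 1"
  by (simp add: motzkin_fps_def)

lemma recip_wheel_fps:
  "(1 + uu) * recip (1 + uu) = 1"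
  "(1 - TT * uu\<^sup>2 * motzkin_fps\<^sup>2) * recip (1 - TT * uu\<^sup>2 * motzkin_fps\<^sup>2) = 1"
  "(1 + uu * motzkin_fps) * recip (1 + uu * motzkin_fps) = 1"
  by (rule recip; simp add: fps_X_power_nth mult.assoc power2_eq_square)+

lemma wheel_fps_eq:
  "(1 + uu) * (1 - TT * uu\<^sup>2 * motzkin_fps\<^sup>2) * (1 + uu * motzkin_fps) * wheel_fps =
    uu * motzkin_fps * (2 * (1 + uu * motzkin_fps) - (1 + motzkin_fps * (1 - uu\<^sup>2)) * (1 - TT * uu\<^sup>2 * motzkin_fps\<^sup>2))"
proof -
  have alg: "a * b * c * (x * (m * a' * (2 * b' - n * c'))) = x * m * (2 * c - n * b)"
    if "a * a' = 1" "b * b' = 1" "c * c' = 1" for a b c a' b' c' x m n :: "int poly fps"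
  proof -
    have "a * b * c * (x * (m * a' * (2 * b' - n * c')))
      = (a * a') * (x * m) * (2 * (b * b') * c - n * (c * c') * b)" by (simp add: algebra_simps)
    then show ?thesis by (simp add: that)
  qed
  show ?thesis unfolding wheel_fps_def by (rule alg[OF recip_wheel_fps])
qed

lemma degree_wheel_fps:
  assumes "k > 0"
  shows "2 * degree (fps_nth wheel_fps k) < k"
proof -
  have s2: "slow (TT * uu\<^sup>2 * motzkin_fps\<^sup>2)"
    unfolding power2_eq_square[of motzkin_fps] by (intro slow_mult slow_TX2 slow_motzkin)
  have "slow (recip (1 + uu))"
    by (rule slow_inverse[OF _ _ recip_wheel_fps(1)]) (simp_all add: slow_add slow_1 slow_X)
  moreover have "slow (recip (1 - TT * uu\<^sup>2 * motzkin_fps\<^sup>2))"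
    by (rule slow_inverse[OF slow_diff[OF slow_1 s2] _ recip_wheel_fps(2)])
      (simp add: mult.assoc power2_eq_square)
  moreover have "slow (recip (1 + uu * motzkin_fps))"
    by (rule slow_inverse[OF _ _ recip_wheel_fps(3)]) (simp_all add: slow_add slow_mult slow_1 slow_X slow_motzkin)
  ultimately have "slow (motzkin_fps * recip (1 + uu) *
     (2 * recip (1 - TT * uu\<^sup>2 * motzkin_fps\<^sup>2)
      - (1 + motzkin_fps * (1 - uu\<^sup>2)) * recip (1 + uu * motzkin_fps)))" (is "slow ?x")
    unfolding power2_eq_square[of uu]
    by (intro slow_mult slow_diff slow_add slow_1 slow_X slow_motzkin slow_numeral)
  then have "2 * degree (fps_nth ?x (k - 1)) \<le> k - 1" by (simp add: slow_def)
  moreover have "fps_nth wheel_fps k = fps_nth ?x (k - 1)"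
    unfolding wheel_fps_def using assms by (subst fps_X_mult_nth) simp
  ultimately show ?thesis using assms by simp
qed

lemma wheel_fps_0: "fps_nth wheel_fps 0 = 0"
  by (simp add: wheel_fps_def)

text \<open>Together with \<open>wheel_fps_0\<close> this gives weight 0 to the words without
  \<open>Hub\<close> that have fewer than two letters \<open>Start\<close>, which can therefore be
  left in the sums.\<close>

lemma wheel_fps_1: "fps_nth wheel_fps (Suc 0) = 0"
proof -
  have r: "fps_nth (recip a) 0 = 1" if "fps_nth a 0 = 1" for a
    using arg_cong[OF recip[OF that], of "\<lambda>x. fps_nth x 0"] that by simp
  have "fps_nth (recip (1 - TT * uu\<^sup>2 * motzkin_fps\<^sup>2)) 0 = 1"
    by (rule r) (simp add: mult.assoc power2_eq_square)
  moreover have "fps_nth (recip (1 + uu * motzkin_fps)) 0 = 1" by (rule r) simp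
  moreover have "fps_nth (1 + motzkin_fps * (1 - uu\<^sup>2)) 0 = 2" by (simp add: motzkin_fps_0)
  ultimately show ?thesis unfolding wheel_fps_def fps_X_mult_nth
    by (simp add: fps_numeral_nth)
qed

text \<open>\<open>vv\<close> has the coefficient t^(k-1) at u^k and accounts for the flat
  consisting of the full rim.\<close>

definition wheel_Z :: "int poly fps" where
  "wheel_Z = Abs_fps (cut_sum (fps_nth wheel_fps) 0) + vv + hub_Z"

lemma RR_0: "fps_nth RR 0 = 0" and mm_0: "fps_nth mm 0 = 1"
  unfolding mm_eq by (simp_all add: RR_def power2_eq_square)

lemma wheel_Z_eq: "wheel_Z * (1 - TT * RR\<^sup>2) = RR * (1 + TT + TT * RR + TT\<^sup>2 * RR ^ 3)"
proof -
  define om where "om = wheel_fps oo vv"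
  define q where "q = TT * RR\<^sup>2"
  have m: "mm = 1 + RR + q" unfolding q_def by (rule mm_eq)
  have K: "Abs_fps (cut_sum (fps_nth wheel_fps) 0) = VV * om"
  proof -
    have "shift (fps_nth wheel_fps) 0 = wheel_fps" by (intro fps_ext) (simp add: shift_def)
    then show ?thesis by (simp only: cut_sum_fps om_def)
  qed
  have c: "TT * (vv * vv) * (mm * mm) = q" "uu oo vv = vv" "motzkin_fps oo vv = mm"
    by (simp_all add: power2_eq_square q_def RR_def mm_def mult_ac)
  have om: "(1 + vv) * (1 - q) * (1 + RR) * om = RR * (2 * (1 + RR) - (1 + mm * (1 - vv\<^sup>2)) * (1 - q))"
    using arg_cong[OF wheel_fps_eq, of "\<lambda>x. x oo vv"]
    by (simp add: vv_compose_mult fps_compose_add_distrib fps_compose_sub_distrib c vv_mm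
        om_def[symmetric] power2_eq_square)
  \<comment> \<open>Multiplying by \<open>mm\<close> eliminates \<open>vv\<close> in favour of
    \<open>RR\<close>; the common factor \<open>E\<close> then has constant term 1 and can be
    cancelled.\<close>
  define E where "E = mm + RR"
  have E1: "mm * (1 + vv) = E" using vv_mm by (simp add: E_def algebra_simps)
  have "E * ((1 - q) * (1 + RR) * om) = mm * ((1 + vv) * (1 - q) * (1 + RR) * om)"
    unfolding E1[symmetric] by (simp add: mult_ac)
  also have "\<dots> = RR * (2 * mm * (1 + RR) - (mm + mm * mm - (vv * mm) * (vv * mm)) * (1 - q))"
    unfolding om by (simp add: power2_eq_square algebra_simps)
  also have "\<dots> = RR * (2 * mm * (1 + RR) - (mm + mm * mm - RR * RR) * (1 - q))"
    unfolding vv_mm ..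
  also have "\<dots> = E * (RR * (RR + q + q\<^sup>2))"
    unfolding E_def m by (simp add: power2_eq_square algebra_simps)
  finally have eq: "E * ((1 - q) * (1 + RR) * om) = E * (RR * (RR + q + q\<^sup>2))" .
  have "fps_nth E 0 = 1" by (simp add: E_def mm_0 RR_0)
  then have "E \<noteq> 0" by auto
  then have om2: "(1 - q) * (1 + RR) * om = RR * (RR + q + q\<^sup>2)"
    using eq by (rule iffD1[OF mult_left_cancel])
  have V: "VV = 1 + TT * vv" using VV_eq by (simp add: vv_def mult.assoc)
  have mV: "mm * VV = (1 + RR) * (1 + TT * RR)"
  proof -
    have "mm * VV = mm + TT * (vv * mm)" unfolding V by (simp add: algebra_simps)
    then show ?thesis unfolding vv_mm by (simp add: m q_def power2_eq_square algebra_simps)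
  qed
  have "mm * ((1 - q) * (VV * om + vv)) = (mm * VV) * ((1 - q) * om) + (1 - q) * (vv * mm)"
    by (simp add: algebra_simps)
  also have "\<dots> = (1 + TT * RR) * ((1 - q) * (1 + RR) * om) + (1 - q) * RR"
    unfolding mV vv_mm by (simp add: mult_ac)
  also have "\<dots> = mm * (RR * (1 + TT * RR * q))"
    unfolding om2 m by (simp add: q_def power2_eq_square algebra_simps)
  finally have eq: "mm * ((1 - q) * (VV * om + vv)) = mm * (RR * (1 + TT * RR * q))" .
  have "mm \<noteq> 0" using mm_0 by auto
  then have "(1 - q) * (VV * om + vv) = RR * (1 + TT * RR * q)"
    using eq by (rule iffD1[OF mult_left_cancel])
  moreover have "wheel_Z * (1 - q) = (1 - q) * (VV * om + vv) + hub_Z * (1 - q)"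
    unfolding wheel_Z_def K by (simp add: algebra_simps)
  ultimately have "wheel_Z * (1 - q) = RR * (1 + TT * RR * q) + TT * RR * (1 + RR)"
    using hub_Z_eq unfolding q_def by simp
  then show ?thesis unfolding q_def by (simp add: power2_eq_square power3_eq_cube algebra_simps)
qed

lemma pal_fps_wheel_Z: "pal_fps wheel_Z"
proof (rule pal_fps_recursive)
  let ?p = "((1 + TT) * uu) * fan_Z + (TT * uu\<^sup>2) * (fan_Z * fan_Z) + (TT * uu\<^sup>2) * ((TT * uu\<^sup>2) * ((fan_Z * fan_Z) * (fan_Z * fan_Z)))"
    and ?q = "(TT * uu\<^sup>2) * (fan_Z * fan_Z)"
  have "wheel_Z = RR * (1 + TT + TT * RR + TT\<^sup>2 * RR ^ 3) + TT * RR\<^sup>2 * wheel_Z"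
    using wheel_Z_eq by (simp add: algebra_simps)
  then show "wheel_Z = ?p + ?q * wheel_Z"
    unfolding RR_fan_Z by (simp add: power2_eq_square power3_eq_cube algebra_simps)
  show "pal_fps ?p" by (intro pal_fps_add pal_fps_mult pal_fps_fan_Z pal_fps_X pal_fps_TX2)
  have "pal_fps ?q" by (intro pal_fps_mult pal_fps_fan_Z pal_fps_TX2)
  then show "palindromic i (fps_nth ?q i)" for i by (simp add: pal_fps_def)
  show "fps_nth ?q 0 = 0" by (simp add: mult.assoc power2_eq_square)
qed

lemma palindromic_wheel:
  assumes "k > 0"
  shows "palindromic k (cut_sum (fps_nth wheel_fps) 0 k + tt ^ (k - 1)
    + (tt * fan_sum fan 0 (k - 1) + wrap_sum end_start 1 (k - 1) + tt * wrap_sum end_cont 0 (k - 1)))"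
proof -
  have "fps_nth wheel_Z k = cut_sum (fps_nth wheel_fps) 0 k + tt ^ (k - 1)
    + (tt * fan_sum fan 0 (k - 1) + wrap_sum end_start 1 (k - 1) + tt * wrap_sum end_cont 0 (k - 1))"
    using assms by (simp add: wheel_Z_def vv_def VV_def hub_Z_def fan_Z_def)
  then show ?thesis using pal_fps_wheel_Z unfolding pal_fps_def by metis
qed

subsection \<open>The closed form\<close>

text \<open>Two roots agree up to sign, and r + s has constant term 2, which is nonzero in
  characteristic 0.\<close>

lemma fps_sqrt1_eqI:
  fixes a s :: "'a :: {idom, ring_char_0} fps"
  assumes "s\<^sup>2 = a" "fps_nth s 0 = 1"
  shows "fps_sqrt1 a = s"
  unfolding fps_sqrt1_def
proof (rule the_equality)
  fix r assume r: "r\<^sup>2 = a \<and> fps_nth r 0 = 1"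
  have "(r - s) * (r + s) = 0" using r assms by (simp add: power2_eq_square algebra_simps)
  moreover have "fps_nth (r + s) 0 \<noteq> 0" using r assms by simp
  then have "r + s \<noteq> 0" by (metis fps_zero_nth)
  ultimately show "r = s" by simp
qed (use assms in simp)

lemma to_fract_ring:
  "to_fract (a + b) = to_fract a + to_fract b" "to_fract (a - b) = to_fract a - to_fract b"
  "to_fract (a * b) = to_fract a * to_fract b" "to_fract 1 = 1" "to_fract (a ^ k) = to_fract a ^ k"
proof -
  show "to_fract (a ^ k) = to_fract a ^ k" by (induction k) simp_all
qed simp_all

lemma to_fract_numeral: "to_fract (numeral k) = numeral k"
proof -
  have "to_fract (of_nat n) = of_nat n" for n by (induction n) simp_all
  from this[of "numeral k"] show ?thesis by simp
qed

lemma wheel_fps_closed_form: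
  fixes t u :: "int poly fps" and U S :: "int poly fps fract"
  defines "t \<equiv> fps_const [:0, 1:]"
    and "u \<equiv> fps_X"
    and "U \<equiv> to_fract u"
    and "S \<equiv> to_fract (fps_sqrt1 ((u - 1)\<^sup>2 - 4 * t * u\<^sup>2))"
  shows "to_fract wheel_fps =
      2 * (U - 1) / (S - U + 1)
      - 2 * (U\<^sup>2 + U - 1) / ((U + 1) * (S + U + 1))
      + 2 * U / ((U + 1) * S)"
proof -
  have t: "t = TT" and u: "u = uu" by (simp_all add: t_def u_def tt_def)
  let ?M = motzkin_fps
  have M: "?M * (1 - uu - TT * uu\<^sup>2 * ?M) = 1"
    using motzkin_fps_eq by (simp add: power2_eq_square algebra_simps)
  \<comment> \<open>The square root of the discriminant of the quadratic equation of the Motzkin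
    series.\<close>
  let ?s = "1 - uu - 2 * TT * uu\<^sup>2 * ?M"
  have "?s\<^sup>2 = (uu - 1)\<^sup>2 - 4 * TT * uu\<^sup>2 * (?M * (1 - uu - TT * uu\<^sup>2 * ?M))"
    by (simp add: power2_eq_square algebra_simps)
  then have "?s\<^sup>2 = (uu - 1)\<^sup>2 - 4 * TT * uu\<^sup>2" unfolding M by simp
  moreover have "fps_nth ?s 0 = 1" by (simp add: mult.assoc power2_eq_square fps_numeral_nth)
  ultimately have s: "fps_sqrt1 ((u - 1)\<^sup>2 - 4 * t * u\<^sup>2) = ?s" unfolding t u by (rule fps_sqrt1_eqI)
  define m where "m = to_fract ?M"
  define T where "T = to_fract TT"
  note hom = to_fract_ring to_fract_numeral
  have S: "S = 1 - U - 2 * T * U\<^sup>2 * m"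
    unfolding S_def s by (simp add: hom U_def u m_def T_def)
  have m1: "m * (1 - U - T * U\<^sup>2 * m) = 1"
    using arg_cong[OF M, of to_fract] by (simp only: hom U_def u m_def T_def)
  have W: "(1 + U) * (1 - T * U\<^sup>2 * m\<^sup>2) * (1 + U * m) * to_fract wheel_fps =
    U * m * (2 * (1 + U * m) - (1 + m * (1 - U\<^sup>2)) * (1 - T * U\<^sup>2 * m\<^sup>2))"
    using arg_cong[OF wheel_fps_eq, of to_fract] by (simp only: hom U_def u m_def T_def)
  have nz: "to_fract a \<noteq> 0" if "fps_nth a 0 = 1" for a :: "int poly fps"
    using that by auto
  have m0: "m \<noteq> 0" using m1 by auto
  have U0: "1 + U \<noteq> 0" using nz[of "1 + uu"] by (simp add: hom U_def u)
  have q0: "1 - T * U\<^sup>2 * m\<^sup>2 \<noteq> 0"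
    using nz[of "1 - TT * uu\<^sup>2 * ?M\<^sup>2"] by (simp add: hom U_def u m_def T_def mult.assoc power2_eq_square)
  have r0: "1 + U * m \<noteq> 0" using nz[of "1 + uu * ?M"] by (simp add: hom U_def u m_def)
  have two: "(2 :: int poly fps fract) \<noteq> 0"
    using to_fract_numeral[of "num.Bit0 num.One", where 'a = "int poly fps"] by (metis to_fract_eq_0_iff zero_neq_numeral)
  \<comment> \<open>By this relation the denominators \<open>S - U + 1\<close>,
    \<open>S + U + 1\<close> and \<open>S\<close> become 2, \<open>2 * (1 + U * m)\<close> and
    \<open>1 - T * U\<^sup>2 * m\<^sup>2\<close>, each divided by \<open>m\<close>.\<close>
  have m2: "T * U\<^sup>2 * m * m = m - U * m - 1" using m1 by (simp add: algebra_simps)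
  have "(S - U + 1) * m = 2"
    using m2 unfolding S by (simp add: ring_distribs mult.assoc)
  then have 1: "S - U + 1 = 2 / m" by (rule eq_divide_imp[OF m0])
  have "(S + U + 1) * m = 2 * (1 + U * m)"
    using m2 unfolding S by (simp add: ring_distribs mult.assoc)
  then have 2: "S + U + 1 = 2 * (1 + U * m) / m" by (rule eq_divide_imp[OF m0])
  have "S * m = 1 - T * U\<^sup>2 * m\<^sup>2"
    using m2 unfolding S by (simp add: ring_distribs mult.assoc power2_eq_square[of m])
  then have 3: "S = (1 - T * U\<^sup>2 * m\<^sup>2) / m" by (rule eq_divide_imp[OF m0])
  have t1: "2 * (U - 1) / (S - U + 1) = (U - 1) * m" unfolding 1 using two m0 by simp
  have t2: "2 * (U\<^sup>2 + U - 1) / ((U + 1) * (S + U + 1)) = (U\<^sup>2 + U - 1) * m / ((1 + U) * (1 + U * m))"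
  proof -
    have "2 * a / (c * (2 * b / m)) = a * m / (c * b)" for a b c using two by simp
    then show ?thesis unfolding 2 by (simp only: add.commute)
  qed
  have t3: "2 * U / ((U + 1) * S) = 2 * U * m / ((1 + U) * (1 - T * U\<^sup>2 * m\<^sup>2))"
    unfolding 3 using m0 by (simp add: add.commute mult_ac)
  let ?D = "(1 + U) * (1 - T * U\<^sup>2 * m\<^sup>2) * (1 + U * m)"
  have D0: "?D \<noteq> 0" using U0 q0 r0 by simp
  have a2: "?D * ((U\<^sup>2 + U - 1) * m / ((1 + U) * (1 + U * m))) = (U\<^sup>2 + U - 1) * m * (1 - T * U\<^sup>2 * m\<^sup>2)"
  proof -
    have "c * q * r * (x / (c * r)) = x * q" if "c \<noteq> 0" "r \<noteq> 0" for c q r x :: "int poly fps fract"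
      using that by simp
    then show ?thesis using U0 r0 by blast
  qed
  have a3: "?D * (2 * U * m / ((1 + U) * (1 - T * U\<^sup>2 * m\<^sup>2))) = 2 * U * m * (1 + U * m)"
  proof -
    have "c * q * r * (x / (c * q)) = x * r" if "c \<noteq> 0" "q \<noteq> 0" for c q r x :: "int poly fps fract"
      using that by simp
    then show ?thesis using U0 q0 by blast
  qed
  have "?D * (2 * (U - 1) / (S - U + 1)
      - 2 * (U\<^sup>2 + U - 1) / ((U + 1) * (S + U + 1))
      + 2 * U / ((U + 1) * S)) =
    ?D * ((U - 1) * m) - (U\<^sup>2 + U - 1) * m * (1 - T * U\<^sup>2 * m\<^sup>2) + 2 * U * m * (1 + U * m)"
  proof -
    have "D * (a - b + c) = D * a - D * b + D * c" for D a b c :: "int poly fps fract"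
      by (simp add: algebra_simps)
    then show ?thesis unfolding t1 t2 t3 by (simp only: a2 a3)
  qed
  also have "\<dots> = U * m * (2 * (1 + U * m) - (1 + m * (1 - U\<^sup>2)) * (1 - T * U\<^sup>2 * m\<^sup>2))"
    by (simp add: power2_eq_square algebra_simps)
  also have "\<dots> = ?D * to_fract wheel_fps" by (rule W[symmetric])
  finally show ?thesis using D0 by simp
qed

section \<open>Weighted sums over words\<close>

text \<open>\<open>up b F G\<close> says that the word \<open>G\<close> describes a flat above the one described by \<open>F\<close>, where \<open>b\<close>
  tells whether the letter that precedes \<open>G\<close> is \<open>Hub\<close>.\<close>

definition step :: "bool \<Rightarrow> letter \<Rightarrow> letter \<Rightarrow> bool" where
  "step b f g \<longleftrightarrow> (f = Hub \<longrightarrow> g = Hub) \<and> (f = Cont \<longrightarrow> g = (if b then Hub else Cont)) \<and> (g = Cont \<longrightarrow> \<not> b)"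

fun up :: "bool \<Rightarrow> letter list \<Rightarrow> letter list \<Rightarrow> bool" where
  "up b [] [] = True"
| "up b (f # F) (g # G) = (step b f g \<and> up (g = Hub) F G)"
| "up b _ _ = False"

abbreviation starts :: "letter list \<Rightarrow> nat" where "starts w \<equiv> count_list w Start"

text \<open>The exponent is the difference of the ranks of the two flats, as long as neither is the
  full rim.\<close>

definition wsum :: "bool \<Rightarrow> letter list \<Rightarrow> (letter list \<Rightarrow> int poly) \<Rightarrow> int poly" where
  "wsum b F h = (\<Sum>G | up b F G. tt ^ (starts F - starts G) * h G)"

section \<open>Evaluation of the sums letter by letter\<close>

lemma up_Nil [simp]: "up b [] G \<longleftrightarrow> G = []"
  by (cases G) auto

lemma up_Cons: "up b (f # F) G \<longleftrightarrow> (\<exists>g G'. G = g # G' \<and> step b f g \<and> up (g = Hub) F G')"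
  by (cases G) auto

lemma up_length: "up b F G \<Longrightarrow> length G = length F"
  by (induction b F G rule: up.induct) auto

lemma step_Start: "step b f Start \<Longrightarrow> f = Start"
  by (cases f) (auto simp: step_def split: if_splits)

lemma starts_le: "up b F G \<Longrightarrow> starts G \<le> starts F"
  by (induction b F G rule: up.induct) (auto dest: step_Start)

lemma finite_letters: "finite (A :: letter set)"
proof (rule finite_subset[of A "{Hub, Start, Cont}"])
  show "A \<subseteq> {Hub, Start, Cont}"
  proof
    fix x :: letter show "x \<in> {Hub, Start, Cont}" by (cases x) simp_all
  qed
qed simp

lemma up_Cons_image:
  "{G. up b (f # F) G} = (\<lambda>(g, G). g # G) ` (SIGMA g:{g. step b f g}. {G. up (g = Hub) F G})"
  by (auto simp: up_Cons image_iff)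

lemma finite_up: "finite {G. up b F G}"
proof (induction F arbitrary: b)
  case (Cons f F)
  show ?case unfolding up_Cons_image
    by (intro finite_imageI finite_SigmaI finite_letters Cons.IH)
next
  case Nil
  have "{G. up b [] G} = {[]}" by auto
  then show ?case by simp
qed

lemma wsum_Nil [simp]: "wsum b [] h = h []"
  by (simp add: wsum_def)

lemma wsum_Cons:
  "wsum b (f # F) h =
    (\<Sum>g | step b f g. (if f = Start \<and> g \<noteq> Start then tt else 1) * wsum (g = Hub) F (\<lambda>G. h (g # G)))"
proof -
  have inj: "inj_on (\<lambda>(g, G). g # G) (SIGMA g:{g. step b f g}. {G. up (g = Hub) F G})"
    by (auto simp: inj_on_def)
  have "wsum b (f # F) h = (\<Sum>(g, G) \<in> (SIGMA g:{g. step b f g}. {G. up (g = Hub) F G}).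
      tt ^ (starts (f # F) - starts (g # G)) * h (g # G))"
    unfolding wsum_def up_Cons_image by (subst sum.reindex[OF inj]) (simp add: case_prod_unfold)
  also have "\<dots> = (\<Sum>g | step b f g. \<Sum>G | up (g = Hub) F G. tt ^ (starts (f # F) - starts (g # G)) * h (g # G))"
    by (rule sum.Sigma[symmetric]) (simp_all add: finite_letters finite_up)
  also have "\<dots> = (\<Sum>g | step b f g. (if f = Start \<and> g \<noteq> Start then tt else 1) * wsum (g = Hub) F (\<lambda>G. h (g # G)))"
    unfolding wsum_def sum_distrib_left
  proof (intro sum.cong refl)
    fix g G assume "g \<in> {g. step b f g}" and G: "G \<in> {G. up (g = Hub) F G}"
    then have g: "f \<noteq> Start \<Longrightarrow> g \<noteq> Start" using step_Start by blast
    have "starts G \<le> starts F" using G starts_le by blast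
    then show "tt ^ (starts (f # F) - starts (g # G)) * h (g # G) =
        (if f = Start \<and> g \<noteq> Start then tt else 1) * (tt ^ (starts F - starts G) * h (g # G))"
      using g by (cases "f = Start"; cases "g = Start") (simp_all add: Suc_diff_le mult.assoc)
  qed
  finally show ?thesis .
qed

lemma wsum_Hub [simp]: "wsum b (Hub # F) h = wsum True F (\<lambda>G. h (Hub # G))"
proof -
  have "{g. step b Hub g} = {Hub}" by (auto simp: step_def)
  then show ?thesis by (simp add: wsum_Cons)
qed

lemma wsum_Cont [simp]:
  "wsum b (Cont # F) h = (if b then wsum True F (\<lambda>G. h (Hub # G)) else wsum False F (\<lambda>G. h (Cont # G)))"
proof -
  have "{g. step b Cont g} = {if b then Hub else Cont}" by (auto simp: step_def)
  then show ?thesis by (simp add: wsum_Cons)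
qed

lemma wsum_Start [simp]:
  "wsum b (Start # F) h = tt * wsum True F (\<lambda>G. h (Hub # G)) + wsum False F (\<lambda>G. h (Start # G))
    + (if b then 0 else tt * wsum False F (\<lambda>G. h (Cont # G)))"
proof -
  have "{g. step b Start g} = (if b then {Hub, Start} else {Hub, Start, Cont})"
  proof (rule set_eqI)
    fix g show "g \<in> {g. step b Start g} \<longleftrightarrow> g \<in> (if b then {Hub, Start} else {Hub, Start, Cont})"
      by (cases g) (auto simp: step_def)
  qed
  then show ?thesis by (simp add: wsum_Cons add.assoc)
qed

lemma wsum_mult [simp]: "wsum b F (\<lambda>G. c * h G) = c * wsum b F h"
  by (simp add: wsum_def sum_distrib_left mult_ac)

lemma wsum_0 [simp]: "wsum b F (\<lambda>G. 0) = 0"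
  by (simp add: wsum_def)

lemma wsum_add: "wsum b F (\<lambda>G. h G + h' G) = wsum b F h + wsum b F h'"
  by (simp add: wsum_def distrib_left sum.distrib)

text \<open>The counter \<open>j\<close> is the number of components in the current run of letters other than \<open>Hub\<close>; a
  run with \<open>j\<close> components contributes the polynomial of the fan with \<open>j\<close> path vertices.\<close>

fun run_weight :: "(nat \<Rightarrow> int poly) \<Rightarrow> nat \<Rightarrow> letter list \<Rightarrow> int poly" where
  "run_weight e j [] = e j"
| "run_weight e j (Hub # w) = fan j * run_weight e 0 w"
| "run_weight e j (Start # w) = run_weight e (Suc j) w"
| "run_weight e j (Cont # w) = run_weight e j w"

fun up_sum :: "(nat \<Rightarrow> int poly) \<Rightarrow> nat \<Rightarrow> letter list \<Rightarrow> int poly" where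
  "up_sum e j [] = e j"
| "up_sum e j (Hub # F) = fan j * up_sum e 0 F"
| "up_sum e j (Start # F) = tt * fan j * up_sum e 0 F + up_sum e (Suc j) F + (if j = 0 then 0 else tt * up_sum e j F)"
| "up_sum e j (Cont # F) = up_sum e j F"

text \<open>The first run gets no factor of its own: its size is handed to the weight
  \<open>e i\<close> of the last run, with which it forms one run of the cyclic word.\<close>

fun wrap_weight :: "(nat \<Rightarrow> nat \<Rightarrow> int poly) \<Rightarrow> nat \<Rightarrow> letter list \<Rightarrow> int poly" where
  "wrap_weight e i [] = 0"
| "wrap_weight e i (Hub # w) = run_weight (e i) 0 w"
| "wrap_weight e i (Start # w) = wrap_weight e (Suc i) w"
| "wrap_weight e i (Cont # w) = wrap_weight e i w"

fun rim_weight :: "(nat \<Rightarrow> int poly) \<Rightarrow> nat \<Rightarrow> letter list \<Rightarrow> int poly" where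
  "rim_weight c j [] = c j"
| "rim_weight c j (Hub # w) = 0"
| "rim_weight c j (Start # w) = rim_weight c (Suc j) w"
| "rim_weight c j (Cont # w) = rim_weight c j w"

text \<open>The flag for a preceding \<open>Hub\<close> is tied to the counter: since
  \<open>Cont\<close> cannot follow \<open>Hub\<close>, every nonempty run has a component, and the
  run is empty exactly after a \<open>Hub\<close>.\<close>

lemma wsum_run_weight: "wsum (j = 0) F (run_weight e j) = up_sum e j F"
proof (induction F arbitrary: j)
  case (Cons f F)
  note IH0 = Cons.IH[of 0, simplified] and IHS = Cons.IH[of "Suc _", simplified]
  show ?case
  proof (cases f)
    case Cont
    then show ?thesis using IH0 Cons.IH[of j] by (cases "j = 0") simp_all
  next
    case Start
    then show ?thesis using IH0 IHS Cons.IH[of j] by (cases "j = 0") (simp_all add: mult.assoc)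
  qed (simp add: IH0)
qed simp

lemma up_sum_fan_sum: "Hub \<notin> set F \<Longrightarrow> up_sum e j F = fan_sum e j (starts F)"
proof (induction F arbitrary: j)
  case (Cons f F)
  then show ?case by (cases f) simp_all
qed simp

lemma wsum_wrap_weight: "Hub \<notin> set F \<Longrightarrow> wsum False F (wrap_weight e i) = wrap_sum e i (starts F)"
proof (induction F arbitrary: i)
  case (Cons f F)
  have "wsum True F (run_weight (e i) 0) = fan_sum (e i) 0 (starts F)"
    using wsum_run_weight[of 0 F "e i"] up_sum_fan_sum[of F] Cons.prems by simp
  then show ?case using Cons by (cases f) simp_all
qed simp

lemma wsum_rim_weight: "Hub \<notin> set F \<Longrightarrow> wsum False F (rim_weight c j) = cut_sum c j (starts F)"
proof (induction F arbitrary: j)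
  case (Cons f F)
  then show ?case by (cases f) simp_all
qed simp

text \<open>A \<open>Hub\<close> of the lower word persists in every word above it, so the sum
  factorizes there.\<close>

lemma up_sum_split: "Hub \<notin> set F \<Longrightarrow> up_sum fan j (F @ Hub # F') = fan_sum fan j (starts F) * up_sum fan 0 F'"
proof (induction F arbitrary: j)
  case (Cons f F)
  then show ?case by (cases f) (simp_all add: algebra_simps)
qed simp

lemma palindromic_up_sum: "palindromic (starts F) (up_sum fan 0 F)"
proof (induction "length F" arbitrary: F rule: less_induct)
  case less
  show ?case
  proof (cases "Hub \<in> set F")
    case True
    then obtain u v where F: "F = u @ Hub # v" "Hub \<notin> set u" by (meson split_list_first)
    have "palindromic (starts u + starts v) (fan_sum fan 0 (starts u) * up_sum fan 0 v)"
      using F(1) by (intro palindromic_mult palindromic_fan_sum less.hyps) simp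
    then show ?thesis using up_sum_split[OF F(2)] F(1) by simp
  next
    case False
    then show ?thesis using up_sum_fan_sum palindromic_fan_sum by metis
  qed
qed

lemma run_weight_append: "run_weight e j (v @ w) = run_weight (\<lambda>j. run_weight e j w) j v"
proof (induction v arbitrary: j)
  case (Cons x v)
  then show ?case by (cases x) simp_all
qed simp

lemma run_weight_Hub: "run_weight fan j (v @ Hub # w) = run_weight fan j v * run_weight fan 0 w"
proof (induction v arbitrary: j)
  case (Cons x v)
  then show ?case by (cases x) simp_all
qed simp

lemma run_weight_no_Hub: "Hub \<notin> set w \<Longrightarrow> run_weight e j w = e (j + starts w)"
proof (induction w arbitrary: j)
  case (Cons x w)
  then show ?case by (cases x) simp_all
qed simp

text \<open>Each nonempty run of r components contributes at most r - 1 to twice the degree; the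
  truncated subtraction covers the case of no components at all.\<close>

lemma degree_run_weight: "2 * degree (run_weight fan j w) \<le> j + starts w - 1"
proof (induction w arbitrary: j)
  case Nil
  then show ?case using degree_fan[of j] by (cases "j = 0") auto
next
  case (Cons x w)
  show ?case
  proof (cases x)
    case Hub
    have "2 * degree (fan j) \<le> j - 1" using degree_fan[of j] by (cases "j = 0") auto
    moreover have "2 * degree (run_weight fan 0 w) \<le> starts w - 1" using Cons.IH[of 0] by simp
    ultimately have "2 * degree (fan j * run_weight fan 0 w) \<le> j + starts w - 1"
      using degree_mult_le[of "fan j" "run_weight fan 0 w"] by linarith
    then show ?thesis using Hub by simp
  next
    case Start
    then show ?thesis using Cons.IH[of "Suc j"] by simp
  next
    case Cont
    then show ?thesis using Cons.IH[of j] by simp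
  qed
qed

subsection \<open>Cyclic words\<close>

text \<open>Opening the cyclic word at a \<open>Hub\<close> keeps the run across the boundary in one
  piece. By \<open>hub_weight_split\<close> the choice of the \<open>Hub\<close> is
  immaterial.\<close>

definition hub_weight :: "letter list \<Rightarrow> int poly" where
  "hub_weight w = run_weight fan 0 (tl (dropWhile (\<lambda>x. x \<noteq> Hub) w) @ takeWhile (\<lambda>x. x \<noteq> Hub) w)"

lemma hub_weight_split: "hub_weight (u @ Hub # v) = run_weight fan 0 (v @ u)"
proof -
  have first: "hub_weight (u @ Hub # v) = run_weight fan 0 (v @ u)" if "Hub \<notin> set u" for u v
  proof -
    have "\<And>x. x \<in> set u \<Longrightarrow> x \<noteq> Hub" using that by auto
    then show ?thesis by (simp add: hub_weight_def takeWhile_append2 dropWhile_append2)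
  qed
  show ?thesis
  proof (cases "Hub \<in> set u")
    case True
    then obtain p m where u: "u = p @ Hub # m" "Hub \<notin> set p" by (meson split_list_first)
    have "hub_weight (u @ Hub # v) = run_weight fan 0 (m @ Hub # (v @ p))"
      using first[OF u(2), of "m @ Hub # v"] u(1) by simp
    also have "\<dots> = run_weight fan 0 ((v @ p) @ Hub # m)" unfolding run_weight_Hub by (rule mult.commute)
    finally show ?thesis using u(1) by simp
  qed (rule first)
qed

text \<open>Without \<open>Hub\<close> the contraction is, up to simplification, the wheel with
  \<open>starts w\<close> spokes; below two letters \<open>Start\<close> the value is the formal
  weight 0.\<close>

definition cyc_weight :: "letter list \<Rightarrow> int poly" where
  "cyc_weight w = (if Hub \<in> set w then hub_weight w else fps_nth wheel_fps (starts w))"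

lemma starts_rotate1 [simp]: "starts (rotate1 w) = starts w"
  by (cases w) (simp_all add: count_list_append)

lemma cyc_weight_rotate1: "cyc_weight (rotate1 w) = cyc_weight w"
proof (cases "Hub \<in> set w")
  case True
  then obtain x w' where w: "w = x # w'" by (cases w) auto
  have "hub_weight (rotate1 w) = hub_weight w"
  proof (cases "x = Hub")
    case True
    then show ?thesis using w hub_weight_split[of w' "[]"] hub_weight_split[of "[]" w'] by simp
  next
    case False
    then obtain u v where "w' = u @ Hub # v" using w \<open>Hub \<in> set w\<close> split_list by fastforce
    then show ?thesis using w hub_weight_split[of u "v @ [x]"] hub_weight_split[of "x # u" v] by simp
  qed
  then show ?thesis using True by (simp add: cyc_weight_def)
qed (simp add: cyc_weight_def)

definition above :: "letter list \<Rightarrow> letter list \<Rightarrow> bool" where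
  "above F G \<longleftrightarrow> up (last G = Hub) F G"

definition csum :: "letter list \<Rightarrow> (letter list \<Rightarrow> int poly) \<Rightarrow> int poly" where
  "csum F h = (\<Sum>G | above F G. tt ^ (starts F - starts G) * h G)"

lemma finite_above: "finite {G. above F G}"
  by (rule finite_subset[of _ "{G. up True F G} \<union> {G. up False F G}"])
    (auto simp: above_def finite_up, metis (full_types))

lemma up_snoc:
  "length F = length G \<Longrightarrow> up b (F @ [f]) (G @ [g]) \<longleftrightarrow>
    up b F G \<and> step (if G = [] then b else last G = Hub) f g"
  by (induction F G arbitrary: b rule: list_induct2) auto

lemma above_rotate1: "above (rotate1 F) (rotate1 G) \<longleftrightarrow> above F G"
proof (cases "length F = length G")
  case True
  show ?thesis
  proof (cases F)
    case (Cons f F')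
    then obtain g G' where G: "G = g # G'" using True by (cases G) auto
    have l: "length F' = length G'" using True Cons G by simp
    show ?thesis using up_snoc[OF l] Cons G by (auto simp: above_def)
  qed (use True in simp)
next
  case False
  then show ?thesis using up_length unfolding above_def by (metis length_rotate1)
qed

lemma csum_rotate1:
  assumes "\<And>w. h (rotate1 w) = h w"
  shows "csum (rotate1 F) h = csum F h"
proof -
  have "bij_betw rotate1 {G. above F G} {G. above (rotate1 F) G}"
  proof (intro bij_betwI')
    fix G G' :: "letter list"
    show "(rotate1 G = rotate1 G') = (G = G')" using inj_rotate1 by (auto dest: injD)
  next
    fix H assume H: "H \<in> {G. above (rotate1 F) G}"
    obtain G where "H = rotate1 G" using surj_rotate1 by (metis surjD)
    then show "\<exists>G\<in>{G. above F G}. H = rotate1 G" using H above_rotate1 by auto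
  qed (simp add: above_rotate1)
  from sum.reindex_bij_betw[OF this, of "\<lambda>G. tt ^ (starts (rotate1 F) - starts G) * h G"]
  show ?thesis by (simp add: csum_def assms)
qed

text \<open>The cyclic word may be opened where it suits: at a \<open>Hub\<close> if there is one,
  otherwise at a \<open>Start\<close>.\<close>

lemma csum_rotate:
  assumes "\<And>w. h (rotate1 w) = h w"
  shows "csum (rotate m F) h = csum F h"
  by (induction m) (simp_all add: csum_rotate1 assms)

lemma rotate_to_head:
  assumes "x \<in> set w"
  obtains m w' where "rotate m w = x # w'"
proof -
  obtain u v where "w = u @ x # v" using assms by (meson split_list)
  then have "rotate (length u) w = x # (v @ u)" using rotate_append[of u "x # v"] by simp
  then show ?thesis using that by blast
qed

lemma starts_rotate: "starts (rotate m w) = starts w"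
  by (induction m) simp_all

lemma csum_Hub:
  assumes "Hub \<in> set F"
  shows "palindromic (starts F) (csum F cyc_weight)"
proof -
  obtain m F' where m: "rotate m F = Hub # F'" by (rule rotate_to_head[OF assms])
  have iff: "above (Hub # F') v \<longleftrightarrow> (\<exists>G. v = Hub # G \<and> up True F' G)" for v
    by (auto simp: above_def up_Cons step_def)
  have "csum F cyc_weight = csum (Hub # F') cyc_weight" using csum_rotate[where h = cyc_weight, OF cyc_weight_rotate1, of m F] m by simp
  also have "\<dots> = wsum True F' (\<lambda>G. cyc_weight (Hub # G))"
  proof -
    have "{v. above (Hub # F') v} = (#) Hub ` {G. up True F' G}" by (auto simp: iff)
    then show ?thesis unfolding csum_def wsum_def by (simp add: sum.reindex)
  qed
  also have "(\<lambda>G. cyc_weight (Hub # G)) = run_weight fan 0"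
  proof
    fix G show "cyc_weight (Hub # G) = run_weight fan 0 G" using hub_weight_split[of "[]" G] by (simp add: cyc_weight_def)
  qed
  also have "wsum True F' (run_weight fan 0) = up_sum fan 0 F'" using wsum_run_weight[of 0] by simp
  finally have "csum F cyc_weight = up_sum fan 0 F'" .
  moreover have "starts F = starts F'" using starts_rotate[of m F] m by simp
  ultimately show ?thesis using palindromic_up_sum by simp
qed

lemma run_weight_end_cont:
  "up (j = 0) F v \<Longrightarrow> run_weight (end_cont i) j v = (if v = [] \<and> j = 0 \<or> v \<noteq> [] \<and> last v = Hub then 0 else run_weight (end_start i) j v)"
proof (induction v arbitrary: j F)
  case Nil
  then show ?case by (simp add: end_cont_def end_start_def)
next
  case (Cons x v)
  obtain f F' where F: "F = f # F'" using Cons.prems by (cases F) auto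
  show ?case
  proof (cases x)
    case Hub
    have "up (0 = (0::nat)) F' v" using Cons.prems F Hub by simp
    from Cons.IH[OF this] show ?thesis using Hub by auto
  next
    case Start
    have "up (Suc j = 0) F' v" using Cons.prems F Start by simp
    from Cons.IH[OF this] show ?thesis using Start by auto
  next
    case Cont
    then have "j \<noteq> 0" using Cons.prems F by (simp add: step_def)
    then have "up (j = 0) F' v" using Cons.prems F Cont by simp
    from Cons.IH[OF this] show ?thesis using Cont \<open>j \<noteq> 0\<close> by auto
  qed
qed

lemma wrap_weight_end_cont:
  "up False F v \<Longrightarrow> wrap_weight end_cont i v = (if v \<noteq> [] \<and> last v = Hub then 0 else wrap_weight end_start i v)"
proof (induction v arbitrary: i F)
  case (Cons x v)
  obtain f F' where F: "F = f # F'" using Cons.prems by (cases F) auto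
  show ?case
  proof (cases x)
    case Hub
    have "up (0 = (0::nat)) F' v" using Cons.prems F Hub by simp
    from run_weight_end_cont[OF this] show ?thesis using Hub by auto
  next
    case Start
    have "up False F' v" using Cons.prems F Start by simp
    from Cons.IH[OF this] show ?thesis using Start by auto
  next
    case Cont
    have "up False F' v" using Cons.prems F Cont by simp
    from Cons.IH[OF this] show ?thesis using Cont by auto
  qed
qed simp

lemma wrap_weight_no_Hub: "Hub \<notin> set w \<Longrightarrow> wrap_weight e i w = 0"
proof (induction w arbitrary: i)
  case (Cons x w)
  then show ?case by (cases x) simp_all
qed simp

lemma wrap_weight_Hub: "Hub \<notin> set u \<Longrightarrow> wrap_weight e i (u @ Hub # v) = run_weight (e (i + starts u)) 0 v"
proof (induction u arbitrary: i)
  case (Cons x u)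
  then show ?case by (cases x) simp_all
qed simp

lemma rim_weight_eq: "rim_weight c j w = (if Hub \<in> set w then 0 else c (j + starts w))"
proof (induction w arbitrary: j)
  case (Cons x w)
  then show ?case by (cases x) simp_all
qed simp

lemma cyc_weight_eq:
  assumes "x \<noteq> Hub"
  shows "cyc_weight (x # G) = rim_weight (fps_nth wheel_fps) (starts [x]) G + wrap_weight end_start (starts [x]) G"
proof (cases "Hub \<in> set G")
  case True
  then obtain u v where G: "G = u @ Hub # v" "Hub \<notin> set u" by (meson split_list_first)
  have "cyc_weight (x # G) = run_weight fan 0 (v @ x # u)"
    using hub_weight_split[of "x # u" v] G by (simp add: cyc_weight_def)
  also have "\<dots> = run_weight (\<lambda>j. run_weight fan j (x # u)) 0 v" by (rule run_weight_append)
  also have "(\<lambda>j. run_weight fan j (x # u)) = end_start (starts [x] + starts u)"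
  proof
    fix j show "run_weight fan j (x # u) = end_start (starts [x] + starts u) j"
      using run_weight_no_Hub[of "x # u" fan j] G(2) assms by (simp add: end_start_def ac_simps)
  qed
  also have "run_weight (end_start (starts [x] + starts u)) 0 v = wrap_weight end_start (starts [x]) G"
    using wrap_weight_Hub[OF G(2)] G(1) by simp
  finally show ?thesis using True by (simp add: rim_weight_eq)
next
  case False
  then show ?thesis using assms by (simp add: cyc_weight_def rim_weight_eq wrap_weight_no_Hub)
qed

text \<open>Opened at a \<open>Start\<close>, the sum splits as in \<open>hub_Z\<close> and in the
  recursion of \<open>cut_sum\<close>. The extra power of \<open>tt\<close> is the full rim, which
  \<open>csum\<close> weighs with 0.\<close>

lemma csum_no_Hub:
  assumes "Hub \<notin> set F" "Start \<in> set F"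
  shows "palindromic (starts F) (tt ^ (starts F - 1) + csum F cyc_weight)"
proof -
  obtain m F' where m: "rotate m F = Start # F'" by (rule rotate_to_head[OF assms(2)])
  have nh: "Hub \<notin> set F'" using m assms(1) set_rotate[of m F] by auto
  let ?k = "starts F'"
  have k: "starts F = Suc ?k" using starts_rotate[of m F] m by simp
  have "above (Start # F') v \<longleftrightarrow>
      (\<exists>G. v = Hub # G \<and> up True F' G) \<or> (\<exists>G. v = Start # G \<and> up False F' G)
      \<or> (\<exists>G. v = Cont # G \<and> up False F' G \<and> \<not> (G \<noteq> [] \<and> last G = Hub))" for v
  proof (cases v)
    case (Cons x G)
    then show ?thesis by (cases x) (auto simp: above_def step_def)
  qed (simp add: above_def)
  then have set_eq: "{v. above (Start # F') v} = (#) Hub ` {G. up True F' G} \<union> ((#) Start ` {G. up False F' G}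
      \<union> (#) Cont ` {G. up False F' G \<and> \<not> (G \<noteq> [] \<and> last G = Hub)})"
    by auto
  have fin: "finite {G. up False F' G \<and> P G}" for P
    by (rule finite_subset[OF _ finite_up[of False F']]) auto
  have "csum F cyc_weight = csum (Start # F') cyc_weight" using csum_rotate[where h = cyc_weight, OF cyc_weight_rotate1, of m F] m by simp
  also have "\<dots> = tt * wsum True F' (\<lambda>G. cyc_weight (Hub # G)) + (wsum False F' (\<lambda>G. cyc_weight (Start # G))
      + tt * (\<Sum>G | up False F' G \<and> \<not> (G \<noteq> [] \<and> last G = Hub). tt ^ (?k - starts G) * cyc_weight (Cont # G)))"
    unfolding csum_def set_eq
  proof (subst sum.union_disjoint, goal_cases)
    case 4
    have "tt ^ (Suc ?k - starts G) = tt * tt ^ (?k - starts G)" if "up b F' G" for b G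
      using starts_le[OF that] by (simp add: Suc_diff_le)
    then show ?case
      by (subst sum.union_disjoint)
        (auto simp: finite_up fin sum.reindex wsum_def sum_distrib_left mult.assoc intro!: sum.cong)
  qed (auto simp: finite_up fin)
  also have "(\<lambda>G. cyc_weight (Hub # G)) = run_weight fan 0"
  proof
    fix G show "cyc_weight (Hub # G) = run_weight fan 0 G" using hub_weight_split[of "[]" G] by (simp add: cyc_weight_def)
  qed
  also have "wsum True F' (run_weight fan 0) = fan_sum fan 0 ?k" using wsum_run_weight[of 0 F' fan] up_sum_fan_sum[OF nh] by simp
  also have "wsum False F' (\<lambda>G. cyc_weight (Start # G)) = cut_sum (fps_nth wheel_fps) 1 ?k + wrap_sum end_start 1 ?k"
    by (simp add: cyc_weight_eq wsum_add wsum_rim_weight[OF nh] wsum_wrap_weight[OF nh])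
  \<comment> \<open>The restriction to words that do not end in \<open>Hub\<close> is traded for the
    weight \<open>end_cont\<close>, which vanishes on the others.\<close>
  also have "(\<Sum>G | up False F' G \<and> \<not> (G \<noteq> [] \<and> last G = Hub). tt ^ (?k - starts G) * cyc_weight (Cont # G))
    = wsum False F' (\<lambda>G. rim_weight (fps_nth wheel_fps) 0 G + wrap_weight end_cont 0 G)"
    unfolding wsum_def
  proof (rule sum.mono_neutral_cong_left[OF finite_up])
    show "\<forall>G\<in>{G. up False F' G} - {G. up False F' G \<and> \<not> (G \<noteq> [] \<and> last G = Hub)}.
        tt ^ (?k - starts G) * (rim_weight (fps_nth wheel_fps) 0 G + wrap_weight end_cont 0 G) = 0"
    proof
      fix G assume "G \<in> {G. up False F' G} - {G. up False F' G \<and> \<not> (G \<noteq> [] \<and> last G = Hub)}"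
      then have G: "up False F' G" "G \<noteq> []" "last G = Hub" by auto
      then have "Hub \<in> set G" using last_in_set by metis
      then show "tt ^ (?k - starts G) * (rim_weight (fps_nth wheel_fps) 0 G + wrap_weight end_cont 0 G) = 0"
        using wrap_weight_end_cont[OF G(1)] G by (simp add: rim_weight_eq)
    qed
    fix G assume "G \<in> {G. up False F' G \<and> \<not> (G \<noteq> [] \<and> last G = Hub)}"
    then show "tt ^ (?k - starts G) * cyc_weight (Cont # G) = tt ^ (?k - starts G) * (rim_weight (fps_nth wheel_fps) 0 G + wrap_weight end_cont 0 G)"
      using wrap_weight_end_cont[of F' G 0] by (auto simp: cyc_weight_eq)
  qed auto
  also have "\<dots> = cut_sum (fps_nth wheel_fps) 0 ?k + wrap_sum end_cont 0 ?k"
    by (simp add: wsum_add wsum_rim_weight[OF nh] wsum_wrap_weight[OF nh])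
  finally have "tt ^ (starts F - 1) + csum F cyc_weight = cut_sum (fps_nth wheel_fps) 0 (Suc ?k) + tt ^ (Suc ?k - 1)
    + (tt * fan_sum fan 0 (Suc ?k - 1) + wrap_sum end_start 1 (Suc ?k - 1) + tt * wrap_sum end_cont 0 (Suc ?k - 1))"
    by (simp add: k algebra_simps)
  then show ?thesis using palindromic_wheel[OF zero_less_Suc, of ?k] by (simp only: k)
qed

section \<open>The Kazhdan--Lusztig polynomials of wheels\<close>

text \<open>Contracting the full rim leaves parallel spokes, of rank 1 and with polynomial 1, where
  \<open>cyc_weight\<close> would give 0.\<close>

definition word_poly :: "letter list \<Rightarrow> int poly" where
  "word_poly w = (if set w \<subseteq> {Cont} then 1 else cyc_weight w)"

lemma up_nth:
  "up b F G \<longleftrightarrow> length F = length G \<and>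
    (\<forall>i<length G. step (if i = 0 then b else G ! (i - 1) = Hub) (F ! i) (G ! i))"
proof (induction b F G rule: up.induct)
  case (2 b f F g G)
  have "(\<forall>i<Suc k. P i) \<longleftrightarrow> P 0 \<and> (\<forall>i<k. P (Suc i))" for k and P :: "nat \<Rightarrow> bool"
    using All_less_Suc2 by blast
  moreover have "(if i = 0 then g = Hub else G ! (i - 1) = Hub) = ((g # G) ! i = Hub)" for i
    by (cases i) auto
  ultimately show ?case using 2 by simp blast
qed auto

lemma up_replicate_Cont: "up b (replicate m Cont) G \<longleftrightarrow> G = replicate m (if b then Hub else Cont)"
proof (induction m arbitrary: b G)
  case (Suc m)
  show ?case by (cases G) (auto simp: Suc.IH step_def)
qed simp

lemma run_weight_replicate_Hub: "run_weight fan 0 (replicate m Hub) = 1"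
  by (induction m) simp_all

section \<open>Palindromicity above every flat of the wheel\<close>

context wheel_graph
begin

definition rank_word :: "letter list \<Rightarrow> nat" where
  "rank_word w = (if set w \<subseteq> {Cont} then n - 1 else n - starts w)"

lemma all_Cont: "length w = n \<Longrightarrow> set w \<subseteq> {Cont} \<longleftrightarrow> w = replicate n Cont"
  using replicate_eqI[of w n Cont] by (metis in_set_replicate singletonD singletonI subset_iff)

lemma rank_word: "good n w \<Longrightarrow> rank_in M (flat_of n w) = rank_word w"
  using rank_flat_of rank_flat_of_Cont all_Cont[of w] by (auto simp: rank_word_def good_def)

lemma above_iff:
  assumes "length v = n" "length F = n"
  shows "above F v \<longleftrightarrow> (\<forall>i<n. step (v ! prv n i = Hub) (F ! i) (v ! i))"
proof -
  have "last v = v ! (n - 1)" using assms n by (subst last_conv_nth) auto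
  then have "(if i = 0 then last v = Hub else v ! (i - 1) = Hub) \<longleftrightarrow> v ! prv n i = Hub" for i
    by (simp add: prv_def)
  then show ?thesis using assms by (simp add: above_def up_nth)
qed

text \<open>\<open>step\<close> already forbids \<open>Cont\<close> after \<open>Hub\<close>, so
  only the exclusion of a lone \<open>Start\<close> has to be added to \<open>above\<close>.\<close>

lemma good_above_iff:
  assumes F: "good n F"
  shows "good n v \<and> flat_of n F \<subseteq> flat_of n v \<longleftrightarrow> above F v \<and> \<not> (Hub \<notin> set v \<and> starts v = 1)"
proof (cases "length v = n")
  case True
  have lF: "length F = n" using F by (simp add: good_def)
  have "above F v \<longleftrightarrow> (\<forall>i<n. v ! i = Cont \<longrightarrow> v ! prv n i \<noteq> Hub) \<and>
    (\<forall>i<n. (F ! i = Hub \<longrightarrow> v ! i = Hub) \<and> (F ! i = Cont \<longrightarrow> v ! i = (if v ! prv n i = Hub then Hub else Cont)))"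
    unfolding above_iff[OF True lF] step_def by blast
  then show ?thesis using flat_of_mono_iff[OF F, of v] True unfolding good_def by blast
next
  case False
  then show ?thesis using F up_length[of "last v = Hub" F v] by (auto simp: good_def above_def)
qed

lemma palindromic_above:
  assumes F: "good n F"
  shows "palindromic (n - rank_word F)
    (\<Sum>v | good n v \<and> flat_of n F \<subseteq> flat_of n v. monom 1 (rank_word v - rank_word F) * word_poly v)"
proof -
  have lF: "length F = n" using F by (simp add: good_def)
  have tt: "monom 1 k = tt ^ k" for k by (simp add: tt_def monom_altdef)
  have le: "starts w \<le> n" if "length w = n" for w using count_le_length[of w Start] that by simp
  have len: "length v = n" if "above F v" for v using up_length that lF by (auto simp: above_def)
  let ?exc = "\<lambda>v. Hub \<notin> set v \<and> starts v = 1"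
  have summand: "monom 1 (rank_word v - rank_word F) * word_poly v = tt ^ (starts F - starts v) * cyc_weight v"
    if "above F v" "\<not> set v \<subseteq> {Cont}" "\<not> set F \<subseteq> {Cont}" for v
  proof -
    have "starts v \<le> starts F" using that(1) starts_le by (auto simp: above_def)
    then have "n - starts v - (n - starts F) = starts F - starts v" using le[OF lF] by simp
    then show ?thesis using that by (simp add: tt rank_word_def word_poly_def)
  qed
  consider "Hub \<in> set F" | "Hub \<notin> set F" "Start \<in> set F" | "set F \<subseteq> {Cont}"
  proof -
    have "set F \<subseteq> {Cont}" if "Hub \<notin> set F" "Start \<notin> set F"
    proof
      fix x assume "x \<in> set F"
      then have "x \<noteq> Hub" "x \<noteq> Start" using that by metis+
      then show "x \<in> {Cont}" by (metis letter.exhaust singletonI)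
    qed
    then show thesis using that by blast
  qed
  then show ?thesis
  proof cases
    case 1
    have Hub: "Hub \<in> set v" if v: "above F v" for v
    proof -
      obtain i where i: "i < n" "F ! i = Hub" using 1 lF by (auto simp: in_set_conv_nth)
      then have "v ! i = Hub" using v len[OF v] lF by (auto simp: above_iff step_def)
      then show ?thesis using i(1) len[OF v] by (metis nth_mem)
    qed
    have "(\<Sum>v | good n v \<and> flat_of n F \<subseteq> flat_of n v. monom 1 (rank_word v - rank_word F) * word_poly v)
      = csum F cyc_weight"
      unfolding csum_def good_above_iff[OF F]
    proof (rule sum.cong)
      show "{v. above F v \<and> \<not> ?exc v} = {v. above F v}" using Hub by blast
      fix v assume "v \<in> {v. above F v}"
      then show "monom 1 (rank_word v - rank_word F) * word_poly v = tt ^ (starts F - starts v) * cyc_weight v"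
        using Hub 1 by (intro summand) auto
    qed
    moreover have "n - rank_word F = starts F" using 1 le[OF lF] by (auto simp: rank_word_def)
    ultimately show ?thesis using csum_Hub[OF 1] by simp
  next
    case 2
    let ?c = "replicate n Cont"
    let ?A = "{v. above F v \<and> \<not> ?exc v}"
    have nC: "\<not> set F \<subseteq> {Cont}" using 2(2) by auto
    have c: "?c \<in> ?A"
    proof -
      have "step (?c ! prv n i = Hub) (F ! i) (?c ! i)" if "i < n" for i
      proof -
        have "F ! i \<noteq> Hub" using that 2(1) lF nth_mem[of i F] by metis
        then show ?thesis using that prv_less[OF that] by (simp add: step_def)
      qed
      then have "above F ?c" using lF by (simp add: above_iff)
      then show ?thesis by (simp add: count_list_0_iff)
    qed
    have fin: "finite ?A" by (rule finite_subset[OF _ finite_above[of F]]) auto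
    have "(\<Sum>v | good n v \<and> flat_of n F \<subseteq> flat_of n v. monom 1 (rank_word v - rank_word F) * word_poly v)
      = monom 1 (rank_word ?c - rank_word F) * word_poly ?c + (\<Sum>v\<in>?A - {?c}. monom 1 (rank_word v - rank_word F) * word_poly v)"
      unfolding good_above_iff[OF F] by (rule sum.remove[OF fin c])
    also have "(\<Sum>v\<in>?A - {?c}. monom 1 (rank_word v - rank_word F) * word_poly v)
      = (\<Sum>v\<in>?A - {?c}. tt ^ (starts F - starts v) * cyc_weight v)"
    proof (rule sum.cong)
      fix v assume v: "v \<in> ?A - {?c}"
      then have "\<not> set v \<subseteq> {Cont}" using all_Cont[of v] len by blast
      then show "monom 1 (rank_word v - rank_word F) * word_poly v = tt ^ (starts F - starts v) * cyc_weight v"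
        using v nC by (intro summand) auto
    qed simp
    \<comment> \<open>The excluded words and the full rim re-enter the sum with weight 0.\<close>
    also have "\<dots> = csum F cyc_weight"
      unfolding csum_def
    proof (rule sum.mono_neutral_left[OF finite_above])
      have "cyc_weight v = 0" if "?exc v" for v using that wheel_fps_1 by (simp add: cyc_weight_def)
      moreover have "cyc_weight ?c = 0" using wheel_fps_0 by (simp add: cyc_weight_def count_list_0_iff)
      ultimately show "\<forall>v\<in>{v. above F v} - (?A - {?c}). tt ^ (starts F - starts v) * cyc_weight v = 0" by auto
    qed auto
    also have "monom 1 (rank_word ?c - rank_word F) * word_poly ?c = tt ^ (starts F - 1)"
    proof -
      have "n - 1 - (n - starts F) = starts F - 1" using le[OF lF] by simp
      then show ?thesis using nC n by (simp add: tt rank_word_def word_poly_def)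
    qed
    finally show ?thesis
      using csum_no_Hub[OF 2] nC le[OF lF] by (simp add: rank_word_def)
  next
    case 3
    \<comment> \<open>Above the full rim there are only the rim itself and the whole ground set,
      which give 1 + t.\<close>
    let ?c = "replicate n Cont" and ?h = "replicate n Hub"
    have Fc: "F = ?c" using 3 all_Cont[OF lF] by simp
    have "above F v \<longleftrightarrow> v = ?c \<or> v = ?h" for v
      using n by (auto simp: Fc above_def up_replicate_Cont)
    then have "{v. above F v \<and> \<not> ?exc v} = {?c, ?h}"
      using n by (auto simp: count_list_0_iff)
    moreover have "?c \<noteq> ?h" using n by (cases n) auto
    moreover have "word_poly ?h = 1"
    proof -
      obtain m where m: "n = Suc m" using n by (cases n) auto
      show ?thesis using hub_weight_split[of "[]" "replicate m Hub"] run_weight_replicate_Hub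
        by (simp add: word_poly_def cyc_weight_def m)
    qed
    moreover have "rank_word ?c = n - 1" "rank_word ?h = n" "word_poly ?c = 1"
      using n by (auto simp: rank_word_def word_poly_def count_list_0_iff)
    ultimately have "(\<Sum>v | good n v \<and> flat_of n F \<subseteq> flat_of n v. monom 1 (rank_word v - rank_word F) * word_poly v) = 1 + tt"
      unfolding good_above_iff[OF F] using n by (simp add: Fc tt)
    moreover have "n - rank_word F = 1" using n 3 by (simp add: rank_word_def)
    ultimately show ?thesis using palindromic_1_tt by simp
  qed
qed

lemma degree_word_poly:
  assumes "good n w" "rank_word w < n"
  shows "2 * degree (word_poly w) < n - rank_word w"
proof (cases "set w \<subseteq> {Cont}")
  case True
  then show ?thesis using assms by (simp add: word_poly_def)
next
  case False
  have "starts w \<le> n" using count_le_length[of w Start] assms(1) by (simp add: good_def)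
  then have s: "n - rank_word w = starts w" "starts w > 0" using assms(2) False by (auto simp: rank_word_def)
  have "2 * degree (cyc_weight w) < starts w"
  proof (cases "Hub \<in> set w")
    case True
    then obtain u v where w: "w = u @ Hub # v" by (meson split_list)
    then have "2 * degree (run_weight fan 0 (v @ u)) \<le> starts w - 1"
      using degree_run_weight[of 0 "v @ u"] by (simp add: add.commute)
    moreover have "cyc_weight w = run_weight fan 0 (v @ u)" using hub_weight_split[of u v] w by (simp add: cyc_weight_def)
    ultimately show ?thesis using s(2) by simp
  next
    case False
    then show ?thesis using degree_wheel_fps[OF s(2)] by (simp add: cyc_weight_def)
  qed
  then show ?thesis using s False by (simp add: word_poly_def)
qed

lemma KL_wheel: "KL_graph (wheel n) = fps_nth wheel_fps n"
proof -
  have rank: "rank_in M F = rank_word (word_of n F)" if "F \<in> flats M" for F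
    using rank_word[OF word_of_flat(1)[OF that]] word_of_flat(2)[OF that] by simp
  have "KL_poly M = word_poly (word_of n {})"
  proof (rule KL_poly_eqI[where Q = "\<lambda>F. word_poly (word_of n F)", OF matroid_M loopless_M])
    have "spoke i \<in> edges (wheel n)" if "i < n" for i using that by (auto simp: edges_wheel)
    then have "word_of n (ground M) = replicate n Hub"
      by (intro nth_equalityI) (simp_all add: nth_word_of)
    moreover obtain m where "n = Suc m" using n by (cases n) auto
    ultimately show "word_poly (word_of n (ground M)) = 1"
      using hub_weight_split[of "[]" "replicate m Hub"] run_weight_replicate_Hub by (simp add: word_poly_def cyc_weight_def)
  next
    fix F assume F: "F \<in> flats M" "F \<noteq> ground M"
    have "rank_word (word_of n F) < n"
      using flat_rank_less[OF matroid_M F] rank[OF F(1)] rk_wheel by simp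
    then show "2 * degree (word_poly (word_of n F)) < rk M - rank_in M F"
      using degree_word_poly[OF word_of_flat(1)[OF F(1)]] rank[OF F(1)] rk_wheel by simp
  next
    fix F assume F: "F \<in> flats M"
    let ?w = "word_of n F"
    have "bij_betw (flat_of n) {v. good n v \<and> flat_of n ?w \<subseteq> flat_of n v} {G. G \<in> flats M \<and> F \<subseteq> G}"
      by (rule bij_betw_byWitness[where f' = "word_of n"])
        (use F in \<open>auto simp: word_of_flat_of word_of_flat flat_of_flat\<close>)
    from sum.reindex_bij_betw[OF this, of "\<lambda>G. monom 1 (rank_in M G - rank_in M F) * word_poly (word_of n G)"]
    have "(\<Sum>G | G \<in> flats M \<and> F \<subseteq> G. monom 1 (rank_in M G - rank_in M F) * word_poly (word_of n G))
      = (\<Sum>v | good n v \<and> flat_of n ?w \<subseteq> flat_of n v. monom 1 (rank_word v - rank_word ?w) * word_poly v)"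
    proof (rule trans[OF sym])
      show "(\<Sum>v | good n v \<and> flat_of n ?w \<subseteq> flat_of n v.
          monom 1 (rank_in M (flat_of n v) - rank_in M F) * word_poly (word_of n (flat_of n v)))
        = (\<Sum>v | good n v \<and> flat_of n ?w \<subseteq> flat_of n v. monom 1 (rank_word v - rank_word ?w) * word_poly v)"
        by (rule sum.cong) (simp_all add: rank_word word_of_flat_of rank[OF F])
    qed
    then show "palindromic (rk M - rank_in M F)
        (\<Sum>G | G \<in> flats M \<and> F \<subseteq> G. monom 1 (rank_in M G - rank_in M F) * word_poly (word_of n G))"
      using palindromic_above[OF word_of_flat(1)[OF F]] by (simp add: rank[OF F] rk_wheel)
  qed
  also have "word_of n {} = replicate n Start" by (intro nth_equalityI) (simp_all add: nth_word_of)
  also have "word_poly \<dots> = fps_nth wheel_fps n"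
  proof -
    have "starts (replicate n Start) = n" by (induction n) simp_all
    then show ?thesis using n by (simp add: word_poly_def cyc_weight_def)
  qed
  finally show ?thesis by (simp add: KL_graph_def)
qed

end

lemma wheel_KL_series_eq: "wheel_KL_series = wheel_fps"
proof (rule fps_ext)
  fix k
  show "fps_nth wheel_KL_series k = fps_nth wheel_fps k"
  proof (cases "k \<ge> 2")
    case True
    then interpret wheel_graph k by unfold_locales
    show ?thesis using True KL_wheel by (simp add: wheel_KL_series_def)
  next
    case False
    then have "k = 0 \<or> k = Suc 0" by linarith
    then show ?thesis using wheel_fps_0 wheel_fps_1 by (auto simp: wheel_KL_series_def)
  qed
qed

theorem theorem4p7:
  fixes t u :: "int poly fps" and U S :: "int poly fps fract"
  defines "t \<equiv> fps_const [:0, 1:]"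
    and "u \<equiv> fps_X"
    and "U \<equiv> to_fract u"
    and "S \<equiv> to_fract (fps_sqrt1 ((u - 1)\<^sup>2 - 4 * t * u\<^sup>2))"
  shows "to_fract wheel_KL_series =
      2 * (U - 1) / (S - U + 1)
      - 2 * (U\<^sup>2 + U - 1) / ((U + 1) * (S + U + 1))
      + 2 * U / ((U + 1) * S)"
  unfolding wheel_KL_series_eq t_def u_def U_def S_def by (rule wheel_fps_closed_form)

end
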